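(* Let $p\ge1$, let $a_1,\dots,a_{p-1}>0$ and $a>0$, and for $\lambda>0$ consider the (tuned) Fused Lasso penalty $$f_A(\beta)=\lambda\Vert A\beta\Vert_1=\lambda\sum_{i=1}^{p-1}a_i\vert\beta_{i+1}-\beta_i\vert+\lambda\sum_{i=1}^pa\vert\beta_i\vert,\qquad\beta\in\mathbb{R}^p.$$ In the linear model described in the context with covariance $C=\mathbb I$ (the identity matrix), let $\hat\beta_n$ be the minimizer over $\beta\in\mathbb{R}^p$ of $\frac12\Vert y-X\beta\Vert_2^2+n^{1/2}f_A(\beta)$. Then the Fused Lasso asymptotically recovers all its patterns, i.e. $$\text{for every }\beta^0\in\mathbb{R}^p:\qquad\lim_{n\to\infty}\mathbb P\big[I_A(\hat\beta_n)=I_A(\beta^0)\big]\underset{\lambda\to\infty}{\longrightarrow}1,$$ if and only if $(0,a_1,\dots,a_{p-1},0)$ forms a strictly concave sequence and $a>\max\{a_i+a_{i+1}:0\le i\le p-1\}$, where $a_0=a_p=0$.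
   Context: Linear model: $p$ is fixed and $\beta^0\in\mathbb{R}^p$. For each $n$, $y=X\beta^0+\varepsilon$ with $X=(X_1,\dots,X_n)^T\in\mathbb{R}^{n\times p}$ and $\varepsilon=(\varepsilon_1,\dots,\varepsilon_n)^T$, where $X_1,X_2,\dots$ are i.i.d. centered random vectors in $\mathbb{R}^p$ with covariance matrix $C$, $\varepsilon_1,\varepsilon_2,\dots$ are i.i.d. centered random variables with variance $\sigma^2>0$, and the sequences $(X_i)$ and $(\varepsilon_i)$ are independent. $A$ is the $(2p-1)\times p$ matrix such that the entries of $A\beta$ are $a_i(\beta_i-\beta_{i+1})$, $1\le i\le p-1$, and $a\beta_i$, $1\le i\le p$. The pattern $I_A(\beta)$ is identified with the sign vector $\operatorname{sgn}(A\beta)\in\{-1,0,1\}^{2p-1}$, so $I_A(\beta)=I_A(\beta')$ if and only if $\operatorname{sgn}(A\beta)=\operatorname{sgn}(A\beta')$. (Formally, $I_A(\beta)$ is the set of diagonal sign matrices $S$ with diagonal entries $\pm1$ maximizing $\langle S\boldsymbol\lambda,A\beta\rangle$, where $\boldsymbol\lambda=(\lambda,\dots,\lambda)^T$.) The sequence $(a_0,a_1,\dots,a_p)$ is strictly concave if there is a strictly concave function $F:\mathbb{R}\to\mathbb{R}$ with $a_i=F(i)$ for $i=0,1,\dots,p$. *)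

theory Defs
  imports "HOL-Probability.Probability"
begin

text \<open>
  Vectors of \<open>\<real>\<^sup>p\<close> are elements of \<^typ>\<open>real ^ 'p\<close> with \<open>p = CARD('p)\<close>. As the index type
  carries no order, a bijection \<open>ix\<close> from \<open>{1..p}\<close> onto \<open>'p\<close> numbers the coordinates, so that
  \<open>\<beta>\<^sub>i\<close> is \<open>\<beta> $ ix i\<close>. Vectors of \<open>\<real>\<^sup>2\<^sup>p\<^sup>-\<^sup>1\<close> and diagonal matrices of that size are functions
  on \<open>{1..2p-1}\<close>.
\<close>

text \<open>The \<open>j\<close>-th entry of \<open>A \<beta>\<close>, \<open>1 \<le> j \<le> 2p-1\<close>: the first \<open>p-1\<close> entries are
  \<open>a\<^sub>j (\<beta>\<^sub>j - \<beta>\<^sub>j\<^sub>+\<^sub>1)\<close>, the last \<open>p\<close> entries are \<open>b \<beta>\<^sub>i\<close> for \<open>i = j - (p-1)\<close>. The scalar called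
  \<open>a\<close> in the paper is \<open>b\<close> here.\<close>

definition fused_map ::
    "(nat \<Rightarrow> 'p::finite) \<Rightarrow> (nat \<Rightarrow> real) \<Rightarrow> real \<Rightarrow> real ^ 'p \<Rightarrow> nat \<Rightarrow> real" where
  "fused_map ix a b \<beta> j =
     (if j < CARD('p) then a j * (\<beta> $ ix j - \<beta> $ ix (j + 1))
      else b * \<beta> $ ix (j - (CARD('p) - 1)))"

definition fused_penalty ::
    "(nat \<Rightarrow> 'p::finite) \<Rightarrow> (nat \<Rightarrow> real) \<Rightarrow> real \<Rightarrow> real \<Rightarrow> real ^ 'p \<Rightarrow> real" where
  "fused_penalty ix a b lam \<beta> = lam * (\<Sum>j = 1..2 * CARD('p) - 1. \<bar>fused_map ix a b \<beta> j\<bar>)"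

text \<open>\<open>I\<^sub>A(\<beta>)\<close>: the diagonal sign matrices \<open>S\<close> maximizing \<open>\<langle>S (lam, \<dots>, lam)\<^sup>T, A \<beta>\<rangle>\<close>.
  A diagonal matrix is given by its diagonal.\<close>

definition fused_pattern ::
    "(nat \<Rightarrow> 'p::finite) \<Rightarrow> (nat \<Rightarrow> real) \<Rightarrow> real \<Rightarrow> real \<Rightarrow> real ^ 'p \<Rightarrow> (nat \<Rightarrow> real) set" where
  "fused_pattern ix a b lam \<beta> =
     {S \<in> {1..2 * CARD('p) - 1} \<rightarrow>\<^sub>E {-1, 1}.
        \<forall>T \<in> {1..2 * CARD('p) - 1} \<rightarrow>\<^sub>E {-1, 1}.
          (\<Sum>j = 1..2 * CARD('p) - 1. T j * lam * fused_map ix a b \<beta> j)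
            \<le> (\<Sum>j = 1..2 * CARD('p) - 1. S j * lam * fused_map ix a b \<beta> j)}"

text \<open>The observations are numbered from \<open>0\<close>: the first \<open>n\<close> rows of the design are
  \<open>X 0, \<dots>, X (n-1)\<close>.\<close>

definition response ::
    "(nat \<Rightarrow> 'w \<Rightarrow> real ^ 'p) \<Rightarrow> (nat \<Rightarrow> 'w \<Rightarrow> real) \<Rightarrow> real ^ 'p \<Rightarrow> nat \<Rightarrow> 'w \<Rightarrow> real" where
  "response X \<epsilon> \<beta>\<^sub>0 i \<omega> = X i \<omega> \<bullet> \<beta>\<^sub>0 + \<epsilon> i \<omega>"

definition fused_objective ::
    "(nat \<Rightarrow> 'p::finite) \<Rightarrow> (nat \<Rightarrow> real) \<Rightarrow> real \<Rightarrow> real \<Rightarrow> nat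
      \<Rightarrow> (nat \<Rightarrow> real ^ 'p) \<Rightarrow> (nat \<Rightarrow> real) \<Rightarrow> real ^ 'p \<Rightarrow> real" where
  "fused_objective ix a b lam n x y \<beta> =
     (1 / 2) * (\<Sum>i<n. (y i - x i \<bullet> \<beta>)\<^sup>2) + sqrt (real n) * fused_penalty ix a b lam \<beta>"

definition covariance_matrix :: "'w measure \<Rightarrow> ('w \<Rightarrow> real ^ 'p) \<Rightarrow> real ^ 'p ^ 'p" where
  "covariance_matrix M Z =
     (\<chi> j k. \<integral>\<omega>. (Z \<omega> $ j - (\<integral>\<omega>'. Z \<omega>' $ j \<partial>M)) * (Z \<omega> $ k - (\<integral>\<omega>'. Z \<omega>' $ k \<partial>M)) \<partial>M)"

definition strictly_concave :: "(real \<Rightarrow> real) \<Rightarrow> bool" where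
  "strictly_concave F \<longleftrightarrow>
     (\<forall>x y t. x \<noteq> y \<longrightarrow> 0 < t \<longrightarrow> t < 1 \<longrightarrow>
        (1 - t) * F x + t * F y < F ((1 - t) * x + t * y))"

text \<open>Strict concavity of the finite sequence \<open>a 0, \<dots>, a p\<close>.\<close>

definition strictly_concave_seq :: "nat \<Rightarrow> (nat \<Rightarrow> real) \<Rightarrow> bool" where
  "strictly_concave_seq p a \<longleftrightarrow>
     (\<exists>F. strictly_concave F \<and> (\<forall>i\<in>{0..p}. a i = F (real i)))"

lemma fused_penalty_eq:
  fixes ix :: "nat \<Rightarrow> 'p::finite"
  assumes "\<forall>i\<in>{1..<CARD('p)}. a i > 0" and "b > 0"
  shows "fused_penalty ix a b lam \<beta> =
    lam * (\<Sum>i = 1..<CARD('p). a i * \<bar>\<beta> $ ix (i + 1) - \<beta> $ ix i\<bar>)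
    + lam * (\<Sum>i = 1..CARD('p). b * \<bar>\<beta> $ ix i\<bar>)"
proof -
  let ?p = "CARD('p)"
  have p: "?p \<ge> 1" using zero_less_card_finite[where 'a='p] by linarith
  have split: "{1..2 * ?p - 1} = {1..<?p} \<union> {?p..2 * ?p - 1}"
    by (rule set_eqI, unfold Un_iff atLeastAtMost_iff atLeastLessThan_iff, insert p, linarith)
  have "(\<Sum>j = 1..2 * ?p - 1. \<bar>fused_map ix a b \<beta> j\<bar>) =
      (\<Sum>j = 1..<?p. \<bar>fused_map ix a b \<beta> j\<bar>) + (\<Sum>j = ?p..2 * ?p - 1. \<bar>fused_map ix a b \<beta> j\<bar>)"
    unfolding split by (rule sum.union_disjoint) auto
  moreover have "(\<Sum>j = 1..<?p. \<bar>fused_map ix a b \<beta> j\<bar>)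
      = (\<Sum>i = 1..<?p. a i * \<bar>\<beta> $ ix (i + 1) - \<beta> $ ix i\<bar>)"
  proof (rule sum.cong[OF refl])
    fix j assume j: "j \<in> {1..<?p}"
    then have "\<bar>a j\<bar> = a j" using assms(1) by (metis abs_of_pos)
    then show "\<bar>fused_map ix a b \<beta> j\<bar> = a j * \<bar>\<beta> $ ix (j + 1) - \<beta> $ ix j\<bar>"
      using j by (simp add: fused_map_def abs_mult abs_minus_commute)
  qed
  moreover have "(\<Sum>j = ?p..2 * ?p - 1. \<bar>fused_map ix a b \<beta> j\<bar>)
      = (\<Sum>i = 1..?p. b * \<bar>\<beta> $ ix i\<bar>)"
  proof -
    have "{?p..2 * ?p - 1} = {1 + (?p - 1)..?p + (?p - 1)}" using p by (simp add: mult_2)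
    then have "(\<Sum>j = ?p..2 * ?p - 1. \<bar>fused_map ix a b \<beta> j\<bar>)
        = (\<Sum>i = 1..?p. \<bar>fused_map ix a b \<beta> (i + (?p - 1))\<bar>)"
      by (simp only: sum.shift_bounds_cl_nat_ivl)
    also have "\<dots> = (\<Sum>i = 1..?p. b * \<bar>\<beta> $ ix i\<bar>)"
      using assms(2) by (intro sum.cong) (auto simp: fused_map_def abs_mult)
    finally show ?thesis .
  qed
  ultimately show ?thesis
    by (simp add: fused_penalty_def distrib_left)
qed

lemma fused_pattern_alt:
  fixes ix :: "nat \<Rightarrow> 'p::finite"
  assumes "lam > 0"
  shows "fused_pattern ix a b lam \<beta> =
    {S \<in> {1..2 * CARD('p) - 1} \<rightarrow>\<^sub>E {-1, 1}.
       \<forall>j\<in>{1..2 * CARD('p) - 1}. fused_map ix a b \<beta> j \<noteq> 0 \<longrightarrow> S j = sgn (fused_map ix a b \<beta> j)}"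
    (is "_ = ?R")
proof -
  define J where "J = {1..2 * CARD('p) - 1}"
  define v where "v = fused_map ix a b \<beta>"
  define \<S> :: "(nat \<Rightarrow> real) set" where "\<S> = J \<rightarrow>\<^sub>E {-1, 1}"
  define M where "M = (\<lambda>j. if j \<in> J then if v j < 0 then -1 else 1 else undefined :: real)"
  have M: "M \<in> \<S>" by (auto simp: M_def \<S>_def)
  have fin: "finite J" by (simp add: J_def)
  have term_le: "T j * lam * v j \<le> lam * \<bar>v j\<bar>" if "T \<in> \<S>" "j \<in> J" for T j
  proof -
    have "T j = -1 \<or> T j = 1" using that by (auto simp: \<S>_def PiE_iff)
    moreover have "- (lam * v j) \<le> lam * \<bar>v j\<bar>" "lam * v j \<le> lam * \<bar>v j\<bar>"
      using assms mult_left_mono[of "v j" "\<bar>v j\<bar>" lam] mult_left_mono[of "- v j" "\<bar>v j\<bar>" lam] by auto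
    ultimately show ?thesis by auto
  qed
  have term_eq: "T j * lam * v j = lam * \<bar>v j\<bar> \<longleftrightarrow> (v j \<noteq> 0 \<longrightarrow> T j = sgn (v j))"
    if "T \<in> \<S>" "j \<in> J" for T j
  proof -
    have "T j = -1 \<or> T j = 1" using that by (auto simp: \<S>_def PiE_iff)
    then show ?thesis using assms by (auto simp: sgn_if abs_if)
  qed
  have Msum: "(\<Sum>j\<in>J. M j * lam * v j) = (\<Sum>j\<in>J. lam * \<bar>v j\<bar>)"
    by (intro sum.cong) (auto simp: M_def)
  have "(\<forall>T\<in>\<S>. (\<Sum>j\<in>J. T j * lam * v j) \<le> (\<Sum>j\<in>J. S j * lam * v j))
      \<longleftrightarrow> (\<forall>j\<in>J. v j \<noteq> 0 \<longrightarrow> S j = sgn (v j))" (is "?max \<longleftrightarrow> ?sgn") if S: "S \<in> \<S>" for S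
  proof
    assume ?max
    then have "(\<Sum>j\<in>J. lam * \<bar>v j\<bar>) \<le> (\<Sum>j\<in>J. S j * lam * v j)" using M Msum by metis
    then have "(\<Sum>j\<in>J. S j * lam * v j) = (\<Sum>j\<in>J. lam * \<bar>v j\<bar>)"
      using sum_mono[of J "\<lambda>j. S j * lam * v j" "\<lambda>j. lam * \<bar>v j\<bar>"] term_le[OF S] by (simp add: antisym)
    then have "\<forall>j\<in>J. S j * lam * v j = lam * \<bar>v j\<bar>"
      using sum_mono_inv[of "\<lambda>j. S j * lam * v j" J "\<lambda>j. lam * \<bar>v j\<bar>"] term_le[OF S] fin by blast
    then show ?sgn using term_eq[OF S] by blast
  next
    assume ?sgn
    then have "(\<Sum>j\<in>J. S j * lam * v j) = (\<Sum>j\<in>J. lam * \<bar>v j\<bar>)"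
      using term_eq[OF S] by (intro sum.cong) auto
    moreover have "(\<Sum>j\<in>J. T j * lam * v j) \<le> (\<Sum>j\<in>J. lam * \<bar>v j\<bar>)" if "T \<in> \<S>" for T
      using term_le[OF that] by (rule sum_mono)
    ultimately show ?max by simp
  qed
  then show ?thesis
    unfolding fused_pattern_def J_def[symmetric] v_def[symmetric] \<S>_def[symmetric] by blast
qed

lemma fused_pattern_eq_iff:
  fixes ix :: "nat \<Rightarrow> 'p::finite"
  assumes "lam > 0"
  shows "fused_pattern ix a b lam \<beta> = fused_pattern ix a b lam \<beta>' \<longleftrightarrow>
    (\<forall>j\<in>{1..2 * CARD('p) - 1}. sgn (fused_map ix a b \<beta> j) = sgn (fused_map ix a b \<beta>' j))"
proof
  define J where "J = {1..2 * CARD('p) - 1}"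
  define P where "P = (\<lambda>v :: nat \<Rightarrow> real.
    {S \<in> J \<rightarrow>\<^sub>E {-1, 1}. \<forall>j\<in>J. v j \<noteq> 0 \<longrightarrow> S j = sgn (v j)})"
  have P: "fused_pattern ix a b lam \<beta> = P (fused_map ix a b \<beta>)" for \<beta>
    unfolding P_def J_def by (rule fused_pattern_alt[OF assms])
  have sgn_vals: "(\<lambda>S. S j) ` P v = (if v j = 0 then {-1, 1} else {sgn (v j)})" if j: "j \<in> J" for v j
  proof -
    define M where "M = (\<lambda>s :: real. \<lambda>i. if i \<in> J then if v i = 0 then s else sgn (v i) else undefined)"
    have "M s \<in> P v" if "s \<in> {-1, 1}" for s
      using that by (auto simp: M_def P_def sgn_if split: if_splits)
    then have "M s j \<in> (\<lambda>S. S j) ` P v" if "s \<in> {-1, 1}" for s using that by blast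
    moreover have "M s j = (if v j = 0 then s else sgn (v j))" for s using j by (simp add: M_def)
    moreover have "(\<lambda>S. S j) ` P v \<subseteq> (if v j = 0 then {-1, 1} else {sgn (v j)})"
      using j by (auto simp: P_def PiE_iff)
    ultimately show ?thesis by (auto split: if_splits)
  qed
  {
    assume "fused_pattern ix a b lam \<beta> = fused_pattern ix a b lam \<beta>'"
    then have eq: "P (fused_map ix a b \<beta>) = P (fused_map ix a b \<beta>')" by (simp add: P)
    show "\<forall>j\<in>{1..2 * CARD('p) - 1}. sgn (fused_map ix a b \<beta> j) = sgn (fused_map ix a b \<beta>' j)"
    proof
      fix j assume "j \<in> {1..2 * CARD('p) - 1}"
      then have j: "j \<in> J" by (simp add: J_def)
      have "{-1, 1} \<noteq> {x}" for x :: real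
        by (metis insertI1 insert_commute one_neq_neg_one singletonD)
      then show "sgn (fused_map ix a b \<beta> j) = sgn (fused_map ix a b \<beta>' j)"
        using sgn_vals[OF j, of "fused_map ix a b \<beta>"] sgn_vals[OF j, of "fused_map ix a b \<beta>'"] eq
        by (auto split: if_splits)
    qed
  next
    assume "\<forall>j\<in>{1..2 * CARD('p) - 1}. sgn (fused_map ix a b \<beta> j) = sgn (fused_map ix a b \<beta>' j)"
    then show "fused_pattern ix a b lam \<beta> = fused_pattern ix a b lam \<beta>'"
      unfolding P P_def J_def[symmetric] by (metis (mono_tags, lifting) sgn_0_0)
  }
qed

end

theory Submission
  imports Defs
begin

text \<open>
  Write \<open>W\<^sub>n = n\<^sup>-\<^sup>1\<^sup>/\<^sup>2 X\<^sup>T \<epsilon>\<close>. Near the truth \<open>z\<close> the penalty increment is \<open>\<langle>s, u\<rangle> + h(u)\<close>, where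
  \<open>h\<close> collects the rows of \<open>A\<close> annihilating \<open>z\<close>; let \<open>K\<close> be the common kernel of these rows. With
  probability close to \<open>1\<close> the pattern is recovered iff the estimation error lies in \<open>K\<close>. As the
  normalised Gram matrix tends to the identity, this holds up to an arbitrarily small tolerance iff
  \<open>\<langle>W\<^sub>n, v\<rangle> \<le> \<lambda> (\<langle>s, v\<rangle> + h(v))\<close> for all \<open>v \<in> K\<^sup>\<bottom>\<close>, and finitely many \<open>v\<close> suffice because \<open>h\<close> is
  the support function of a polytope.

  The probability of such a system of half-space constraints converges: by the one-dimensional
  central limit theorem \<open>E cos (\<langle>W\<^sub>n, t\<rangle> + c)\<close> converges for all \<open>t\<close>, \<open>c\<close>, products of trigonometric
  polynomials of linear functionals approximate the indicator, and boundary layers are negligible.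
  The limit itself is never needed: if \<open>\<langle>s, v\<rangle> + h(v) > 0\<close> on \<open>K\<^sup>\<bottom> - {0}\<close>, Chebyshev's inequality
  bounds it from below by \<open>1 - O(\<lambda>\<^sup>-\<^sup>2)\<close>; otherwise a half-space keeps it away from \<open>1\<close> for all \<open>\<lambda>\<close>.

  For the Fused Lasso, the positivity for all \<open>z\<close> is tested on vectors \<open>z\<close> with a single tie
  (\<open>v = e\<^sub>i - e\<^sub>i\<^sub>+\<^sub>1\<close> or \<open>v = e\<^sub>i\<close>), and follows in general from a dual certificate that
  interpolates linearly on the blocks of \<open>z\<close>.
\<close>

section \<open>Local geometry of an absolute-value penalty\<close>

text \<open>Write \<open>u\<close> for the estimation error. Divided by sqrt n, the objective is, up
  to a constant, (sqrt n / 2) c(u, u) - <u, W_n> + lam * (penalty increment), with \<open>c\<close>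
  the normalised Gram form. Its minimizer has norm O(1 / sqrt n) as long as \<open>W_n\<close> is
  bounded, so eventually no row that is nonzero at \<open>z\<close> changes sign and the increment
  formula is exact. The obstacle is the cross term sqrt n * c(v, k) between the tie part
  \<open>k\<close> and the normal part \<open>v\<close> of \<open>u\<close>. For the identity it
  vanishes; for a nearby form it is at most a constant times the distance to the identity times the
  norm of \<open>v\<close>. This remainder is the tolerance: recovery is not equal to a system of
  inequalities in \<open>W_n\<close> but lies between two of them. The passage to finitely many
  directions is what allows union bounds, since each direction costs one boundary layer and one
  Chebyshev estimate. Convergence to an unidentified limit is obtained from the Cauchy criterion, by
  approximating with sequences already known to converge.\<close>

locale generalized_lasso =
  fixes J :: "'j set" and l :: "'j \<Rightarrow> 'v::euclidean_space" and z :: 'v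
  assumes finite_rows: "finite J"
begin

definition penalty :: "'v \<Rightarrow> real" where
  "penalty x = (\<Sum>j\<in>J. \<bar>l j \<bullet> x\<bar>)"

definition ties :: "'j set" where
  "ties = {j \<in> J. l j \<bullet> z = 0}"

definition tie_space :: "'v set" where
  "tie_space = {u. \<forall>j\<in>ties. l j \<bullet> u = 0}"

definition normal_space :: "'v set" where
  "normal_space = {v. \<forall>u\<in>tie_space. v \<bullet> u = 0}"

definition slope :: 'v where
  "slope = (\<Sum>j\<in>J - ties. sgn (l j \<bullet> z) *\<^sub>R l j)"

definition kink :: "'v \<Rightarrow> real" where
  "kink v = (\<Sum>j\<in>ties. \<bar>l j \<bullet> v\<bar>)"

definition same_signs :: "'v \<Rightarrow> bool" where
  "same_signs x \<longleftrightarrow> (\<forall>j\<in>J. sgn (l j \<bullet> x) = sgn (l j \<bullet> z))"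

lemma ties_subset: "ties \<subseteq> J"
  by (auto simp: ties_def)

lemma finite_ties: "finite ties"
  using finite_rows ties_subset finite_subset by blast

lemma subspace_tie_space: "subspace tie_space"
  unfolding tie_space_def by (rule subspaceI) (auto simp: inner_add_right)

lemma decompose:
  obtains k v where "k \<in> tie_space" "v \<in> normal_space" "x = k + v"
proof -
  obtain y w where "y \<in> span tie_space" "\<And>u. u \<in> span tie_space \<Longrightarrow> orthogonal w u" "x = y + w"
    using orthogonal_subspace_decomp_exists[of tie_space x] by metis
  moreover have "span tie_space = tie_space"
    using subspace_tie_space by (simp add: span_eq_iff)
  ultimately have "y \<in> tie_space" "w \<in> normal_space" "x = y + w"
    by (auto simp: normal_space_def orthogonal_def)
  then show thesis ..
qed

lemma normal_orthogonal: "v \<in> normal_space \<Longrightarrow> u \<in> tie_space \<Longrightarrow> v \<bullet> u = 0"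
  by (auto simp: normal_space_def)

lemma norm_tie_part_le:
  assumes "k \<in> tie_space" "v \<in> normal_space"
  shows "norm k \<le> norm (k + v)"
proof (rule power2_le_imp_le)
  have "k \<bullet> v = 0" using assms by (metis normal_orthogonal inner_commute)
  then have "(norm (k + v))\<^sup>2 = (norm k)\<^sup>2 + (norm v)\<^sup>2"
    by (simp add: power2_norm_eq_inner inner_add inner_commute)
  then show "(norm k)\<^sup>2 \<le> (norm (k + v))\<^sup>2" by simp
qed simp

lemma kink_add_tie: "k \<in> tie_space \<Longrightarrow> kink (k + v) = kink v"
  unfolding kink_def by (intro sum.cong) (auto simp: tie_space_def inner_add_right)

lemma kink_nonneg: "0 \<le> kink v"
  unfolding kink_def by (simp add: sum_nonneg)

lemma kink_scale: "kink (t *\<^sub>R v) = \<bar>t\<bar> * kink v"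
  unfolding kink_def by (simp add: abs_mult sum_distrib_left)

text \<open>\<open>kink\<close> is a seminorm with kernel \<open>tie_space\<close>, and a vector
  lying both there and in \<open>normal_space\<close> is orthogonal to itself.\<close>

lemma kink_pos:
  assumes "v \<in> normal_space" "v \<noteq> 0"
  shows "0 < kink v"
proof (rule ccontr)
  assume "\<not> 0 < kink v"
  then have "kink v = 0" using kink_nonneg[of v] by simp
  then have "v \<in> tie_space"
    unfolding kink_def tie_space_def using finite_ties by (simp add: sum_nonneg_eq_0_iff)
  then show False using assms normal_orthogonal by fastforce
qed

lemma slope_inner: "slope \<bullet> v = (\<Sum>j\<in>J - ties. sgn (l j \<bullet> z) * (l j \<bullet> v))"
  by (simp add: slope_def inner_sum_left)

lemma penalty_split: "penalty x = (\<Sum>j\<in>J - ties. \<bar>l j \<bullet> x\<bar>) + (\<Sum>j\<in>ties. \<bar>l j \<bullet> x\<bar>)"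
  unfolding penalty_def using sum.subset_diff[OF ties_subset finite_rows] by blast

text \<open>A row that is nonzero at \<open>z\<close> keeps its sign, so its absolute value changes
  linearly; a tie row vanishes at \<open>z\<close> and contributes its full absolute value at
  \<open>u\<close>.\<close>

lemma penalty_increment_eq:
  assumes "\<And>j. j \<in> J - ties \<Longrightarrow> \<bar>l j \<bullet> u\<bar> < \<bar>l j \<bullet> z\<bar>"
  shows "penalty (z + u) - penalty z = slope \<bullet> u + kink u"
proof -
  have "sgn x * y = \<bar>x + y\<bar> - \<bar>x\<bar>" if "\<bar>y\<bar> < \<bar>x\<bar>" for x y :: real using that by (auto simp: sgn_if)
  then have "slope \<bullet> u = (\<Sum>j\<in>J - ties. \<bar>l j \<bullet> (z + u)\<bar> - \<bar>l j \<bullet> z\<bar>)"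
    unfolding slope_inner using assms by (intro sum.cong) (auto simp: inner_add_right)
  moreover have "kink u = (\<Sum>j\<in>ties. \<bar>l j \<bullet> (z + u)\<bar> - \<bar>l j \<bullet> z\<bar>)"
    unfolding kink_def by (intro sum.cong) (auto simp: inner_add_right ties_def)
  ultimately show ?thesis
    unfolding penalty_split by (simp add: sum_subtractf)
qed

lemma same_signs_iff_tie_space:
  assumes "\<And>j. j \<in> J - ties \<Longrightarrow> \<bar>l j \<bullet> u\<bar> < \<bar>l j \<bullet> z\<bar>"
  shows "same_signs (z + u) \<longleftrightarrow> u \<in> tie_space"
proof -
  have "sgn (x + y) = sgn x" if "\<bar>y\<bar> < \<bar>x\<bar>" for x y :: real using that by (auto simp: sgn_if)
  then have "sgn (l j \<bullet> (z + u)) = sgn (l j \<bullet> z)" if "j \<in> J - ties" for j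
    using assms[OF that] by (simp add: inner_add_right)
  moreover have "sgn (l j \<bullet> (z + u)) = sgn (l j \<bullet> z) \<longleftrightarrow> l j \<bullet> u = 0" if "j \<in> ties" for j
    using that by (simp add: ties_def inner_add_right sgn_zero_iff)
  ultimately show ?thesis
    unfolding same_signs_def tie_space_def using ties_subset by blast
qed

lemma signs_stable_radius:
  obtains r where "r > 0" "\<And>u j. norm u < r \<Longrightarrow> j \<in> J - ties \<Longrightarrow> \<bar>l j \<bullet> u\<bar> < \<bar>l j \<bullet> z\<bar>"
proof -
  \<comment> \<open>The \<open>insert 1\<close> keeps the minimum meaningful when every row is a
    tie; the \<open>+ 1\<close> makes the denominators positive and leaves slack for the strict
    inequality.\<close>
  define D where "D = insert 1 ((\<lambda>j. \<bar>l j \<bullet> z\<bar> / (norm (l j) + 1)) ` (J - ties))"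
  have D: "finite D" "D \<noteq> {}" using finite_rows by (auto simp: D_def)
  have "0 < d" if "d \<in> D" for d
    using that by (auto simp: D_def ties_def intro!: divide_pos_pos add_nonneg_pos)
  then have "Min D > 0" using D by simp
  moreover have "\<bar>l j \<bullet> u\<bar> < \<bar>l j \<bullet> z\<bar>" if "norm u < Min D" "j \<in> J - ties" for u j
  proof -
    have "Min D \<le> \<bar>l j \<bullet> z\<bar> / (norm (l j) + 1)"
      using that D by (intro Min_le) (auto simp: D_def)
    then have "norm u < \<bar>l j \<bullet> z\<bar> / (norm (l j) + 1)" using that by linarith
    moreover have "0 < norm (l j) + 1" by (smt (verit) norm_ge_zero)
    ultimately have "norm u * (norm (l j) + 1) < \<bar>l j \<bullet> z\<bar>" by (simp add: pos_less_divide_eq)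
    moreover have "\<bar>l j \<bullet> u\<bar> \<le> norm (l j) * norm u" by (rule Cauchy_Schwarz_ineq2)
    moreover have "norm u * (norm (l j) + 1) = norm (l j) * norm u + norm u" by (simp add: algebra_simps)
    ultimately show ?thesis by (smt (verit) norm_ge_zero)
  qed
  ultimately show thesis ..
qed

lemma penalty_lipschitz: "\<bar>penalty (x + u) - penalty x\<bar> \<le> (\<Sum>j\<in>J. norm (l j)) * norm u"
proof -
  have "\<bar>penalty (x + u) - penalty x\<bar> \<le> (\<Sum>j\<in>J. \<bar>\<bar>l j \<bullet> (x + u)\<bar> - \<bar>l j \<bullet> x\<bar>\<bar>)"
    unfolding penalty_def sum_subtractf[symmetric] by (rule sum_abs)
  also have "\<dots> \<le> (\<Sum>j\<in>J. norm (l j) * norm u)"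
  proof (rule sum_mono)
    fix j
    have "\<bar>\<bar>l j \<bullet> (x + u)\<bar> - \<bar>l j \<bullet> x\<bar>\<bar> \<le> \<bar>l j \<bullet> u\<bar>" by (simp add: inner_add_right)
    also have "\<dots> \<le> norm (l j) * norm u" by (rule Cauchy_Schwarz_ineq2)
    finally show "\<bar>\<bar>l j \<bullet> (x + u)\<bar> - \<bar>l j \<bullet> x\<bar>\<bar> \<le> norm (l j) * norm u" .
  qed
  finally show ?thesis by (simp add: sum_distrib_right)
qed

text \<open>\<open>kink\<close> is the support function of a polytope in the normal space, hence finitely many
  directions decide whether a linear functional is dominated by it.\<close>

lemma kink_finite_test:
  obtains E where "finite E" "E \<subseteq> normal_space - {0}"
    "\<And>x v. (\<And>e. e \<in> E \<Longrightarrow> x \<bullet> e \<le> kink e) \<Longrightarrow> v \<in> normal_space \<Longrightarrow> x \<bullet> v \<le> kink v"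
proof -
  \<comment> \<open>The hull of all signed sums of tie rows is a zonotope, and maximising over the
    signs shows that \<open>kink\<close> is its support function.\<close>
  define V where "V = (\<lambda>S. \<Sum>j\<in>ties. S j *\<^sub>R l j) ` (ties \<rightarrow>\<^sub>E {-1, 1 :: real})"
  define B where "B = convex hull V"
  have finV: "finite V" unfolding V_def using finite_ties by (intro finite_imageI finite_PiE) auto
  have V_le: "x \<bullet> v \<le> kink v" if xV: "x \<in> V" for x v
  proof -
    from xV obtain S where S: "S \<in> ties \<rightarrow>\<^sub>E {-1, 1}" and x: "x = (\<Sum>j\<in>ties. S j *\<^sub>R l j)"
      unfolding V_def by blast
    show ?thesis unfolding x kink_def inner_sum_left
    proof (rule sum_mono)
      fix j assume "j \<in> ties"
      then have "S j = -1 \<or> S j = 1" using S by (auto simp: PiE_iff)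
      then show "(S j *\<^sub>R l j) \<bullet> v \<le> \<bar>l j \<bullet> v\<bar>" by auto
    qed
  qed
  have V_attain: "\<exists>x\<in>V. x \<bullet> v = kink v" for v
  proof
    define S where "S = (\<lambda>j. if j \<in> ties then if l j \<bullet> v < 0 then -1 else 1 else undefined :: real)"
    have "S \<in> ties \<rightarrow>\<^sub>E {-1, 1}" by (auto simp: S_def)
    then show "(\<Sum>j\<in>ties. S j *\<^sub>R l j) \<in> V" unfolding V_def by blast
    show "(\<Sum>j\<in>ties. S j *\<^sub>R l j) \<bullet> v = kink v"
      unfolding inner_sum_left kink_def by (intro sum.cong) (auto simp: S_def)
  qed
  have B_le: "x \<bullet> v \<le> kink v" if "x \<in> B" for x v
  proof -
    have "B \<subseteq> {x. v \<bullet> x \<le> kink v}" unfolding B_def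
      using V_le by (intro hull_minimal convex_halfspace_le) (auto simp: inner_commute)
    then show ?thesis using that by (auto simp: inner_commute)
  qed
  have V_sub: "V \<subseteq> B" unfolding B_def by (rule hull_subset)
  \<comment> \<open>A polytope is cut out by finitely many half-spaces; the test directions are
    their normals.\<close>
  have "polyhedron B"
    unfolding B_def using finV by (intro polytope_imp_polyhedron polytope_convex_hull)
  then obtain F where F: "finite F" "B = \<Inter>F" and "\<forall>H\<in>F. \<exists>d c. d \<noteq> 0 \<and> H = {x. d \<bullet> x \<le> c}"
    unfolding polyhedron_def by blast
  then obtain d c where dc: "\<And>H. H \<in> F \<Longrightarrow> H = {x. d H \<bullet> x \<le> c H}" by metis
  \<comment> \<open>The normals are projected to \<open>normal_space\<close>. This leaves
    \<open>kink\<close> unchanged, because it ignores tie components.\<close>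
  have "\<exists>e. e \<in> normal_space \<and> d H - e \<in> tie_space" for H
    using decompose[of "d H"] by (metis add_diff_cancel_right')
  then obtain e where e: "\<And>H. e H \<in> normal_space" "\<And>H. d H - e H \<in> tie_space" by metis
  \<comment> \<open>The zero vector is dropped from the test set: the test there always succeeds,
    and later each direction must have a nondegenerate Gaussian limit.\<close>
  have *: "x \<bullet> v \<le> kink v"
    if x: "\<And>y. y \<in> e ` F - {0} \<Longrightarrow> x \<bullet> y \<le> kink y" and v: "v \<in> normal_space" for x v
  proof -
    \<comment> \<open>The projection \<open>q\<close> acts like \<open>x\<close> on
      \<open>normal_space\<close>, and its product with a facet normal equals that of
      \<open>x\<close> with the projected normal. So the finite test places \<open>q\<close> in the
      polytope.\<close>
    obtain k q where kq: "k \<in> tie_space" "q \<in> normal_space" "x = k + q" by (rule decompose)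
    have normal: "q \<bullet> v = x \<bullet> v" if "v \<in> normal_space" for v
      using kq(3) normal_orthogonal[OF that kq(1)] by (simp add: inner_add_left inner_commute[of k])
    have "q \<in> H" if H: "H \<in> F" for H
    proof -
      have "d H \<bullet> q = x \<bullet> e H"
        using normal[OF e(1)[of H]] normal_orthogonal[OF kq(2) e(2)[of H]]
        by (simp add: inner_diff_right inner_commute)
      also have "\<dots> \<le> kink (e H)"
      proof (cases "e H = 0")
        case True
        then show ?thesis by (simp add: kink_nonneg)
      next
        case False
        then show ?thesis using x H by blast
      qed
      also have "\<dots> = kink (d H)" using kink_add_tie[OF e(2)[of H], of "e H"] by simp
      also have "\<dots> \<le> c H"
      proof -
        obtain y where "y \<in> V" "y \<bullet> d H = kink (d H)" using V_attain by blast
        then have "y \<in> H" using V_sub F(2) H by blast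
        then have "d H \<bullet> y \<le> c H" using dc[OF H] by (metis mem_Collect_eq)
        then show ?thesis using \<open>y \<bullet> d H = kink (d H)\<close> by (simp add: inner_commute)
      qed
      finally show ?thesis using dc[OF H] by blast
    qed
    then have "q \<in> B" using F by blast
    then show ?thesis using B_le normal[OF v] by metis
  qed
  show thesis
  proof (rule that)
    show "finite (e ` F - {0})" using F by blast
    show "e ` F - {0} \<subseteq> normal_space - {0}" using e by blast
    show "x \<bullet> v \<le> kink v"
      if "\<And>y. y \<in> e ` F - {0} \<Longrightarrow> x \<bullet> y \<le> kink y" "v \<in> normal_space" for x v
      using * that by blast
  qed
qed

text \<open>Roles: \<open>m\<close> is sqrt n, \<open>c\<close> the normalised Gram form,
  \<open>w\<close> the noise vector \<open>W n\<close>, \<open>u\<^sub>0\<close> the estimation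
  error, and \<open>r\<close> a radius within which rows nonzero at \<open>z\<close> keep their
  sign. \<open>\<delta> \<le> 1 / 2\<close> makes \<open>c\<close> coercive, and
  \<open>large\<close> puts the a priori bound on \<open>u\<^sub>0\<close> below
  \<open>r\<close>.\<close>

context
  fixes c :: "'v \<Rightarrow> 'v \<Rightarrow> real" and w u\<^sub>0 :: 'v and m lam \<delta> R r :: real
  assumes bilinear: "bilinear c" and sym: "\<And>u v. c u v = c v u"
    and near: "\<And>u v. \<bar>c u v - u \<bullet> v\<bar> \<le> \<delta> * norm u * norm v"
    and \<delta>: "\<delta> \<le> 1 / 2" and m: "0 < m" and lam: "0 < lam" and w: "norm w \<le> R"
    and r: "\<And>u j. norm u < r \<Longrightarrow> j \<in> J - ties \<Longrightarrow> \<bar>l j \<bullet> u\<bar> < \<bar>l j \<bullet> z\<bar>"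
    and large: "4 * (R + lam * (\<Sum>j\<in>J. norm (l j))) < r * m"
    and minimal: "\<And>u. m / 2 * c u\<^sub>0 u\<^sub>0 - u\<^sub>0 \<bullet> w + lam * (penalty (z + u\<^sub>0) - penalty z)
                   \<le> m / 2 * c u u - u \<bullet> w + lam * (penalty (z + u) - penalty z)"
begin

lemma quadratic_ge: "(norm u)\<^sup>2 / 2 \<le> c u u"
proof -
  have "u \<bullet> u - c u u \<le> \<delta> * norm u * norm u" using near[of u u] by linarith
  also have "\<dots> \<le> 1 / 2 * (norm u)\<^sup>2"
    using mult_right_mono[OF \<delta>, of "(norm u)\<^sup>2"] by (simp add: power2_eq_square)
  finally show ?thesis by (simp add: power2_norm_eq_inner)
qed

text \<open>Comparison with \<open>u = 0\<close>: coercivity gives m/4 times the squared norm on the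
  left, Cauchy-Schwarz and the Lipschitz constant of the penalty give a linear bound on the right,
  and one factor of the norm cancels.\<close>

lemma minimizer_bound: "norm u\<^sub>0 * m \<le> 4 * (R + lam * (\<Sum>j\<in>J. norm (l j)))" (is "_ \<le> 4 * (R + lam * ?G)")
proof (cases "u\<^sub>0 = 0")
  case True
  have "0 \<le> R" using w norm_ge_zero order_trans by blast
  then show ?thesis using lam True by (simp add: sum_nonneg)
next
  case False
  have "c 0 0 = 0" using bilinear_lzero[OF bilinear] by blast
  then have "m / 2 * c u\<^sub>0 u\<^sub>0 \<le> u\<^sub>0 \<bullet> w - lam * (penalty (z + u\<^sub>0) - penalty z)"
    using minimal[of 0] by simp
  moreover have "u\<^sub>0 \<bullet> w \<le> norm u\<^sub>0 * R"
    using norm_cauchy_schwarz[of u\<^sub>0 w] mult_left_mono[OF w, of "norm u\<^sub>0"] by simp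
  moreover have "lam * (- (penalty (z + u\<^sub>0) - penalty z)) \<le> lam * (?G * norm u\<^sub>0)"
    using penalty_lipschitz[of z u\<^sub>0] lam by (intro mult_left_mono) auto
  moreover have "m / 2 * ((norm u\<^sub>0)\<^sup>2 / 2) \<le> m / 2 * c u\<^sub>0 u\<^sub>0"
    using quadratic_ge[of u\<^sub>0] m by (intro mult_left_mono) auto
  ultimately have "m / 2 * ((norm u\<^sub>0)\<^sup>2 / 2) \<le> norm u\<^sub>0 * R + lam * (?G * norm u\<^sub>0)" by linarith
  then have "norm u\<^sub>0 * (norm u\<^sub>0 * m) \<le> norm u\<^sub>0 * (4 * (R + lam * ?G))"
    by (simp add: algebra_simps power2_eq_square)
  then show ?thesis using False by simp
qed

lemma minimizer_small: "norm u\<^sub>0 < r"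
  using minimizer_bound large m by (smt (verit) mult_le_cancel_right)

lemma minimizer_same_signs_iff: "same_signs (z + u\<^sub>0) \<longleftrightarrow> u\<^sub>0 \<in> tie_space"
  using r[OF minimizer_small] by (rule same_signs_iff_tie_space)

text \<open>The factor \<open>m\<close> is absorbed by the minimizer being of order 1/m, so the
  error is proportional to \<open>\<delta>\<close> with a constant free of \<open>m\<close>. It is
  applied with \<open>k\<close> the tie part of \<open>u\<^sub>0\<close> or \<open>u\<^sub>0\<close>
  itself.\<close>

lemma scaled_near:
  assumes "norm k \<le> norm u\<^sub>0"
  shows "m * \<bar>c v k - v \<bullet> k\<bar> \<le> \<delta> * (4 * (R + lam * (\<Sum>j\<in>J. norm (l j)))) * norm v" (is "_ \<le> \<delta> * ?R * _")
proof (cases "v = 0")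
  case True
  then show ?thesis using bilinear_lzero[OF bilinear] by simp
next
  case False
  \<comment> \<open>Evaluating \<open>near\<close> at a nonzero vector forces
    \<open>\<delta>\<close> to be nonnegative.\<close>
  have "0 \<le> \<bar>c v v - v \<bullet> v\<bar>" by simp
  also have "\<dots> \<le> \<delta> * (norm v * norm v)" using near[of v v] by (simp add: mult.assoc)
  finally have "0 \<le> \<delta> * (norm v * norm v)" .
  moreover have "0 < norm v * norm v" using False by simp
  ultimately have \<delta>0: "0 \<le> \<delta>" by (metis not_less mult_less_0_iff)
  have "m * \<bar>c v k - v \<bullet> k\<bar> \<le> m * (\<delta> * norm v * norm k)"
    using near[of v k] m by (intro mult_left_mono) auto
  also have "\<dots> = \<delta> * norm v * (norm k * m)" by (simp add: algebra_simps)
  also have "\<dots> \<le> \<delta> * norm v * ?R"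
    using \<delta>0 order_trans[OF mult_right_mono[OF assms less_imp_le[OF m]] minimizer_bound]
    by (intro mult_left_mono) auto
  finally show ?thesis by (simp add: algebra_simps)
qed

text \<open>Near \<open>z\<close> the penalty is linear along \<open>tie_space\<close>, and
  \<open>kink\<close> does not see the tie component. Hence \<open>k\<close> and \<open>v\<close>
  interact only through the quadratic form, in the term \<open>m * c v k\<close>.\<close>

lemma increment_add_normal:
  assumes "k \<in> tie_space" "norm k < r" "norm (k + v) < r"
  shows "(m / 2 * c (k + v) (k + v) - (k + v) \<bullet> w + lam * (penalty (z + (k + v)) - penalty z))
       - (m / 2 * c k k - k \<bullet> w + lam * (penalty (z + k) - penalty z))
       = m * c v k + m / 2 * c v v - v \<bullet> w + lam * (slope \<bullet> v + kink v)"
proof -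
  have "penalty (z + k) - penalty z = slope \<bullet> k"
    using penalty_increment_eq[OF r[OF assms(2)]] kink_add_tie[OF assms(1), of 0]
    by (simp add: kink_def)
  moreover have "penalty (z + (k + v)) - penalty z = slope \<bullet> k + slope \<bullet> v + kink v"
    using penalty_increment_eq[OF r[OF assms(3)]] kink_add_tie[OF assms(1), of v]
    by (simp add: inner_add_right)
  moreover have "c (k + v) (k + v) = c k k + 2 * c v k + c v v"
    by (simp add: bilinear_ladd[OF bilinear] bilinear_radd[OF bilinear] sym[of k v])
  ultimately show ?thesis by (simp add: algebra_simps)
qed

text \<open>\<open>u\<^sub>0 = k + v\<close> is compared with its own tie part \<open>k\<close>.
  Keeping \<open>v\<close> gains at least \<open>\<eta> * norm v\<close> in cost by domination,
  while the cross term can save at most a smaller multiple of \<open>norm v\<close>; so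
  \<open>v = 0\<close>.\<close>

lemma minimizer_tie_space:
  assumes dom: "\<And>v. v \<in> normal_space \<Longrightarrow> w \<bullet> v + \<eta> * norm v \<le> lam * (slope \<bullet> v + kink v)"
    and \<eta>: "\<delta> * (4 * (R + lam * (\<Sum>j\<in>J. norm (l j)))) < \<eta>" (is "\<delta> * ?R < \<eta>")
  shows "u\<^sub>0 \<in> tie_space"
proof -
  obtain k v where k: "k \<in> tie_space" and v: "v \<in> normal_space" and u0: "u\<^sub>0 = k + v" by (rule decompose)
  have le: "norm k \<le> norm u\<^sub>0" unfolding u0 using k v by (rule norm_tie_part_le)
  have "m * c v k + m / 2 * c v v - v \<bullet> w + lam * (slope \<bullet> v + kink v) \<le> 0"
    using increment_add_normal[OF k, of v] le minimizer_small minimal[of k] unfolding u0 by linarith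
  moreover have "- (\<delta> * ?R * norm v) \<le> m * c v k"
  proof -
    have "m * \<bar>c v k\<bar> \<le> \<delta> * ?R * norm v" using scaled_near[OF le, of v] normal_orthogonal[OF v k] by simp
    moreover have "m * \<bar>c v k\<bar> = \<bar>m * c v k\<bar>" using m by (simp add: abs_mult)
    ultimately show ?thesis by linarith
  qed
  moreover have "0 \<le> m / 2 * c v v" using quadratic_ge[of v] m by (smt (verit) zero_le_mult_iff divide_nonneg_nonneg zero_le_power2)
  ultimately have "\<eta> * norm v \<le> \<delta> * ?R * norm v"
    using dom[OF v] by (simp add: inner_commute)
  then have "norm v = 0" using \<eta> by (smt (verit) mult_right_less_imp_less mult_strict_right_mono norm_ge_zero)
  then show ?thesis using u0 k by simp
qed

text \<open>First-order optimality: perturb \<open>u\<^sub>0\<close> by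
  \<open>t *\<^sub>R v\<close>, divide by \<open>t\<close> and let \<open>t\<close> decrease to 0,
  which removes the quadratic term.\<close>

lemma minimizer_dominated:
  assumes u0: "u\<^sub>0 \<in> tie_space" and v: "v \<in> normal_space"
  shows "w \<bullet> v \<le> lam * (slope \<bullet> v + kink v) + \<delta> * (4 * (R + lam * (\<Sum>j\<in>J. norm (l j)))) * norm v"
    (is "_ \<le> ?X + ?Y")
proof (rule tendsto_lowerbound)
  show "((\<lambda>t. ?X + ?Y + t * (m / 2 * c v v)) \<longlongrightarrow> ?X + ?Y) (at_right 0)"
    by (auto intro!: tendsto_eq_intros)
  have "((\<lambda>t. norm (u\<^sub>0 + t *\<^sub>R v)) \<longlongrightarrow> norm u\<^sub>0) (at_right 0)"
    by (auto intro!: tendsto_eq_intros)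
  then have "\<forall>\<^sub>F t in at_right 0. norm (u\<^sub>0 + t *\<^sub>R v) < r"
    using minimizer_small by (rule order_tendstoD)
  then show "\<forall>\<^sub>F t in at_right 0. w \<bullet> v \<le> ?X + ?Y + t * (m / 2 * c v v)"
    using eventually_at_right_less[of 0]
  proof eventually_elim
    case (elim t)
    have "0 \<le> m * c (t *\<^sub>R v) u\<^sub>0 + m / 2 * c (t *\<^sub>R v) (t *\<^sub>R v) - (t *\<^sub>R v) \<bullet> w
        + lam * (slope \<bullet> (t *\<^sub>R v) + kink (t *\<^sub>R v))"
      using increment_add_normal[OF u0 minimizer_small elim(1)] minimal[of "u\<^sub>0 + t *\<^sub>R v"] by linarith
    also have "\<dots> = t * (m * c v u\<^sub>0 + t * (m / 2 * c v v) - w \<bullet> v + ?X)"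
      using elim(2)
      by (simp add: bilinear_lmul[OF bilinear] bilinear_rmul[OF bilinear] kink_scale algebra_simps inner_commute)
    finally have "0 \<le> m * c v u\<^sub>0 + t * (m / 2 * c v v) - w \<bullet> v + ?X"
      using elim(2) by (simp add: zero_le_mult_iff)
    moreover have "m * c v u\<^sub>0 \<le> ?Y"
    proof -
      have "m * \<bar>c v u\<^sub>0\<bar> \<le> ?Y" using scaled_near[of u\<^sub>0 v] normal_orthogonal[OF v u0] by simp
      moreover have "m * \<bar>c v u\<^sub>0\<bar> = \<bar>m * c v u\<^sub>0\<bar>" using m by (simp add: abs_mult)
      ultimately show ?thesis by linarith
    qed
    ultimately show ?case by linarith
  qed
qed simp

end

end

section \<open>Moments and the weak law of large numbers\<close>

context prob_space
begin

lemma expectation_ident_distr: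
  fixes g :: "'b::topological_space \<Rightarrow> real"
  assumes [measurable]: "random_variable borel Y" "random_variable borel Z" "g \<in> borel_measurable borel"
    and "distr M borel Y = distr M borel Z"
  shows "expectation (\<lambda>\<omega>. g (Y \<omega>)) = expectation (\<lambda>\<omega>. g (Z \<omega>))"
    and "integrable M (\<lambda>\<omega>. g (Y \<omega>)) \<longleftrightarrow> integrable M (\<lambda>\<omega>. g (Z \<omega>))"
proof -
  have "expectation (\<lambda>\<omega>. g (Y \<omega>)) = integral\<^sup>L (distr M borel Y) g"
    by (simp add: integral_distr)
  also have "\<dots> = expectation (\<lambda>\<omega>. g (Z \<omega>))"
    unfolding assms(4) by (simp add: integral_distr)
  finally show "expectation (\<lambda>\<omega>. g (Y \<omega>)) = expectation (\<lambda>\<omega>. g (Z \<omega>))" .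
  show "integrable M (\<lambda>\<omega>. g (Y \<omega>)) \<longleftrightarrow> integrable M (\<lambda>\<omega>. g (Z \<omega>))"
    using integrable_distr_eq[of Y M borel g] integrable_distr_eq[of Z M borel g] assms(4) by simp
qed

lemma indep_vars_sum_square:
  fixes Y :: "nat \<Rightarrow> 'a \<Rightarrow> real"
  assumes indep: "indep_vars (\<lambda>_. borel) Y UNIV"
    and sq: "\<And>i. integrable M (\<lambda>\<omega>. (Y i \<omega>)\<^sup>2)"
    and mean: "\<And>i. expectation (Y i) = 0"
    and var: "\<And>i. expectation (\<lambda>\<omega>. (Y i \<omega>)\<^sup>2) = v"
  shows "expectation (\<lambda>\<omega>. (\<Sum>i<n. Y i \<omega>)\<^sup>2) = real n * v"
    and "integrable M (\<lambda>\<omega>. (\<Sum>i<n. Y i \<omega>)\<^sup>2)"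
proof -
  have [measurable]: "random_variable borel (Y i)" for i
    using indep by (simp add: indep_vars_def)
  have int: "integrable M (Y i)" for i
    using sq by (rule square_integrable_imp_integrable[rotated]) simp
  have mixed: "integrable M (\<lambda>\<omega>. Y i \<omega> * Y j \<omega>) \<and>
      expectation (\<lambda>\<omega>. Y i \<omega> * Y j \<omega>) = (if i = j then v else 0)" for i j
  proof (cases "i = j")
    case True
    then show ?thesis using sq var by (simp add: power2_eq_square)
  next
    case False
    have ind: "indep_vars (\<lambda>_. borel) Y {i, j}" using indep by (rule indep_vars_subset) simp
    show ?thesis
      using indep_vars_lebesgue_integral[OF _ ind int] indep_vars_integrable[OF _ ind int] False mean
      by simp
  qed
  have eq: "(\<Sum>i<n. Y i \<omega>)\<^sup>2 = (\<Sum>i<n. \<Sum>j<n. Y i \<omega> * Y j \<omega>)" for \<omega>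
    by (simp add: power2_eq_square sum_product)
  show "integrable M (\<lambda>\<omega>. (\<Sum>i<n. Y i \<omega>)\<^sup>2)"
    unfolding eq using mixed by (intro Bochner_Integration.integrable_sum) blast
  show "expectation (\<lambda>\<omega>. (\<Sum>i<n. Y i \<omega>)\<^sup>2) = real n * v"
    unfolding eq using mixed by (simp add: Bochner_Integration.integral_sum sum.delta)
qed

lemma second_moment_tail:
  assumes [measurable]: "random_variable borel Y" and "integrable M (\<lambda>\<omega>. (Y \<omega>)\<^sup>2)" and "t > 0"
  shows "prob {\<omega> \<in> space M. t \<le> \<bar>Y \<omega>\<bar>} \<le> expectation (\<lambda>\<omega>. (Y \<omega>)\<^sup>2) / t\<^sup>2"
proof -
  have "{\<omega> \<in> space M. t \<le> \<bar>Y \<omega>\<bar>} = {\<omega> \<in> space M. (Y \<omega>)\<^sup>2 \<ge> t\<^sup>2}"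
    using \<open>t > 0\<close> by (auto simp: abs_le_square_iff[symmetric])
  then show ?thesis
    using integral_Markov_inequality_measure[of M "\<lambda>\<omega>. (Y \<omega>)\<^sup>2" "{}" "t\<^sup>2"] assms by simp
qed

text \<open>Truncation at a level \<open>K\<close> leaves bounded variables, for which the variance of the mean
  tends to \<open>0\<close>; the remainder is uniformly small in \<open>L\<^sup>1\<close>.\<close>

lemma weak_law_of_large_numbers:
  fixes Z :: "nat \<Rightarrow> 'a \<Rightarrow> real"
  assumes indep: "indep_vars (\<lambda>_. borel) Z UNIV"
    and ident: "\<And>i. distr M borel (Z i) = distr M borel (Z 0)"
    and int0: "integrable M (Z 0)"
    and mean: "expectation (Z 0) = \<mu>"
    and "\<epsilon> > 0"
  shows "(\<lambda>n. prob {\<omega> \<in> space M. \<epsilon> \<le> \<bar>(\<Sum>i<n. Z i \<omega>) / real n - \<mu>\<bar>}) \<longlonglongrightarrow> 0"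
proof -
  have Zm [measurable]: "random_variable borel (Z i)" for i
    using indep by (simp add: indep_vars_def)
  have int: "integrable M (Z i)" for i
    using expectation_ident_distr(2)[OF Zm[of i] Zm[of 0] _ ident, of "\<lambda>x. x"] int0 by simp
  define A where "A n = expectation (\<lambda>\<omega>. \<bar>(\<Sum>i<n. Z i \<omega>) / real n - \<mu>\<bar>)" for n
  have small: "\<forall>\<^sub>F n in sequentially. A n < \<kappa>" if "\<kappa> > 0" for \<kappa>
  proof -
    define T where "T K x = (if \<bar>x\<bar> \<le> real K then x else 0)" for K :: nat and x :: real
    have Tm [measurable]: "T K \<in> borel_measurable borel" for K unfolding T_def by measurable
    have T_le: "\<bar>T K x\<bar> \<le> real K" "\<bar>T K x\<bar> \<le> \<bar>x\<bar>" for K x by (auto simp: T_def)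
    have intT: "integrable M (\<lambda>\<omega>. T K (Z i \<omega>))" for K i
      using T_le by (intro integrable_const_bound[where B="real K"]) auto
    have "(\<lambda>K. expectation (\<lambda>\<omega>. \<bar>Z 0 \<omega> - T K (Z 0 \<omega>)\<bar>)) \<longlonglongrightarrow> expectation (\<lambda>\<omega>. 0)"
    proof (rule integral_dominated_convergence[where w="\<lambda>\<omega>. \<bar>Z 0 \<omega>\<bar>"])
      show "AE \<omega> in M. (\<lambda>K. \<bar>Z 0 \<omega> - T K (Z 0 \<omega>)\<bar>) \<longlonglongrightarrow> 0"
      proof (rule AE_I2, rule tendsto_eventually)
        fix \<omega>
        obtain N where "\<bar>Z 0 \<omega>\<bar> \<le> real N" using real_arch_simple by blast
        then show "\<forall>\<^sub>F K in sequentially. \<bar>Z 0 \<omega> - T K (Z 0 \<omega>)\<bar> = 0"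
          by (intro eventually_sequentiallyI[of N]) (auto simp: T_def)
      qed
      show "AE \<omega> in M. norm \<bar>Z 0 \<omega> - T K (Z 0 \<omega>)\<bar> \<le> \<bar>Z 0 \<omega>\<bar>" for K
        by (intro AE_I2) (auto simp: T_def)
    qed (use int0 in auto)
    then have "\<forall>\<^sub>F K in sequentially. expectation (\<lambda>\<omega>. \<bar>Z 0 \<omega> - T K (Z 0 \<omega>)\<bar>) < \<kappa> / 4"
      using that by (intro order_tendstoD) auto
    then obtain K where K: "expectation (\<lambda>\<omega>. \<bar>Z 0 \<omega> - T K (Z 0 \<omega>)\<bar>) < \<kappa> / 4"
      using eventually_happens'[OF sequentially_bot] by blast
    define \<nu> where "\<nu> = expectation (\<lambda>\<omega>. T K (Z 0 \<omega>))"
    define D where "D i \<omega> = T K (Z i \<omega>) - \<nu>" for i \<omega>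
    have Dm [measurable]: "random_variable borel (D i)" for i unfolding D_def by measurable
    have \<nu>: "expectation (\<lambda>\<omega>. T K (Z i \<omega>)) = \<nu>" for i
      unfolding \<nu>_def by (rule expectation_ident_distr(1)) (use ident in auto)
    have \<nu>_le: "\<bar>\<nu>\<bar> \<le> real K"
    proof -
      have "\<bar>\<nu>\<bar> \<le> expectation (\<lambda>\<omega>. \<bar>T K (Z 0 \<omega>)\<bar>)" unfolding \<nu>_def by (rule integral_abs_bound)
      also have "\<dots> \<le> expectation (\<lambda>\<omega>. real K)"
        using T_le by (intro integral_mono intT integrable_abs) auto
      finally show ?thesis by (simp add: prob_space)
    qed
    have D_le: "\<bar>D i \<omega>\<bar> \<le> 2 * real K" for i \<omega>
      unfolding D_def using T_le(1)[of K "Z i \<omega>"] \<nu>_le by linarith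
    have D_sq_le: "(D i \<omega>)\<^sup>2 \<le> (2 * real K)\<^sup>2" for i \<omega>
      using D_le[of i \<omega>] by (subst abs_le_square_iff[symmetric]) simp
    have D_sq: "integrable M (\<lambda>\<omega>. (D i \<omega>)\<^sup>2)" for i
      using D_sq_le by (intro integrable_const_bound[where B="(2 * real K)\<^sup>2"]) auto
    define v where "v = expectation (\<lambda>\<omega>. (D 0 \<omega>)\<^sup>2)"
    have v: "expectation (\<lambda>\<omega>. (D i \<omega>)\<^sup>2) = v" for i
      unfolding v_def D_def using expectation_ident_distr(1)[OF Zm[of i] Zm[of 0] _ ident, of "\<lambda>x. (T K x - \<nu>)\<^sup>2"]
      by simp
    have D_indep: "indep_vars (\<lambda>_. borel) D UNIV"
      unfolding D_def by (rule indep_vars_compose2[OF indep, where Y="\<lambda>_ x. T K x - \<nu>"]) measurable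
    have D_mean: "expectation (D i) = 0" for i
      unfolding D_def using \<nu>[of i] intT[of K i] by (simp add: prob_space)
    note D_sum = indep_vars_sum_square[OF D_indep D_sq D_mean v]
    have remainder: "expectation (\<lambda>\<omega>. \<bar>Z i \<omega> - T K (Z i \<omega>)\<bar>) < \<kappa> / 4" for i
      using expectation_ident_distr(1)[OF Zm[of i] Zm[of 0] _ ident, of "\<lambda>x. \<bar>x - T K x\<bar>"] K by simp
    have "\<bar>\<mu> - \<nu>\<bar> \<le> \<kappa> / 4"
    proof -
      have "\<mu> - \<nu> = expectation (\<lambda>\<omega>. Z 0 \<omega> - T K (Z 0 \<omega>))"
        unfolding mean[symmetric] \<nu>_def using int0 intT by simp
      also have "\<bar>\<dots>\<bar> \<le> expectation (\<lambda>\<omega>. \<bar>Z 0 \<omega> - T K (Z 0 \<omega>)\<bar>)" by (rule integral_abs_bound)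
      finally show ?thesis using K by linarith
    qed
    note \<mu>\<nu> = this
    \<comment> \<open>Budget: \<kappa>/4 for the truncated remainder, \<kappa>/4 for the bias of the
      truncated mean, \<kappa>/8 from the arithmetic-geometric inequality. The variance term carries
      1/n, so the bound tends to 5\<kappa>/8.\<close>
    have A_le: "A n \<le> \<kappa> / 4 + \<kappa> / 4 + (\<kappa> / 4 + 4 / \<kappa> * (v / real n)) / 2" if "n > 0" for n
    proof -
      have pt: "\<bar>(\<Sum>i<n. Z i \<omega>) / real n - \<mu>\<bar> \<le> (\<Sum>i<n. \<bar>Z i \<omega> - T K (Z i \<omega>)\<bar>) / real n + \<kappa> / 4
          + (\<kappa> / 4 + 4 / \<kappa> * ((\<Sum>i<n. D i \<omega>)\<^sup>2 / (real n)\<^sup>2)) / 2" for \<omega>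
      proof -
        define s where "s = (\<Sum>i<n. D i \<omega>) / real n"
        have "(\<Sum>i<n. Z i \<omega>) = (\<Sum>i<n. Z i \<omega> - T K (Z i \<omega>)) + (\<Sum>i<n. D i \<omega>) + real n * \<nu>"
          unfolding D_def by (simp add: sum_subtractf)
        then have "(\<Sum>i<n. Z i \<omega>) / real n - \<mu> = (\<Sum>i<n. Z i \<omega> - T K (Z i \<omega>)) / real n + s + (\<nu> - \<mu>)"
          using that unfolding s_def by (simp add: add_divide_distrib)
        moreover have "\<bar>(\<Sum>i<n. Z i \<omega> - T K (Z i \<omega>)) / real n\<bar> \<le> (\<Sum>i<n. \<bar>Z i \<omega> - T K (Z i \<omega>)\<bar>) / real n"
          using that sum_abs[of "\<lambda>i. Z i \<omega> - T K (Z i \<omega>)" "{..<n}"] by (simp add: divide_right_mono)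
        moreover have "\<bar>s\<bar> \<le> (\<kappa> / 4 + 4 / \<kappa> * ((\<Sum>i<n. D i \<omega>)\<^sup>2 / (real n)\<^sup>2)) / 2"
        proof -
          have s2: "s\<^sup>2 = (\<Sum>i<n. D i \<omega>)\<^sup>2 / (real n)\<^sup>2" by (simp add: s_def power_divide)
          \<comment> \<open>With weight \<kappa>/4 this bounds the absolute value of
            \<open>s\<close> by a constant plus a multiple of its square, so that the second moment
            of the centred mean controls its first absolute moment.\<close>
          have "0 \<le> (\<bar>s\<bar> - \<kappa> / 4)\<^sup>2" by simp
          then have "2 * \<bar>s\<bar> * (\<kappa> / 4) \<le> s\<^sup>2 + (\<kappa> / 4)\<^sup>2" by (simp add: power2_diff)
          then show ?thesis using \<open>\<kappa> > 0\<close> unfolding s2[symmetric]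
            by (simp add: field_simps power2_eq_square)
        qed
        ultimately show ?thesis using \<mu>\<nu> by linarith
      qed
      have "A n \<le> expectation (\<lambda>\<omega>. (\<Sum>i<n. \<bar>Z i \<omega> - T K (Z i \<omega>)\<bar>) / real n + \<kappa> / 4
          + (\<kappa> / 4 + 4 / \<kappa> * ((\<Sum>i<n. D i \<omega>)\<^sup>2 / (real n)\<^sup>2)) / 2)"
        unfolding A_def using int intT D_sum(2) pt by (intro integral_mono) auto
      also have "\<dots> = (\<Sum>i<n. expectation (\<lambda>\<omega>. \<bar>Z i \<omega> - T K (Z i \<omega>)\<bar>)) / real n + \<kappa> / 4
          + (\<kappa> / 4 + 4 / \<kappa> * (real n * v / (real n)\<^sup>2)) / 2"
        using int intT D_sum by (simp add: prob_space)
      also have "\<dots> \<le> (\<Sum>i<n. \<kappa> / 4) / real n + \<kappa> / 4 + (\<kappa> / 4 + 4 / \<kappa> * (real n * v / (real n)\<^sup>2)) / 2"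
        using remainder that by (intro add_right_mono divide_right_mono sum_mono less_imp_le) auto
      also have "\<dots> = \<kappa> / 4 + \<kappa> / 4 + (\<kappa> / 4 + 4 / \<kappa> * (v / real n)) / 2"
        using that by (simp add: power2_eq_square)
      finally show ?thesis .
    qed
    have "(\<lambda>n. \<kappa> / 4 + \<kappa> / 4 + (\<kappa> / 4 + 4 / \<kappa> * (v / real n)) / 2) \<longlonglongrightarrow> \<kappa> / 4 + \<kappa> / 4 + (\<kappa> / 4 + 4 / \<kappa> * 0) / 2"
      by (intro tendsto_intros lim_const_over_n) auto
    then have "\<forall>\<^sub>F n in sequentially. \<kappa> / 4 + \<kappa> / 4 + (\<kappa> / 4 + 4 / \<kappa> * (v / real n)) / 2 < \<kappa>"
      by (rule order_tendstoD(2)) (use \<open>\<kappa> > 0\<close> in simp)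
    then show ?thesis
      using eventually_gt_at_top[of 0] 
    proof eventually_elim
      case (elim n)
      then show ?case using A_le[of n] by linarith
    qed
  qed
  have A_nonneg: "0 \<le> A n" for n unfolding A_def by simp
  have "A \<longlonglongrightarrow> 0"
  proof (rule order_tendstoI)
    show "\<forall>\<^sub>F n in sequentially. x < A n" if "x < 0" for x
      using less_le_trans[OF that A_nonneg] by simp
  qed (rule small)
  then have lim: "(\<lambda>n. A n / \<epsilon>) \<longlonglongrightarrow> 0" by (rule tendsto_divide_zero)
  have "prob {\<omega> \<in> space M. \<epsilon> \<le> \<bar>(\<Sum>i<n. Z i \<omega>) / real n - \<mu>\<bar>} \<le> A n / \<epsilon>" for n
    unfolding A_def using int \<open>\<epsilon> > 0\<close>
    by (intro integral_Markov_inequality_measure[where A="{}"]) auto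
  then show ?thesis
    by (intro tendsto_sandwich[OF always_eventually always_eventually tendsto_const lim]) auto
qed

end

section \<open>Convergence of trigonometric expectations\<close>

text \<open>The approximating sequences may change with the accuracy, so no candidate limit is
  available; the Cauchy criterion passes through a triangle inequality with three quarters of
  \<open>e\<close>.\<close>

lemma convergent_if_approximable:
  fixes a :: "nat \<Rightarrow> real"
  assumes "\<And>e. e > 0 \<Longrightarrow> \<exists>b. convergent b \<and> (\<forall>\<^sub>F n in sequentially. \<bar>a n - b n\<bar> \<le> e)"
  shows "convergent a"
proof (intro real_Cauchy_convergent CauchyI)
  fix e :: real assume "e > 0"
  then obtain b where b: "convergent b" "\<forall>\<^sub>F n in sequentially. \<bar>a n - b n\<bar> \<le> e / 4"
    using assms[of "e / 4"] by auto
  obtain N1 where N1: "\<And>n. n \<ge> N1 \<Longrightarrow> \<bar>a n - b n\<bar> \<le> e / 4"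
    using b(2) unfolding eventually_sequentially by blast
  have "Cauchy b" using b(1) by (rule convergent_Cauchy)
  then obtain N2 where N2: "\<And>m n. m \<ge> N2 \<Longrightarrow> n \<ge> N2 \<Longrightarrow> norm (b m - b n) < e / 4"
    using CauchyD[of b "e / 4"] \<open>e > 0\<close> by auto
  have "norm (a m - a n) < e" if "m \<ge> max N1 N2" "n \<ge> max N1 N2" for m n
  proof -
    have "\<bar>a m - b m\<bar> \<le> e / 4" "\<bar>a n - b n\<bar> \<le> e / 4" "\<bar>b m - b n\<bar> < e / 4"
      using that N1[of m] N1[of n] N2[of m n] by auto
    then show ?thesis using \<open>e > 0\<close> unfolding real_norm_def by linarith
  qed
  then show "\<exists>M. \<forall>m\<ge>M. \<forall>n\<ge>M. norm (a m - a n) < e" by blast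
qed

text \<open>Algebraic approximation of \<open>\<psi> \<circ> arccos\<close> (rescaled) gives trigonometric polynomials that are
  close to \<open>\<psi>\<close> on \<open>[-R, R]\<close> and, by periodicity, bounded everywhere.\<close>

lemma trig_approximation:
  fixes \<psi> :: "real \<Rightarrow> real"
  assumes cont: "continuous_on UNIV \<psi>" and bound: "\<And>y. 0 \<le> \<psi> y" "\<And>y. \<psi> y \<le> 1" and "e > 0" "R > 0"
  obtains a N where
    "\<And>y. \<bar>y\<bar> \<le> R \<Longrightarrow> \<bar>\<psi> y - (\<Sum>i\<le>N. a i * cos (pi / (2 * R) * y + pi / 2) ^ i)\<bar> < e"
    "\<And>y. \<bar>\<Sum>i\<le>(N::nat). a i * cos (pi / (2 * R) * y + pi / 2) ^ i\<bar> < 1 + e"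
proof -
  \<comment> \<open>The inner map inverts y \<mapsto> cos(pi/(2R) y + pi/2) on [-R, R], where the
    angle runs through [0, pi].\<close>
  define h where "h = (\<lambda>u. \<psi> (2 * R * arccos u / pi - R))"
  have "continuous_on {-1..1} h"
    unfolding h_def by (intro continuous_on_compose2[OF cont] continuous_intros) auto
  then obtain g where g: "real_polynomial_function g" "\<And>u. u \<in> {-1..1} \<Longrightarrow> \<bar>h u - g u\<bar> < e"
    using Stone_Weierstrass_real_polynomial_function[of "{-1..1}" h e] \<open>e > 0\<close> by auto
  obtain a N where gs: "g = (\<lambda>x. \<Sum>i\<le>N. a i * x ^ i)"
    using g(1) unfolding real_polynomial_function_iff_sum by blast
  have "\<bar>\<psi> y - g (cos (pi / (2 * R) * y + pi / 2))\<bar> < e" if "\<bar>y\<bar> \<le> R" for y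
  proof -
    let ?\<theta> = "pi / (2 * R) * y + pi / 2"
    have th: "?\<theta> = pi * ((y + R) / (2 * R))" using \<open>R > 0\<close> by (simp add: field_simps)
    have "0 \<le> (y + R) / (2 * R)" "(y + R) / (2 * R) \<le> 1" using that \<open>R > 0\<close> by (auto simp: field_simps)
    then have "0 \<le> ?\<theta>" "?\<theta> \<le> pi" unfolding th
      using mult_left_mono[of "(y + R) / (2 * R)" 1 pi] by (auto simp del: times_divide_eq_right)
    then have "arccos (cos ?\<theta>) = ?\<theta>" by (rule arccos_cos)
    then have "h (cos ?\<theta>) = \<psi> y" unfolding h_def using \<open>R > 0\<close> by (simp add: field_simps)
    then show ?thesis using g(2)[of "cos ?\<theta>"] by simp
  qed
  \<comment> \<open>This bound holds for every real \<open>y\<close>: the cosine stays in [-1, 1],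
    and \<open>h\<close> there takes values of \<open>\<psi>\<close>.\<close>
  moreover have "\<bar>g (cos (pi / (2 * R) * y + pi / 2))\<bar> < 1 + e" for y
    using g(2)[of "cos (pi / (2 * R) * y + pi / 2)"] bound
      [of "2 * R * arccos (cos (pi / (2 * R) * y + pi / 2)) / pi - R"] unfolding h_def by (simp add: abs_less_iff abs_diff_less_iff)
  ultimately show thesis using that unfolding gs by blast
qed

context prob_space
begin

text \<open>The weight \<open>G\<close> collects the factors treated so far, so that a product can
  be built one factor at a time. The phase \<open>c\<close> covers sines as well, and
  \<open>t = 0\<close>, \<open>c = 0\<close> gives back the plain expectation of
  \<open>G\<close>.\<close>

definition trig_convergent :: "(nat \<Rightarrow> 'a \<Rightarrow> 'v::euclidean_space) \<Rightarrow> (nat \<Rightarrow> 'a \<Rightarrow> real) \<Rightarrow> bool" where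
  "trig_convergent W G \<longleftrightarrow>
     (\<forall>t c. convergent (\<lambda>n. expectation (\<lambda>\<omega>. G n \<omega> * cos (W n \<omega> \<bullet> t + c))))"

context
  fixes W :: "nat \<Rightarrow> 'a \<Rightarrow> 'v::euclidean_space"
  assumes W_measurable [measurable]: "\<And>n. random_variable borel (W n)"
begin

text \<open>The product-to-sum formula trades one cosine factor for two shifts of the frequency by
  \<open>\<alpha> *\<^sub>R d\<close> and of the phase by \<open>\<beta>\<close>; hence the
  induction over \<open>k\<close> has \<open>t\<close> and \<open>c\<close> arbitrary.\<close>

lemma trig_convergent_cos_power:
  assumes [measurable]: "\<And>n. random_variable borel (G n)" and G1: "\<And>n \<omega>. \<bar>G n \<omega>\<bar> \<le> 1"
    and G: "trig_convergent W G"
  shows "convergent (\<lambda>n. expectation (\<lambda>\<omega>. G n \<omega> * cos (\<alpha> * (W n \<omega> \<bullet> d) + \<beta>) ^ k * cos (W n \<omega> \<bullet> t + c)))"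
proof (induction k arbitrary: t c)
  case 0
  then show ?case using G by (simp add: trig_convergent_def)
next
  case (Suc k)
  let ?C = "\<lambda>n \<omega>. G n \<omega> * cos (\<alpha> * (W n \<omega> \<bullet> d) + \<beta>) ^ k"
  have int: "integrable M (\<lambda>\<omega>. ?C n \<omega> * cos (W n \<omega> \<bullet> t + c))" for n t c
    using G1 by (intro integrable_const_bound[where B=1])
      (auto simp: abs_mult power_abs intro!: mult_le_one power_le_one)
  have eq: "G n \<omega> * cos (\<alpha> * (W n \<omega> \<bullet> d) + \<beta>) ^ Suc k * cos (W n \<omega> \<bullet> t + c)
      = 1 / 2 * (?C n \<omega> * cos (W n \<omega> \<bullet> (t - \<alpha> *\<^sub>R d) + (c - \<beta>)))
        + 1 / 2 * (?C n \<omega> * cos (W n \<omega> \<bullet> (t + \<alpha> *\<^sub>R d) + (c + \<beta>)))" for n \<omega>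
  proof -
    have "cos x * cos y = 1 / 2 * cos (y - x) + 1 / 2 * cos (y + x)" for x y :: real
      by (simp add: cos_add cos_diff field_simps)
    from this[of "\<alpha> * (W n \<omega> \<bullet> d) + \<beta>" "W n \<omega> \<bullet> t + c"]
    have "cos (\<alpha> * (W n \<omega> \<bullet> d) + \<beta>) * cos (W n \<omega> \<bullet> t + c)
        = 1 / 2 * cos (W n \<omega> \<bullet> (t - \<alpha> *\<^sub>R d) + (c - \<beta>)) + 1 / 2 * cos (W n \<omega> \<bullet> (t + \<alpha> *\<^sub>R d) + (c + \<beta>))"
      by (simp add: inner_diff_right inner_add_right algebra_simps)
    then have "?C n \<omega> * (cos (\<alpha> * (W n \<omega> \<bullet> d) + \<beta>) * cos (W n \<omega> \<bullet> t + c)) = ?C n \<omega> *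
       (1 / 2 * cos (W n \<omega> \<bullet> (t - \<alpha> *\<^sub>R d) + (c - \<beta>)) + 1 / 2 * cos (W n \<omega> \<bullet> (t + \<alpha> *\<^sub>R d) + (c + \<beta>)))"
      by (rule arg_cong)
    then show ?thesis by (simp add: algebra_simps)
  qed
  have "expectation (\<lambda>\<omega>. G n \<omega> * cos (\<alpha> * (W n \<omega> \<bullet> d) + \<beta>) ^ Suc k * cos (W n \<omega> \<bullet> t + c))
      = 1 / 2 * expectation (\<lambda>\<omega>. ?C n \<omega> * cos (W n \<omega> \<bullet> (t - \<alpha> *\<^sub>R d) + (c - \<beta>)))
        + 1 / 2 * expectation (\<lambda>\<omega>. ?C n \<omega> * cos (W n \<omega> \<bullet> (t + \<alpha> *\<^sub>R d) + (c + \<beta>)))" for n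
    unfolding eq using int by simp
  then show ?case
    using Suc.IH by (simp only:) (intro convergent_add convergent_mult convergent_const)
qed

text \<open>\<open>\<psi>\<close> is replaced by a trigonometric polynomial that is accurate on
  [-R, R]. Outside, the polynomial is still bounded, and tightness makes that event rare uniformly
  for large \<open>n\<close>.\<close>

lemma trig_convergent_mult:
  fixes \<psi> :: "real \<Rightarrow> real"
  assumes [measurable]: "\<And>n. random_variable borel (G n)" and G1: "\<And>n \<omega>. \<bar>G n \<omega>\<bar> \<le> 1"
    and G: "trig_convergent W G"
    and cont: "continuous_on UNIV \<psi>" and bound: "\<And>y. 0 \<le> \<psi> y" "\<And>y. \<psi> y \<le> 1"
    and tight: "\<And>e. e > 0 \<Longrightarrow> \<exists>R>0. \<forall>\<^sub>F n in sequentially. prob {\<omega> \<in> space M. R \<le> \<bar>W n \<omega> \<bullet> d\<bar>} \<le> e"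
  shows "trig_convergent W (\<lambda>n \<omega>. G n \<omega> * \<psi> (W n \<omega> \<bullet> d))"
  unfolding trig_convergent_def
proof (intro allI convergent_if_approximable)
  fix t c and e :: real assume "e > 0"
  have [measurable]: "\<psi> \<in> borel_measurable borel" using cont by (rule borel_measurable_continuous_onI)
  \<comment> \<open>\<open>\<delta> \<le> 1\<close> bounds the polynomial by 2, so the error is at
    most 3 outside [-R, R]. With tail probability \<open>e / 6\<close> this costs
    \<open>e / 2\<close>, and \<open>\<delta> \<le> e / 2\<close> pays for the inside.\<close>
  define \<delta> where "\<delta> = min 1 (e / 2)"
  have \<delta>: "0 < \<delta>" "\<delta> \<le> 1" "\<delta> \<le> e / 2" using \<open>e > 0\<close> by (auto simp: \<delta>_def)
  obtain R where "R > 0" and R: "\<forall>\<^sub>F n in sequentially. prob {\<omega> \<in> space M. R \<le> \<bar>W n \<omega> \<bullet> d\<bar>} \<le> e / 6"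
    using tight[of "e / 6"] \<open>e > 0\<close> by auto
  obtain a N where
    approx: "\<And>y. \<bar>y\<bar> \<le> R \<Longrightarrow> \<bar>\<psi> y - (\<Sum>i\<le>N. a i * cos (pi / (2 * R) * y + pi / 2) ^ i)\<bar> < \<delta>" and
    poly_bound: "\<And>y. \<bar>\<Sum>i\<le>(N::nat). a i * cos (pi / (2 * R) * y + pi / 2) ^ i\<bar> < 1 + \<delta>"
    using trig_approximation[OF cont bound \<delta>(1) \<open>R > 0\<close>] by blast
  define q where "q y = (\<Sum>i\<le>N. a i * cos (pi / (2 * R) * y + pi / 2) ^ i)" for y
  have [measurable]: "q \<in> borel_measurable borel" unfolding q_def by measurable
  define b where "b n = expectation (\<lambda>\<omega>. G n \<omega> * q (W n \<omega> \<bullet> d) * cos (W n \<omega> \<bullet> t + c))" for n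
  have int_pow: "integrable M (\<lambda>\<omega>. G n \<omega> * cos (\<alpha> * (W n \<omega> \<bullet> d) + \<beta>) ^ i * cos (W n \<omega> \<bullet> t + c))" for n \<alpha> \<beta> i
    using G1 by (intro integrable_const_bound[where B=1])
      (auto simp: abs_mult power_abs intro!: mult_le_one power_le_one)
  have "b n = expectation (\<lambda>\<omega>. \<Sum>i\<le>N. a i * (G n \<omega> * cos (pi / (2 * R) * (W n \<omega> \<bullet> d) + pi / 2) ^ i * cos (W n \<omega> \<bullet> t + c)))" for n
    unfolding b_def q_def by (simp add: sum_distrib_left sum_distrib_right mult_ac)
  also have "\<dots> n = (\<Sum>i\<le>N. a i * expectation (\<lambda>\<omega>. G n \<omega> * cos (pi / (2 * R) * (W n \<omega> \<bullet> d) + pi / 2) ^ i * cos (W n \<omega> \<bullet> t + c)))" for n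
    by (simp only: Bochner_Integration.integral_sum integrable_mult_right int_pow integral_mult_right_zero)
  finally have b_eq: "b n = (\<Sum>i\<le>N. a i * expectation (\<lambda>\<omega>. G n \<omega> * cos (pi / (2 * R) * (W n \<omega> \<bullet> d) + pi / 2) ^ i * cos (W n \<omega> \<bullet> t + c)))" for n .
  have "convergent (\<lambda>n. \<Sum>i\<le>N. a i * expectation (\<lambda>\<omega>. G n \<omega> * cos (pi / (2 * R) * (W n \<omega> \<bullet> d) + pi / 2) ^ i * cos (W n \<omega> \<bullet> t + c)))"
  proof (rule convergent_sum)
    fix i
    define f where "f n = expectation (\<lambda>\<omega>. G n \<omega> * cos (pi / (2 * R) * (W n \<omega> \<bullet> d) + pi / 2) ^ i * cos (W n \<omega> \<bullet> t + c))" for n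
    have "convergent f"
      unfolding f_def by (rule trig_convergent_cos_power[OF assms(1) G1 G])
    then have "convergent (\<lambda>n. a i * f n)"
      by (rule convergent_mult[OF convergent_const])
    then show "convergent (\<lambda>n. a i * expectation (\<lambda>\<omega>. G n \<omega> * cos (pi / (2 * R) * (W n \<omega> \<bullet> d) + pi / 2) ^ i * cos (W n \<omega> \<bullet> t + c)))"
      unfolding f_def .
  qed
  then have "convergent b" unfolding b_eq[abs_def] .
  moreover have "\<forall>\<^sub>F n in sequentially. \<bar>expectation (\<lambda>\<omega>. G n \<omega> * \<psi> (W n \<omega> \<bullet> d) * cos (W n \<omega> \<bullet> t + c)) - b n\<bar> \<le> e"
    using R
  proof eventually_elim
    case (elim n)
    let ?T = "{\<omega> \<in> space M. R \<le> \<bar>W n \<omega> \<bullet> d\<bar>}"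
    have int1: "integrable M (\<lambda>\<omega>. G n \<omega> * \<psi> (W n \<omega> \<bullet> d) * cos (W n \<omega> \<bullet> t + c))"
      using G1 bound by (intro integrable_const_bound[where B=1]) (auto simp: abs_mult intro!: mult_le_one)
    have int_T: "integrable M (indicator ?T :: 'a \<Rightarrow> real)"
      by (intro integrable_real_indicator) (auto simp: less_top[symmetric])
    have q2: "\<bar>q y\<bar> \<le> 2" for y using poly_bound[of y] \<delta> unfolding q_def by linarith
    have "\<bar>G n \<omega>\<bar> * \<bar>q (W n \<omega> \<bullet> d)\<bar> * \<bar>cos (W n \<omega> \<bullet> t + c)\<bar> \<le> 1 * 2 * 1" for \<omega>
      using G1 q2 by (intro mult_mono) auto
    then have int2: "integrable M (\<lambda>\<omega>. G n \<omega> * q (W n \<omega> \<bullet> d) * cos (W n \<omega> \<bullet> t + c))"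
      by (intro integrable_const_bound[where B=2]) (auto simp: abs_mult)
    have pt: "\<bar>G n \<omega> * \<psi> (W n \<omega> \<bullet> d) * cos (W n \<omega> \<bullet> t + c) - G n \<omega> * q (W n \<omega> \<bullet> d) * cos (W n \<omega> \<bullet> t + c)\<bar>
        \<le> \<delta> + 3 * indicator ?T \<omega>" if "\<omega> \<in> space M" for \<omega>
    proof -
      let ?g = "G n \<omega> * cos (W n \<omega> \<bullet> t + c)" and ?d = "\<psi> (W n \<omega> \<bullet> d) - q (W n \<omega> \<bullet> d)"
      have "G n \<omega> * \<psi> (W n \<omega> \<bullet> d) * cos (W n \<omega> \<bullet> t + c) - G n \<omega> * q (W n \<omega> \<bullet> d) * cos (W n \<omega> \<bullet> t + c)
          = ?g * ?d"
        by (simp add: algebra_simps)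
      moreover have "\<bar>?g * ?d\<bar> \<le> 1 * \<bar>?d\<bar>"
        unfolding abs_mult[of ?g] using G1
        by (intro mult_right_mono) (auto simp: abs_mult intro!: mult_le_one)
      moreover have "\<bar>?d\<bar> \<le> \<delta> + 3 * indicator ?T \<omega>"
        using approx[of "W n \<omega> \<bullet> d"] q2[of "W n \<omega> \<bullet> d"] bound[of "W n \<omega> \<bullet> d"] \<delta> that
        by (cases "R \<le> \<bar>W n \<omega> \<bullet> d\<bar>") (auto simp: q_def)
      ultimately show ?thesis by (simp only: mult_1)
    qed
    have "\<bar>expectation (\<lambda>\<omega>. G n \<omega> * \<psi> (W n \<omega> \<bullet> d) * cos (W n \<omega> \<bullet> t + c)) - b n\<bar>
        = \<bar>expectation (\<lambda>\<omega>. G n \<omega> * \<psi> (W n \<omega> \<bullet> d) * cos (W n \<omega> \<bullet> t + c) - G n \<omega> * q (W n \<omega> \<bullet> d) * cos (W n \<omega> \<bullet> t + c))\<bar>"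
      unfolding b_def using int1 int2 by simp
    also have "\<dots> \<le> expectation (\<lambda>\<omega>. \<bar>G n \<omega> * \<psi> (W n \<omega> \<bullet> d) * cos (W n \<omega> \<bullet> t + c) - G n \<omega> * q (W n \<omega> \<bullet> d) * cos (W n \<omega> \<bullet> t + c)\<bar>)"
      by (rule integral_abs_bound)
    also have "\<dots> \<le> expectation (\<lambda>\<omega>. \<delta> + 3 * indicator ?T \<omega>)"
    proof (rule integral_mono)
      show "integrable M (\<lambda>\<omega>. \<delta> + 3 * indicator ?T \<omega>)"
        using int_T by (intro Bochner_Integration.integrable_add integrable_mult_right) auto
      show "integrable M (\<lambda>\<omega>. \<bar>G n \<omega> * \<psi> (W n \<omega> \<bullet> d) * cos (W n \<omega> \<bullet> t + c) - G n \<omega> * q (W n \<omega> \<bullet> d) * cos (W n \<omega> \<bullet> t + c)\<bar>)"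
        by (intro integrable_abs Bochner_Integration.integrable_diff int1 int2)
    qed (rule pt)
    also have "\<dots> = \<delta> + 3 * prob ?T"
    proof -
      have "expectation (\<lambda>\<omega>. \<delta> + 3 * indicator ?T \<omega>) = expectation (\<lambda>\<omega>. \<delta>) + expectation (\<lambda>\<omega>. 3 * indicator ?T \<omega>)"
        using int_T by (intro Bochner_Integration.integral_add integrable_mult_right) auto
      also have "\<dots> = \<delta> + 3 * prob ?T" using int_T by (simp add: prob_space)
      finally show ?thesis .
    qed
    also have "\<dots> \<le> e" using elim \<delta> by simp
    finally show ?case .
  qed
  ultimately show "\<exists>b. convergent b \<and> (\<forall>\<^sub>F n in sequentially.
      \<bar>expectation (\<lambda>\<omega>. G n \<omega> * \<psi> (W n \<omega> \<bullet> d) * cos (W n \<omega> \<bullet> t + c)) - b n\<bar> \<le> e)"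
    by blast
qed

lemma trig_convergent_prod:
  assumes "finite E" and base: "trig_convergent W (\<lambda>_ _. 1)"
    and cont: "\<And>d. d \<in> E \<Longrightarrow> continuous_on UNIV (\<psi> d)"
    and bound: "\<And>d y. 0 \<le> \<psi> d y" "\<And>d y. \<psi> d y \<le> (1::real)"
    and tight: "\<And>d e. d \<in> E \<Longrightarrow> e > 0 \<Longrightarrow>
       \<exists>R>0. \<forall>\<^sub>F n in sequentially. prob {\<omega> \<in> space M. R \<le> \<bar>W n \<omega> \<bullet> d\<bar>} \<le> e"
  shows "trig_convergent W (\<lambda>n \<omega>. \<Prod>d\<in>E. \<psi> d (W n \<omega> \<bullet> d))"
  using \<open>finite E\<close> cont tight
proof (induction E rule: finite_induct)
  case empty
  then show ?case using base by simp
next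
  case (insert d E)
  have [measurable]: "\<psi> d \<in> borel_measurable borel" if "d \<in> E" for d
    using insert.prems(1) that by (intro borel_measurable_continuous_onI) auto
  have "trig_convergent W (\<lambda>n \<omega>. (\<Prod>d\<in>E. \<psi> d (W n \<omega> \<bullet> d)) * \<psi> d (W n \<omega> \<bullet> d))"
  proof (rule trig_convergent_mult)
    show "trig_convergent W (\<lambda>n \<omega>. \<Prod>d\<in>E. \<psi> d (W n \<omega> \<bullet> d))"
      using insert.IH insert.prems by blast
    show "\<bar>\<Prod>d\<in>E. \<psi> d (W n \<omega> \<bullet> d)\<bar> \<le> 1" for n \<omega>
      using bound by (auto simp: abs_prod intro!: prod_le_1)
    show "random_variable borel (\<lambda>\<omega>. \<Prod>d\<in>E. \<psi> d (W n \<omega> \<bullet> d))" for n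
      by (intro borel_measurable_prod) measurable
    show "continuous_on UNIV (\<psi> d)" using insert.prems(1) by blast
    show "\<exists>R>0. \<forall>\<^sub>F n in sequentially. prob {\<omega> \<in> space M. R \<le> \<bar>W n \<omega> \<bullet> d\<bar>} \<le> e" if "e > 0" for e
      using insert.prems(2)[of d] that by blast
    show "0 \<le> \<psi> d y" "\<psi> d y \<le> 1" for y by (rule bound)+
  qed
  moreover have "(\<Prod>e\<in>insert d E. \<psi> e (W n \<omega> \<bullet> e)) = (\<Prod>e\<in>E. \<psi> e (W n \<omega> \<bullet> e)) * \<psi> d (W n \<omega> \<bullet> d)" for n \<omega>
    using prod.insert[OF insert.hyps, of "\<lambda>e. \<psi> e (W n \<omega> \<bullet> e)"] by (simp only: mult.commute)
  ultimately show ?case by (simp only:)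
qed

end

end

section \<open>Independent pairs\<close>

lemma vimage_component_in_vimage_algebra:
  assumes "X i \<in> \<Omega> \<rightarrow> space N" "A \<in> sets N"
    and "\<And>j. X j \<in> \<Omega> \<rightarrow> space N"
  shows "X i -` A \<inter> \<Omega> \<in> sets (vimage_algebra \<Omega> (\<lambda>\<omega> i. X i \<omega>) (Pi\<^sub>M UNIV (\<lambda>_. N)))"
proof -
  have "(\<lambda>f. f i) -` A \<inter> space (Pi\<^sub>M UNIV (\<lambda>_. N)) \<in> sets (Pi\<^sub>M UNIV (\<lambda>_. N))"
    using assms(2) by (intro measurable_sets[OF measurable_component_singleton]) auto
  then have "(\<lambda>\<omega> i. X i \<omega>) -` ((\<lambda>f. f i) -` A \<inter> space (Pi\<^sub>M UNIV (\<lambda>_. N))) \<inter> \<Omega>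
      \<in> sets (vimage_algebra \<Omega> (\<lambda>\<omega> i. X i \<omega>) (Pi\<^sub>M UNIV (\<lambda>_. N)))"
    by (rule in_vimage_algebra)
  moreover have "(\<lambda>\<omega> i. X i \<omega>) -` ((\<lambda>f. f i) -` A \<inter> space (Pi\<^sub>M UNIV (\<lambda>_. N))) \<inter> \<Omega> = X i -` A \<inter> \<Omega>"
    using assms(3) by (auto simp: space_PiM PiE_iff Pi_iff)
  ultimately show ?thesis by simp
qed

context prob_space
begin

context
  fixes X :: "nat \<Rightarrow> 'a \<Rightarrow> 'b" and Y :: "nat \<Rightarrow> 'a \<Rightarrow> 'c" and N :: "'b measure" and N' :: "'c measure"
  assumes indep_X: "indep_vars (\<lambda>_. N) X UNIV" and indep_Y: "indep_vars (\<lambda>_. N') Y UNIV"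
    and joint: "indep_set (sets (vimage_algebra (space M) (\<lambda>\<omega> i. X i \<omega>) (Pi\<^sub>M UNIV (\<lambda>_. N))))
                          (sets (vimage_algebra (space M) (\<lambda>\<omega> i. Y i \<omega>) (Pi\<^sub>M UNIV (\<lambda>_. N'))))"
begin

lemma vars_measurable: "random_variable N (X i)" "random_variable N' (Y i)"
  using indep_X indep_Y by (auto simp: indep_vars_def)

lemma vars_in_algebra:
  "A \<in> sets N \<Longrightarrow> X i -` A \<inter> space M \<in> sets (vimage_algebra (space M) (\<lambda>\<omega> i. X i \<omega>) (Pi\<^sub>M UNIV (\<lambda>_. N)))"
  "B \<in> sets N' \<Longrightarrow> Y i -` B \<inter> space M \<in> sets (vimage_algebra (space M) (\<lambda>\<omega> i. Y i \<omega>) (Pi\<^sub>M UNIV (\<lambda>_. N')))"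
  using vars_measurable by (auto intro!: vimage_component_in_vimage_algebra dest: measurable_space)

lemma prob_pair:
  assumes "A \<in> sets N" "B \<in> sets N'"
  shows "prob (X i -` A \<inter> Y i -` B \<inter> space M) = prob (X i -` A \<inter> space M) * prob (Y i -` B \<inter> space M)"
  using indep_setD[OF joint vars_in_algebra(1)[OF assms(1)] vars_in_algebra(2)[OF assms(2)], of i i]
  by (simp add: Int_ac)

text \<open>Uniqueness of product measures: rectangles suffice, and on them the identity is
  \<open>prob_pair\<close>.\<close>

lemma distr_pair_eq: "distr M (N \<Otimes>\<^sub>M N') (\<lambda>\<omega>. (X i \<omega>, Y i \<omega>)) = distr M N (X i) \<Otimes>\<^sub>M distr M N' (Y i)"
proof -
  interpret X: prob_space "distr M N (X i)" by (rule prob_space_distr) (rule vars_measurable)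
  interpret Y: prob_space "distr M N' (Y i)" by (rule prob_space_distr) (rule vars_measurable)
  have XY: "random_variable (N \<Otimes>\<^sub>M N') (\<lambda>\<omega>. (X i \<omega>, Y i \<omega>))"
    using vars_measurable by (rule measurable_Pair)
  have "distr M N (X i) \<Otimes>\<^sub>M distr M N' (Y i) = distr M (N \<Otimes>\<^sub>M N') (\<lambda>\<omega>. (X i \<omega>, Y i \<omega>))"
  proof (rule pair_measure_eqI)
    show "sigma_finite_measure (distr M N (X i))" "sigma_finite_measure (distr M N' (Y i))"
      by unfold_locales
    fix A B assume "A \<in> sets (distr M N (X i))" "B \<in> sets (distr M N' (Y i))"
    then have A: "A \<in> sets N" and B: "B \<in> sets N'" by auto
    have "emeasure (distr M (N \<Otimes>\<^sub>M N') (\<lambda>\<omega>. (X i \<omega>, Y i \<omega>))) (A \<times> B) = prob (X i -` A \<inter> Y i -` B \<inter> space M)"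
      using A B by (subst emeasure_distr[OF XY]) (auto simp: emeasure_eq_measure intro!: arg_cong[where f=prob])
    also have "\<dots> = emeasure (distr M N (X i)) A * emeasure (distr M N' (Y i)) B"
      using A B vars_measurable unfolding prob_pair[OF A B]
      by (simp add: emeasure_distr emeasure_eq_measure ennreal_mult)
    finally show "emeasure (distr M N (X i)) A * emeasure (distr M N' (Y i)) B
        = emeasure (distr M (N \<Otimes>\<^sub>M N') (\<lambda>\<omega>. (X i \<omega>, Y i \<omega>))) (A \<times> B)" by simp
  qed simp
  then show ?thesis by simp
qed

lemma indep_var_components:
  assumes f: "f \<in> measurable N L" and g: "g \<in> measurable N' L'"
  shows "indep_var L (\<lambda>\<omega>. f (X i \<omega>)) L' (\<lambda>\<omega>. g (Y i \<omega>))"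
proof -
  have fX: "random_variable L (\<lambda>\<omega>. f (X i \<omega>))" and gY: "random_variable L' (\<lambda>\<omega>. g (Y i \<omega>))"
    using vars_measurable f g by (auto intro: measurable_compose)
  have XY: "random_variable (N \<Otimes>\<^sub>M N') (\<lambda>\<omega>. (X i \<omega>, Y i \<omega>))"
    using vars_measurable by (rule measurable_Pair)
  have fg: "(\<lambda>(x, y). (f x, g y)) \<in> measurable (N \<Otimes>\<^sub>M N') (L \<Otimes>\<^sub>M L')"
    using f g by measurable
  interpret X: prob_space "distr M L (\<lambda>\<omega>. f (X i \<omega>))" by (rule prob_space_distr) (rule fX)
  interpret Y: prob_space "distr M L' (\<lambda>\<omega>. g (Y i \<omega>))" by (rule prob_space_distr) (rule gY)
  interpret Y': prob_space "distr M N' (Y i)" by (rule prob_space_distr) (rule vars_measurable)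
  have "distr M (L \<Otimes>\<^sub>M L') (\<lambda>\<omega>. (f (X i \<omega>), g (Y i \<omega>)))
      = distr (distr M (N \<Otimes>\<^sub>M N') (\<lambda>\<omega>. (X i \<omega>, Y i \<omega>))) (L \<Otimes>\<^sub>M L') (\<lambda>(x, y). (f x, g y))"
    by (subst distr_distr[OF fg XY]) (simp add: comp_def)
  also have "\<dots> = distr (distr M N (X i)) L f \<Otimes>\<^sub>M distr (distr M N' (Y i)) L' g"
  proof -
    have "distr (distr M N' (Y i)) L' g = distr M L' (\<lambda>\<omega>. g (Y i \<omega>))"
      using distr_distr[OF g vars_measurable(2)] by (simp add: comp_def)
    then have "sigma_finite_measure (distr (distr M N' (Y i)) L' g)" using Y.sigma_finite_measure_axioms by simp
    then show ?thesis unfolding distr_pair_eq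
      using pair_measure_distr[of f "distr M N (X i)" L g "distr M N' (Y i)" L'] f g by simp
  qed
  also have "\<dots> = distr M L (\<lambda>\<omega>. f (X i \<omega>)) \<Otimes>\<^sub>M distr M L' (\<lambda>\<omega>. g (Y i \<omega>))"
    using distr_distr[OF f vars_measurable(1)] distr_distr[OF g vars_measurable(2)] by (simp add: comp_def)
  finally show ?thesis
    using fX gY by (simp add: indep_var_distribution_eq)
qed

text \<open>Both sequences become one family, with a Boolean tag for the sequence, so that the i-th
  pair corresponds to the block of indices (True, i) and (False, i).\<close>

definition component_events :: "bool \<times> nat \<Rightarrow> 'a set set" where
  "component_events = (\<lambda>(b, i). if b then {X i -` A \<inter> space M |A. A \<in> sets N}
                                else {Y i -` A \<inter> space M |A. A \<in> sets N'})"

text \<open>A finite intersection splits into an \<open>X\<close> part and a \<open>Y\<close> part.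
  The joint assumption factorises the two parts, and independence within each sequence factorises
  each part.\<close>

lemma indep_component_events: "indep_sets component_events UNIV"
proof (rule indep_setsI)
  show "component_events k \<subseteq> events" for k
    using vars_measurable by (auto simp: component_events_def split: prod.splits if_splits intro: measurable_sets)
next
  fix A and J :: "(bool \<times> nat) set"
  assume J: "J \<noteq> {}" "finite J" and A: "\<forall>j\<in>J. A j \<in> component_events j"
  define F where "F = snd ` J"
  \<comment> \<open>Padding with the whole space extends the index set to a full rectangle of tags
    and numbers; it changes neither the intersection nor the product of probabilities.\<close>
  define A' where "A' j = (if j \<in> J then A j else space M)" for j
  have F: "finite F" "F \<noteq> {}" using J by (auto simp: F_def)
  have top: "space M \<in> component_events j" for j
  proof (cases j)
    case (Pair b i)
    have "X i -` space N \<inter> space M = space M" "Y i -` space N' \<inter> space M = space M"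
      using vars_measurable[THEN measurable_space] by auto
    then show ?thesis unfolding Pair component_events_def
      by (auto intro: exI[of _ "space N"] exI[of _ "space N'"])
  qed
  have A': "A' j \<in> component_events j" for j using A top by (auto simp: A'_def)
  have A'_sub: "A' j \<subseteq> space M" for j
    using A'[of j] by (auto simp: component_events_def split: prod.splits if_splits)
  have X_events: "A' (True, i) \<in> {X i -` A \<inter> space M |A. A \<in> sets N}" for i
    using A'[of "(True, i)"] by (simp add: component_events_def)
  have X_part: "prob (\<Inter>i\<in>F. A' (True, i)) = (\<Prod>i\<in>F. prob (A' (True, i)))"
    using indep_X F X_events unfolding indep_vars_def2
    by (intro indep_setsD[where F="\<lambda>i. {X i -` A \<inter> space M |A. A \<in> sets N}" and I=UNIV]) blast+
  have Y_events: "A' (False, i) \<in> {Y i -` A \<inter> space M |A. A \<in> sets N'}" for i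
    using A'[of "(False, i)"] by (simp add: component_events_def)
  have Y_part: "prob (\<Inter>i\<in>F. A' (False, i)) = (\<Prod>i\<in>F. prob (A' (False, i)))"
    using indep_Y F Y_events unfolding indep_vars_def2
    by (intro indep_setsD[where F="\<lambda>i. {Y i -` A \<inter> space M |A. A \<in> sets N'}" and I=UNIV]) blast+
  have "(\<Inter>i\<in>F. A' (True, i)) \<in> sets (vimage_algebra (space M) (\<lambda>\<omega> i. X i \<omega>) (Pi\<^sub>M UNIV (\<lambda>_. N)))"
  proof (rule sets.finite_INT[OF F])
    fix i show "A' (True, i) \<in> sets (vimage_algebra (space M) (\<lambda>\<omega> i. X i \<omega>) (Pi\<^sub>M UNIV (\<lambda>_. N)))"
      using A'[of "(True, i)"] vars_in_algebra(1) by (auto simp: component_events_def)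
  qed
  moreover have "(\<Inter>i\<in>F. A' (False, i)) \<in> sets (vimage_algebra (space M) (\<lambda>\<omega> i. Y i \<omega>) (Pi\<^sub>M UNIV (\<lambda>_. N')))"
  proof (rule sets.finite_INT[OF F])
    fix i show "A' (False, i) \<in> sets (vimage_algebra (space M) (\<lambda>\<omega> i. Y i \<omega>) (Pi\<^sub>M UNIV (\<lambda>_. N')))"
      using A'[of "(False, i)"] vars_in_algebra(2) by (auto simp: component_events_def)
  qed
  ultimately have prod: "prob ((\<Inter>i\<in>F. A' (True, i)) \<inter> (\<Inter>i\<in>F. A' (False, i)))
      = (\<Prod>i\<in>F. prob (A' (True, i))) * (\<Prod>i\<in>F. prob (A' (False, i)))"
    using indep_setD[OF joint] X_part Y_part by simp
  have "(\<Inter>j\<in>J. A j) = (\<Inter>i\<in>F. A' (True, i)) \<inter> (\<Inter>i\<in>F. A' (False, i))"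
  proof (intro equalityI subsetI)
    fix \<omega> assume \<omega>: "\<omega> \<in> (\<Inter>j\<in>J. A j)"
    obtain j where "j \<in> J" using J by blast
    then have "\<omega> \<in> space M" using \<omega> A'_sub[of j] by (auto simp: A'_def)
    then show "\<omega> \<in> (\<Inter>i\<in>F. A' (True, i)) \<inter> (\<Inter>i\<in>F. A' (False, i))"
      using \<omega> by (auto simp: A'_def)
  next
    fix \<omega> assume \<omega>: "\<omega> \<in> (\<Inter>i\<in>F. A' (True, i)) \<inter> (\<Inter>i\<in>F. A' (False, i))"
    have "\<omega> \<in> A (b, i)" if "(b, i) \<in> J" for b i
    proof -
      have "i \<in> F" using that by (force simp: F_def)
      then have "\<omega> \<in> A' (b, i)" using \<omega> by (cases b) auto
      then show ?thesis using that by (simp add: A'_def)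
    qed
    then show "\<omega> \<in> (\<Inter>j\<in>J. A j)" by auto
  qed
  moreover have "(\<Prod>j\<in>J. prob (A j)) = (\<Prod>j\<in>UNIV \<times> F. prob (A' j))"
    using F by (intro prod.mono_neutral_cong_left) (force simp: A'_def F_def prob_space)+
  moreover have "\<dots> = (\<Prod>b\<in>UNIV. \<Prod>i\<in>F. prob (A' (b, i)))"
    by (simp add: prod.cartesian_product)
  ultimately show "prob (\<Inter>j\<in>J. A j) = (\<Prod>j\<in>J. prob (A j))"
    using prod by (simp add: UNIV_bool mult.commute)
qed

text \<open>Disjoint blocks of an independent family of intersection-stable generators generate
  independent sigma-algebras, and the i-th pair is measurable for its block. This is what makes the
  products of noise and design an independent sequence.\<close>

lemma indep_vars_Pair: "indep_vars (\<lambda>_. N \<Otimes>\<^sub>M N') (\<lambda>i \<omega>. (X i \<omega>, Y i \<omega>)) UNIV"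
  unfolding indep_vars_def2
proof (intro conjI ballI)
  show "random_variable (N \<Otimes>\<^sub>M N') (\<lambda>\<omega>. (X i \<omega>, Y i \<omega>))" for i
    using vars_measurable by (intro measurable_Pair)
  have stable: "Int_stable (component_events j)" for j
  proof (cases j)
    case (Pair b i)
    have "\<exists>C. (X i -` A \<inter> space M) \<inter> (X i -` B \<inter> space M) = (X i -` C \<inter> space M) \<and> C \<in> sets N"
      if "A \<in> sets N" "B \<in> sets N" for A B
      using that by (intro exI[of _ "A \<inter> B"]) auto
    moreover have "\<exists>C. (Y i -` A \<inter> space M) \<inter> (Y i -` B \<inter> space M) = (Y i -` C \<inter> space M) \<and> C \<in> sets N'"
      if "A \<in> sets N'" "B \<in> sets N'" for A B
      using that by (intro exI[of _ "A \<inter> B"]) auto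
    ultimately show ?thesis unfolding Pair component_events_def Int_stable_def by auto
  qed
  have "indep_sets (\<lambda>i. sigma_sets (space M) (\<Union>j\<in>{(True, i), (False, i)}. component_events j)) UNIV"
    by (rule indep_sets_collect_sigma[OF indep_sets_mono_index[OF _ indep_component_events]])
       (auto simp: stable disjoint_family_on_def)
  then show "indep_sets (\<lambda>i. {(\<lambda>\<omega>. (X i \<omega>, Y i \<omega>)) -` A \<inter> space M |A. A \<in> sets (N \<Otimes>\<^sub>M N')}) UNIV"
  proof (rule indep_sets_mono_sets)
    fix i
    let ?G = "\<Union>j\<in>{(True, i), (False, i)}. component_events j"
    define S where "S = sigma (space M) ?G"
    have G: "?G \<subseteq> Pow (space M)" by (auto simp: component_events_def)
    have S: "space S = space M" "sets S = sigma_sets (space M) ?G"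
      unfolding S_def using G by (auto simp: space_measure_of sets_measure_of)
    have "X i \<in> measurable S N"
      unfolding measurable_def S using vars_measurable(1)[of i, THEN measurable_space]
      by (auto simp: component_events_def intro!: sigma_sets.Basic)
    moreover have "Y i \<in> measurable S N'"
      unfolding measurable_def S using vars_measurable(2)[of i, THEN measurable_space]
      by (auto simp: component_events_def intro!: sigma_sets.Basic)
    ultimately have "(\<lambda>\<omega>. (X i \<omega>, Y i \<omega>)) \<in> measurable S (N \<Otimes>\<^sub>M N')" by (rule measurable_Pair)
    from measurable_sets[OF this]
    show "{(\<lambda>\<omega>. (X i \<omega>, Y i \<omega>)) -` A \<inter> space M |A. A \<in> sets (N \<Otimes>\<^sub>M N')} \<subseteq> sigma_sets (space M) ?G"
      unfolding S by blast
  qed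
qed

end

end

section \<open>The linear model\<close>

lemma emeasure_std_normal_null:
  assumes "A \<in> sets borel" "emeasure lborel A = 0"
  shows "emeasure std_normal_distribution A = 0"
proof -
  have "A \<in> null_sets lborel" using assms by (auto simp: null_sets_def)
  then have "A \<in> null_sets std_normal_distribution"
    using absolutely_continuousI_density[of std_normal_density lborel]
    by (auto simp: absolutely_continuous_def)
  then show ?thesis by (auto simp: null_sets_def)
qed

text \<open>The density is at most 1; this crude Lipschitz constant is enough for thin boundary
  layers.\<close>

lemma std_normal_interval_le:
  assumes "x \<le> y"
  shows "measure std_normal_distribution {x..y} \<le> y - x"
proof -
  have le1: "std_normal_density t \<le> 1" for t
  proof -
    have "1 \<le> sqrt (2 * pi)" using pi_ge_two by simp
    then have "1 / sqrt (2 * pi) \<le> 1" by simp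
    then have "1 / sqrt (2 * pi) * exp (- t\<^sup>2 / 2) \<le> 1 * 1" by (intro mult_mono) auto
    then show ?thesis by (simp add: std_normal_density_def)
  qed
  have "emeasure std_normal_distribution {x..y} = (\<integral>\<^sup>+t. ennreal (std_normal_density t) * indicator {x..y} t \<partial>lborel)"
    by (rule emeasure_density) auto
  also have "\<dots> \<le> (\<integral>\<^sup>+t. indicator {x..y} t \<partial>lborel)"
    using le1 by (intro nn_integral_mono) (auto simp: indicator_def)
  also have "\<dots> = ennreal (y - x)" using assms by simp
  finally show ?thesis
    unfolding measure_def using assms by (intro enn2real_leI) auto
qed

text \<open>The positive density charges every right half-line. The strict inequality is the source
  of the gap in the failure of recovery.\<close>

lemma std_normal_atMost_less_1: "measure std_normal_distribution {..x} < 1"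
proof -
  interpret N: real_distribution std_normal_distribution by (rule real_dist_normal_dist)
  have "emeasure std_normal_distribution {x<..} \<noteq> 0"
  proof
    assume "emeasure std_normal_distribution {x<..} = 0"
    then have "{x<..} \<in> null_sets std_normal_distribution" by (auto simp: null_sets_def)
    then have "AE t in lborel. t \<in> {x<..} \<longrightarrow> ennreal (std_normal_density t) = 0"
      by (simp add: null_sets_density_iff)
    moreover have "std_normal_density t > 0" for t by (simp add: normal_density_pos)
    ultimately have "AE t in lborel. t \<notin> {x<..}"
      by (auto simp: ennreal_eq_0_iff not_le[symmetric] elim!: eventually_mono)
    then have "emeasure lborel {x<..} = 0"
      using AE_iff_measurable[of "{x<..}" lborel "\<lambda>t. t \<notin> {x<..}"] by (simp add: greaterThan_def not_le)
    moreover have "emeasure lborel {x<..x+1} \<le> emeasure lborel {x<..}"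
      by (intro emeasure_mono) auto
    ultimately show False by simp
  qed
  then have "0 < N.prob {x<..}" using N.emeasure_eq_measure by (simp add: zero_less_measure_iff)
  moreover have "N.prob {x<..} = 1 - N.prob {..x}"
    using N.prob_compl[of "{..x}"] by (simp add: Compl_eq_Diff_UNIV[symmetric] Compl_atMost)
  ultimately show ?thesis by simp
qed

text \<open>The covariance condition is coordinate-free: the second-moment form of each
  \<open>X i\<close> is the inner product.\<close>

locale standard_linear_model = prob_space M for M :: "'w measure" +
  fixes X :: "nat \<Rightarrow> 'w \<Rightarrow> 'v::euclidean_space" and \<epsilon> :: "nat \<Rightarrow> 'w \<Rightarrow> real" and \<sigma> :: real
  assumes X_indep: "indep_vars (\<lambda>_. borel) X UNIV"
    and X_ident: "\<And>i. distr M borel (X i) = distr M borel (X 0)"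
    and X_square_integrable: "\<And>i. integrable M (\<lambda>\<omega>. (norm (X i \<omega>))\<^sup>2)"
    and X_covariance: "\<And>i u v. expectation (\<lambda>\<omega>. (X i \<omega> \<bullet> u) * (X i \<omega> \<bullet> v)) = u \<bullet> v"
    and \<epsilon>_indep: "indep_vars (\<lambda>_. borel) \<epsilon> UNIV"
    and \<epsilon>_ident: "\<And>i. distr M borel (\<epsilon> i) = distr M borel (\<epsilon> 0)"
    and \<epsilon>_square_integrable: "\<And>i. integrable M (\<lambda>\<omega>. (\<epsilon> i \<omega>)\<^sup>2)"
    and \<epsilon>_mean: "\<And>i. expectation (\<epsilon> i) = 0"
    and \<epsilon>_variance: "\<And>i. expectation (\<lambda>\<omega>. (\<epsilon> i \<omega>)\<^sup>2) = \<sigma>\<^sup>2"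
    and \<sigma>_nonzero: "\<sigma> \<noteq> 0"
    and X_\<epsilon>_indep: "indep_set (sets (vimage_algebra (space M) (\<lambda>\<omega> i. X i \<omega>) (Pi\<^sub>M UNIV (\<lambda>_. borel))))
                              (sets (vimage_algebra (space M) (\<lambda>\<omega> i. \<epsilon> i \<omega>) (Pi\<^sub>M UNIV (\<lambda>_. borel))))"
begin

lemma X_measurable [measurable]: "random_variable borel (X i)"
  using X_indep by (simp add: indep_vars_def)

lemma \<epsilon>_measurable [measurable]: "random_variable borel (\<epsilon> i)"
  using \<epsilon>_indep by (simp add: indep_vars_def)

lemma integrable_X_product: "integrable M (\<lambda>\<omega>. (X i \<omega> \<bullet> u) * (X i \<omega> \<bullet> v))"
proof (rule Bochner_Integration.integrable_bound)
  show "integrable M (\<lambda>\<omega>. (norm (X i \<omega>))\<^sup>2 * (norm u * norm v))"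
    using X_square_integrable by (rule integrable_mult_left)
  have "\<bar>(x \<bullet> u) * (x \<bullet> v)\<bar> \<le> (norm x)\<^sup>2 * (norm u * norm v)" for x :: 'v
  proof -
    have "\<bar>x \<bullet> u\<bar> * \<bar>x \<bullet> v\<bar> \<le> (norm x * norm u) * (norm x * norm v)"
      by (intro mult_mono Cauchy_Schwarz_ineq2) auto
    then show ?thesis by (simp add: abs_mult power2_eq_square mult_ac)
  qed
  then show "AE \<omega> in M. norm ((X i \<omega> \<bullet> u) * (X i \<omega> \<bullet> v)) \<le> norm ((norm (X i \<omega>))\<^sup>2 * (norm u * norm v))"
    by (intro AE_I2) simp
qed measurable

text \<open>The i-th summand of the product of \<open>t\<close> with the unnormalised noise vector.
  All limit theorems in a direction \<open>t\<close> are applied to this i.i.d. centred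
  sequence.\<close>

definition score :: "'v \<Rightarrow> nat \<Rightarrow> 'w \<Rightarrow> real" where
  "score t i \<omega> = \<epsilon> i \<omega> * (X i \<omega> \<bullet> t)"

lemma score_measurable [measurable]: "random_variable borel (score t i)"
  unfolding score_def[abs_def] by measurable

lemma score_indep: "indep_vars (\<lambda>_. borel) (score t) UNIV"
proof -
  have "indep_vars (\<lambda>_. borel \<Otimes>\<^sub>M borel) (\<lambda>i \<omega>. (X i \<omega>, \<epsilon> i \<omega>)) UNIV"
    using X_indep \<epsilon>_indep X_\<epsilon>_indep by (rule indep_vars_Pair)
  from indep_vars_compose2[OF this, of "\<lambda>_ (x, e). e * (x \<bullet> t)" "\<lambda>_. borel"]
  show ?thesis by (simp add: score_def[abs_def])
qed

lemma score_ident: "distr M borel (score t i) = distr M borel (score t 0)"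
proof -
  have eq: "distr M borel (score t i) = distr (distr M borel (X i) \<Otimes>\<^sub>M distr M borel (\<epsilon> i)) borel (\<lambda>(x, e). e * (x \<bullet> t))" for i
    unfolding distr_pair_eq[OF X_indep \<epsilon>_indep X_\<epsilon>_indep, symmetric]
    by (subst distr_distr) (auto simp: comp_def score_def[abs_def])
  show ?thesis
    unfolding eq[of i] eq[of 0] X_ident[of i] \<epsilon>_ident[of i] by (rule refl)
qed

lemma score_moments:
  shows "expectation (score t i) = 0" "integrable M (\<lambda>\<omega>. (score t i \<omega>)\<^sup>2)"
    "expectation (\<lambda>\<omega>. (score t i \<omega>)\<^sup>2) = \<sigma>\<^sup>2 * (norm t)\<^sup>2"
proof -
  have X2: "integrable M (\<lambda>\<omega>. (X i \<omega> \<bullet> t)\<^sup>2)" "expectation (\<lambda>\<omega>. (X i \<omega> \<bullet> t)\<^sup>2) = (norm t)\<^sup>2"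
    using integrable_X_product[of i t t] X_covariance[of i t t]
    by (simp_all add: power2_eq_square dot_square_norm)
  have X1: "integrable M (\<lambda>\<omega>. X i \<omega> \<bullet> t)"
    using X2(1) by (rule square_integrable_imp_integrable[rotated]) measurable
  have e1: "integrable M (\<epsilon> i)"
    using \<epsilon>_square_integrable by (rule square_integrable_imp_integrable[rotated]) measurable
  have "indep_var borel (\<lambda>\<omega>. X i \<omega> \<bullet> t) borel (\<lambda>\<omega>. \<epsilon> i \<omega>)"
    by (rule indep_var_components[OF X_indep \<epsilon>_indep X_\<epsilon>_indep]) measurable
  from indep_var_lebesgue_integral[OF this X1 e1]
  show "expectation (score t i) = 0"
    unfolding score_def[abs_def] by (simp add: \<epsilon>_mean mult.commute)
  have ind: "indep_var borel (\<lambda>\<omega>. (X i \<omega> \<bullet> t)\<^sup>2) borel (\<lambda>\<omega>. (\<epsilon> i \<omega>)\<^sup>2)"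
    by (rule indep_var_components[OF X_indep \<epsilon>_indep X_\<epsilon>_indep]) measurable
  show "expectation (\<lambda>\<omega>. (score t i \<omega>)\<^sup>2) = \<sigma>\<^sup>2 * (norm t)\<^sup>2"
    using indep_var_lebesgue_integral[OF ind X2(1) \<epsilon>_square_integrable]
    by (simp add: score_def \<epsilon>_variance X2 power_mult_distrib mult.commute)
  show "integrable M (\<lambda>\<omega>. (score t i \<omega>)\<^sup>2)"
    using indep_var_integrable[OF ind X2(1) \<epsilon>_square_integrable]
    by (simp add: score_def power_mult_distrib mult.commute)
qed

definition W :: "nat \<Rightarrow> 'w \<Rightarrow> 'v" where
  "W n \<omega> = (1 / sqrt (real n)) *\<^sub>R (\<Sum>i<n. \<epsilon> i \<omega> *\<^sub>R X i \<omega>)"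

lemma W_measurable [measurable]: "random_variable borel (W n)"
  unfolding W_def[abs_def] by measurable

lemma W_inner: "W n \<omega> \<bullet> t = (\<Sum>i<n. score t i \<omega>) / sqrt (real n)"
  by (simp add: W_def inner_sum_left score_def)

text \<open>An inequality rather than an equality, because \<open>W 0\<close> is the zero
  vector.\<close>

lemma W_second_moment:
  shows "integrable M (\<lambda>\<omega>. (W n \<omega> \<bullet> t)\<^sup>2)" "expectation (\<lambda>\<omega>. (W n \<omega> \<bullet> t)\<^sup>2) \<le> \<sigma>\<^sup>2 * (norm t)\<^sup>2"
  using indep_vars_sum_square[OF score_indep score_moments(2,1,3), where n=n]
  by (auto simp: W_inner power_divide)

lemma W_tail:
  assumes "R > 0"
  shows "prob {\<omega> \<in> space M. R \<le> \<bar>W n \<omega> \<bullet> t\<bar>} \<le> \<sigma>\<^sup>2 * (norm t)\<^sup>2 / R\<^sup>2"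
proof -
  have "prob {\<omega> \<in> space M. R \<le> \<bar>W n \<omega> \<bullet> t\<bar>} \<le> expectation (\<lambda>\<omega>. (W n \<omega> \<bullet> t)\<^sup>2) / R\<^sup>2"
    using W_second_moment(1) assms by (intro second_moment_tail) auto
  also have "\<dots> \<le> \<sigma>\<^sup>2 * (norm t)\<^sup>2 / R\<^sup>2"
    using W_second_moment(2) by (intro divide_right_mono) auto
  finally show ?thesis .
qed

lemma W_tight:
  assumes "e > 0"
  shows "\<exists>R>0. \<forall>n. prob {\<omega> \<in> space M. R \<le> \<bar>W n \<omega> \<bullet> t\<bar>} \<le> e"
proof -
  \<comment> \<open>Chebyshev requires \<sigma>^2 times the squared norm of \<open>t\<close> to be
    at most e R^2; the \<open>+ 1\<close> keeps \<open>R\<close> positive for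
    \<open>t = 0\<close>.\<close>
  define R where "R = sqrt (\<sigma>\<^sup>2 * (norm t)\<^sup>2 / e + 1)"
  have "0 \<le> \<sigma>\<^sup>2 * (norm t)\<^sup>2 / e" using assms by simp
  then have R: "R > 0" "R\<^sup>2 = \<sigma>\<^sup>2 * (norm t)\<^sup>2 / e + 1" unfolding R_def by auto
  have "\<sigma>\<^sup>2 * (norm t)\<^sup>2 / R\<^sup>2 \<le> e"
  proof (subst pos_divide_le_eq)
    show "\<sigma>\<^sup>2 * (norm t)\<^sup>2 \<le> e * R\<^sup>2" unfolding R(2) using assms by (simp add: distrib_left)
  qed (rule zero_less_power[OF R(1)])
  then show ?thesis using W_tail[OF R(1), of _ t] R(1) by (meson order_trans)
qed

lemma W_central_limit:
  assumes "t \<noteq> 0"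
  shows "weak_conv_m (\<lambda>n. distr M borel (\<lambda>\<omega>. (W n \<omega> \<bullet> t) / (\<bar>\<sigma>\<bar> * norm t))) std_normal_distribution"
proof -
  have pos: "0 < \<bar>\<sigma>\<bar> * norm t" using assms \<sigma>_nonzero by simp
  have eq: "(W n \<omega> \<bullet> t) / (\<bar>\<sigma>\<bar> * norm t) = (\<Sum>i<n. score t i \<omega>) / sqrt (real n * (\<bar>\<sigma>\<bar> * norm t)\<^sup>2)" for n \<omega>
    using pos by (simp add: W_inner real_sqrt_mult)
  have "variance (score t n) = (\<bar>\<sigma>\<bar> * norm t)\<^sup>2" for n
    using score_moments[of t n] by (simp add: power_mult_distrib)
  then show ?thesis
    unfolding eq using central_limit_theorem_zero_mean[OF score_indep score_moments(1) pos score_moments(2) _ score_ident]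
    by simp
qed

lemma W_scaled_distribution: "real_distribution (distr M borel (\<lambda>\<omega>. (W n \<omega> \<bullet> t) / c))"
  by (rule real_distribution_distr) measurable

lemma W_set_limit:
  assumes "t \<noteq> 0" "A \<in> sets borel" "emeasure lborel (frontier A) = 0"
  shows "(\<lambda>n. prob {\<omega> \<in> space M. (W n \<omega> \<bullet> t) / (\<bar>\<sigma>\<bar> * norm t) \<in> A}) \<longlonglongrightarrow> measure std_normal_distribution A"
proof -
  have null: "emeasure std_normal_distribution (frontier A) = 0"
    using assms by (intro emeasure_std_normal_null) auto
  have "(\<lambda>n. measure (distr M borel (\<lambda>\<omega>. (W n \<omega> \<bullet> t) / (\<bar>\<sigma>\<bar> * norm t))) A) \<longlonglongrightarrow> measure std_normal_distribution A"
    by (rule weak_conv_imp_continuity_set_conv[OF W_scaled_distribution real_dist_normal_dist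
          W_central_limit[OF assms(1)] assms(2) null])
  moreover have "measure (distr M borel (\<lambda>\<omega>. (W n \<omega> \<bullet> t) / (\<bar>\<sigma>\<bar> * norm t))) A
      = prob {\<omega> \<in> space M. (W n \<omega> \<bullet> t) / (\<bar>\<sigma>\<bar> * norm t) \<in> A}" for n
    using assms(2) by (subst measure_distr) (auto intro!: arg_cong[where f=prob])
  ultimately show ?thesis by simp
qed

text \<open>After normalisation the layer is an interval whose Gaussian mass is bounded by its
  length, and convergence of the distributions transfers the bound to large
  \<open>n\<close>.\<close>

lemma W_layer:
  assumes "t \<noteq> 0" "\<kappa> > 0"
  shows "\<exists>\<eta>>0. \<forall>\<^sub>F n in sequentially. prob {\<omega> \<in> space M. \<bar>W n \<omega> \<bullet> t - c\<bar> \<le> \<eta> * norm t} \<le> \<kappa>"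
proof -
  define s where "s = \<bar>\<sigma>\<bar> * norm t"
  have s: "s > 0" using assms \<sigma>_nonzero by (simp add: s_def)
  \<comment> \<open>Chosen so that \<open>\<eta> * norm t\<close> is
    \<open>s * (\<kappa> / 4)\<close>: the normalised layer has length
    \<open>\<kappa> / 2\<close>.\<close>
  define \<eta> where "\<eta> = \<kappa> * \<bar>\<sigma>\<bar> / 4"
  have \<eta>: "\<eta> > 0" using assms \<sigma>_nonzero by (simp add: \<eta>_def)
  let ?A = "{c / s - \<kappa> / 4..c / s + \<kappa> / 4}"
  have "frontier ?A \<subseteq> {c / s - \<kappa> / 4, c / s + \<kappa> / 4}" by (auto simp: frontier_def)
  then have "emeasure lborel (frontier ?A) = 0"
    by (intro emeasure_lborel_countable countable_finite) (rule finite_subset, auto)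
  then have lim: "(\<lambda>n. prob {\<omega> \<in> space M. (W n \<omega> \<bullet> t) / s \<in> ?A}) \<longlonglongrightarrow> measure std_normal_distribution ?A"
    using W_set_limit[OF assms(1), of ?A] by (simp add: s_def)
  have "measure std_normal_distribution ?A \<le> (c / s + \<kappa> / 4) - (c / s - \<kappa> / 4)"
    using assms(2) by (intro std_normal_interval_le) auto
  then have "measure std_normal_distribution ?A < \<kappa>" using assms(2) by simp
  from order_tendstoD(2)[OF lim this]
  have "\<forall>\<^sub>F n in sequentially. prob {\<omega> \<in> space M. \<bar>W n \<omega> \<bullet> t - c\<bar> \<le> \<eta> * norm t} \<le> \<kappa>"
  proof eventually_elim
    case (elim n)
    have "{\<omega> \<in> space M. \<bar>W n \<omega> \<bullet> t - c\<bar> \<le> \<eta> * norm t} \<subseteq> {\<omega> \<in> space M. (W n \<omega> \<bullet> t) / s \<in> ?A}"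
    proof safe
      fix \<omega> assume *: "\<bar>W n \<omega> \<bullet> t - c\<bar> \<le> \<eta> * norm t"
      have "\<eta> * norm t = s * (\<kappa> / 4)" by (simp add: \<eta>_def s_def)
      then have "\<bar>W n \<omega> \<bullet> t / s - c / s\<bar> \<le> \<kappa> / 4"
        using * s by (simp add: diff_divide_distrib[symmetric] abs_divide pos_divide_le_eq mult.commute)
      then show "(W n \<omega> \<bullet> t) / s \<in> ?A"
        unfolding atLeastAtMost_iff abs_le_iff by (intro conjI) linarith+
    qed
    then have "prob {\<omega> \<in> space M. \<bar>W n \<omega> \<bullet> t - c\<bar> \<le> \<eta> * norm t} \<le> prob {\<omega> \<in> space M. (W n \<omega> \<bullet> t) / s \<in> ?A}"
      by (intro finite_measure_mono) measurable
    then show ?case using elim by linarith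
  qed
  then show ?thesis using \<eta> by blast
qed

text \<open>The threshold \<open>norm t\<close> is the error left by
  \<open>recovery_sandwich\<close> at tolerance 1.\<close>

lemma W_halfspace_bound:
  assumes "t \<noteq> 0"
  shows "\<exists>q<1. \<forall>\<^sub>F n in sequentially. prob {\<omega> \<in> space M. W n \<omega> \<bullet> t \<le> norm t} \<le> q"
proof -
  define s where "s = \<bar>\<sigma>\<bar> * norm t"
  have s: "s > 0" using assms \<sigma>_nonzero by (simp add: s_def)
  let ?A = "{..norm t / s}"
  obtain q where q: "measure std_normal_distribution ?A < q" "q < 1"
    using dense[OF std_normal_atMost_less_1] by blast
  have "emeasure lborel (frontier ?A) = 0" by (subst frontier_real_atMost) auto
  then have lim: "(\<lambda>n. prob {\<omega> \<in> space M. (W n \<omega> \<bullet> t) / s \<in> ?A}) \<longlonglongrightarrow> measure std_normal_distribution ?A"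
    using W_set_limit[OF assms, of ?A] by (simp add: s_def)
  have "{\<omega> \<in> space M. (W n \<omega> \<bullet> t) / s \<in> ?A} = {\<omega> \<in> space M. W n \<omega> \<bullet> t \<le> norm t}" for n
    using s by (auto simp: divide_le_cancel)
  then have "\<forall>\<^sub>F n in sequentially. prob {\<omega> \<in> space M. W n \<omega> \<bullet> t \<le> norm t} < q"
    using order_tendstoD(2)[OF lim q(1)] by simp
  then show ?thesis using q(2) by (auto elim!: eventually_mono intro!: exI[of _ q])
qed

text \<open>The central limit theorem tested on a bounded continuous function; for
  \<open>t = 0\<close> there is nothing to normalise and the sequence is constant.\<close>

lemma W_cos_convergent: "convergent (\<lambda>n. expectation (\<lambda>\<omega>. cos (W n \<omega> \<bullet> t + c)))"
proof (cases "t = 0")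
  case True
  then show ?thesis by (simp add: convergent_const)
next
  case False
  define s where "s = \<bar>\<sigma>\<bar> * norm t"
  have s: "s > 0" using False \<sigma>_nonzero by (simp add: s_def)
  define f where "f = (\<lambda>x. cos (s * x + c))"
  have "(\<lambda>n. integral\<^sup>L (distr M borel (\<lambda>\<omega>. (W n \<omega> \<bullet> t) / s)) f) \<longlonglongrightarrow> integral\<^sup>L std_normal_distribution f"
  proof (rule weak_conv_imp_integral_bdd_continuous_conv[OF W_scaled_distribution real_dist_normal_dist])
    show "weak_conv_m (\<lambda>n. distr M borel (\<lambda>\<omega>. (W n \<omega> \<bullet> t) / s)) std_normal_distribution"
      unfolding s_def using False by (rule W_central_limit)
    show "isCont f x" for x unfolding f_def by (intro continuous_intros)
    show "norm (f x) \<le> 1" for x by (simp add: f_def)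
  qed
  moreover have "integral\<^sup>L (distr M borel (\<lambda>\<omega>. (W n \<omega> \<bullet> t) / s)) f = expectation (\<lambda>\<omega>. cos (W n \<omega> \<bullet> t + c))" for n
    using s by (subst integral_distr) (auto simp: f_def)
  ultimately show ?thesis by (auto simp: convergent_def)
qed

text \<open>The normalised Gram matrix \<open>(1 / n) X\<^sup>T X\<close> as a bilinear form.\<close>

definition gram :: "nat \<Rightarrow> 'w \<Rightarrow> 'v \<Rightarrow> 'v \<Rightarrow> real" where
  "gram n \<omega> u v = (\<Sum>i<n. (X i \<omega> \<bullet> u) * (X i \<omega> \<bullet> v)) / real n"

lemma bilinear_gram: "bilinear (gram n \<omega>)"
  unfolding bilinear_def gram_def
  by (auto intro!: linearI simp: inner_add_right sum.distrib add_divide_distrib algebra_simps sum_distrib_left sum_divide_distrib)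

lemma gram_sym: "gram n \<omega> u v = gram n \<omega> v u"
  by (simp add: gram_def mult.commute)

text \<open>The bound \<open>\<delta>\<close> is divided by the number of matrix entries, because
  expanding a bilinear form in the basis adds up one error per entry.\<close>

definition gram_far :: "nat \<Rightarrow> real \<Rightarrow> 'w set" where
  "gram_far n \<delta> = (\<Union>(i, j)\<in>Basis \<times> Basis. {\<omega> \<in> space M. \<delta> / real (DIM('v) * DIM('v)) \<le> \<bar>gram n \<omega> i j - i \<bullet> j\<bar>})"

lemma gram_measurable [measurable]: "random_variable borel (\<lambda>\<omega>. gram n \<omega> u v)"
  unfolding gram_def by measurable

lemma gram_far_event [measurable]: "gram_far n \<delta> \<in> events"
  unfolding gram_far_def by (intro sets.finite_UN) auto

lemma gram_near:
  assumes "\<omega> \<in> space M - gram_far n \<delta>"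
  shows "\<bar>gram n \<omega> u v - u \<bullet> v\<bar> \<le> \<delta> * norm u * norm v"
proof -
  have lin: "gram n \<omega> u v = (\<Sum>(i, j)\<in>Basis \<times> Basis. (u \<bullet> i) * (v \<bullet> j) * gram n \<omega> i j)"
  proof -
    have "gram n \<omega> u v = gram n \<omega> (\<Sum>i\<in>Basis. (u \<bullet> i) *\<^sub>R i) (\<Sum>j\<in>Basis. (v \<bullet> j) *\<^sub>R j)"
      by (simp add: euclidean_representation)
    also have "\<dots> = (\<Sum>(i, j)\<in>Basis \<times> Basis. gram n \<omega> ((u \<bullet> i) *\<^sub>R i) ((v \<bullet> j) *\<^sub>R j))"
      by (rule bilinear_sum[OF bilinear_gram])
    finally show ?thesis
      by (simp add: bilinear_lmul[OF bilinear_gram] bilinear_rmul[OF bilinear_gram] case_prod_unfold mult_ac)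
  qed
  have "u \<bullet> v = (\<Sum>i\<in>Basis. \<Sum>j\<in>Basis. (u \<bullet> i) * (v \<bullet> j) * (i \<bullet> j))"
    by (simp add: inner_Basis euclidean_inner[of u v] if_distrib cong: if_cong)
  then have inn: "u \<bullet> v = (\<Sum>(i, j)\<in>Basis \<times> Basis. (u \<bullet> i) * (v \<bullet> j) * (i \<bullet> j))"
    by (simp add: sum.cartesian_product)
  have "\<bar>gram n \<omega> u v - u \<bullet> v\<bar> = \<bar>\<Sum>(i, j)\<in>Basis \<times> Basis. (u \<bullet> i) * (v \<bullet> j) * (gram n \<omega> i j - i \<bullet> j)\<bar>"
    unfolding lin inn by (simp add: sum_subtractf case_prod_unfold right_diff_distrib)
  also have "\<dots> \<le> (\<Sum>(i, j)\<in>Basis \<times> Basis. \<bar>(u \<bullet> i) * (v \<bullet> j) * (gram n \<omega> i j - i \<bullet> j)\<bar>)"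
    unfolding case_prod_unfold by (rule sum_abs)
  also have "\<dots> \<le> (\<Sum>(i, j)\<in>(Basis \<times> Basis :: ('v \<times> 'v) set). norm u * norm v * (\<delta> / real (DIM('v) * DIM('v))))"
  proof (rule sum_mono)
    fix k :: "'v \<times> 'v" assume "k \<in> Basis \<times> Basis"
    then obtain i j where k: "k = (i, j)" and ij: "i \<in> Basis" "j \<in> Basis" by blast
    then have "\<bar>gram n \<omega> i j - i \<bullet> j\<bar> \<le> \<delta> / real (DIM('v) * DIM('v))"
      using assms unfolding gram_far_def by force
    then have "\<bar>(u \<bullet> i) * (v \<bullet> j) * (gram n \<omega> i j - i \<bullet> j)\<bar> \<le> norm u * norm v * (\<delta> / real (DIM('v) * DIM('v)))"
      unfolding abs_mult using ij by (intro mult_mono Basis_le_norm) auto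
    then show "(case k of (i, j) \<Rightarrow> \<bar>(u \<bullet> i) * (v \<bullet> j) * (gram n \<omega> i j - i \<bullet> j)\<bar>)
        \<le> (case k of (i, j) \<Rightarrow> norm u * norm v * (\<delta> / real (DIM('v) * DIM('v))))" by (simp add: k)
  qed
  also have "\<dots> = \<delta> * norm u * norm v" by (simp add: card_cartesian_product)
  finally show ?thesis .
qed

lemma gram_far_tendsto:
  assumes "\<delta> > 0"
  shows "(\<lambda>n. prob (gram_far n \<delta>)) \<longlonglongrightarrow> 0"
proof -
  let ?d = "\<delta> / real (DIM('v) * DIM('v))"
  let ?A = "\<lambda>n (i, j). {\<omega> \<in> space M. ?d \<le> \<bar>gram n \<omega> i j - i \<bullet> j\<bar>}"
  have d: "?d > 0" using assms by simp
  have entry: "(\<lambda>n. prob {\<omega> \<in> space M. ?d \<le> \<bar>gram n \<omega> i j - i \<bullet> j\<bar>}) \<longlonglongrightarrow> 0" for i j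
    unfolding gram_def
  proof (rule weak_law_of_large_numbers[OF _ _ integrable_X_product X_covariance d])
    show "indep_vars (\<lambda>_. borel) (\<lambda>k \<omega>. (X k \<omega> \<bullet> i) * (X k \<omega> \<bullet> j)) UNIV"
      by (rule indep_vars_compose2[OF X_indep, where Y="\<lambda>_ x. (x \<bullet> i) * (x \<bullet> j)"]) measurable
    have eq: "distr M borel (\<lambda>\<omega>. (X k \<omega> \<bullet> i) * (X k \<omega> \<bullet> j)) = distr (distr M borel (X k)) borel (\<lambda>x. (x \<bullet> i) * (x \<bullet> j))" for k
      by (subst distr_distr) (auto simp: comp_def)
    show "distr M borel (\<lambda>\<omega>. (X k \<omega> \<bullet> i) * (X k \<omega> \<bullet> j)) = distr M borel (\<lambda>\<omega>. (X 0 \<omega> \<bullet> i) * (X 0 \<omega> \<bullet> j))" for k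
      unfolding eq X_ident[of k] by (rule refl)
  qed
  have "(\<lambda>n. prob (?A n k)) \<longlonglongrightarrow> 0" for k
    by (cases k) (simp only: prod.case entry)
  then have "(\<lambda>n. \<Sum>k\<in>Basis \<times> Basis. prob (?A n k)) \<longlonglongrightarrow> (\<Sum>k\<in>(Basis \<times> Basis :: ('v \<times> 'v) set). 0)"
    by (rule tendsto_sum)
  then have lim: "(\<lambda>n. \<Sum>k\<in>Basis \<times> Basis. prob (?A n k)) \<longlonglongrightarrow> 0" by simp
  have "prob (gram_far n \<delta>) \<le> (\<Sum>k\<in>Basis \<times> Basis. prob (?A n k))" for n
    unfolding gram_far_def by (intro finite_measure_subadditive_finite) auto
  then show ?thesis
    by (intro tendsto_sandwich[OF always_eventually always_eventually tendsto_const lim]) auto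
qed

text \<open>If the norm exceeds the sum of the coordinate radii, so does the sum of absolute
  coordinates, and some coordinate is large; a union bound shares \<open>e\<close> among the
  coordinates.\<close>

lemma W_norm_tail:
  assumes "e > 0"
  shows "\<exists>R. \<forall>n. prob {\<omega> \<in> space M. R < norm (W n \<omega>)} \<le> e"
proof -
  define e' where "e' = e / real DIM('v)"
  have "e' > 0" using assms by (simp add: e'_def)
  then obtain r where r: "\<And>b. r b > 0" "\<And>b n. prob {\<omega> \<in> space M. r b \<le> \<bar>W n \<omega> \<bullet> b\<bar>} \<le> e'"
    using W_tight[of e'] by metis
  have "prob {\<omega> \<in> space M. (\<Sum>b\<in>Basis. r b) < norm (W n \<omega>)} \<le> e" for n
  proof -
    have "{\<omega> \<in> space M. (\<Sum>b\<in>Basis. r b) < norm (W n \<omega>)} \<subseteq> (\<Union>b\<in>Basis. {\<omega> \<in> space M. r b \<le> \<bar>W n \<omega> \<bullet> b\<bar>})"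
    proof
      fix \<omega> assume \<omega>: "\<omega> \<in> {\<omega> \<in> space M. (\<Sum>b\<in>Basis. r b) < norm (W n \<omega>)}"
      show "\<omega> \<in> (\<Union>b\<in>Basis. {\<omega> \<in> space M. r b \<le> \<bar>W n \<omega> \<bullet> b\<bar>})"
      proof (rule ccontr)
        assume "\<omega> \<notin> (\<Union>b\<in>Basis. {\<omega> \<in> space M. r b \<le> \<bar>W n \<omega> \<bullet> b\<bar>})"
        then have "(\<Sum>b\<in>Basis. \<bar>W n \<omega> \<bullet> b\<bar>) \<le> (\<Sum>b\<in>Basis. r b)"
          using \<omega> by (intro sum_mono) force
        then show False using \<omega> norm_le_l1[of "W n \<omega>"] by simp
      qed
    qed
    then have "prob {\<omega> \<in> space M. (\<Sum>b\<in>Basis. r b) < norm (W n \<omega>)} \<le> prob (\<Union>b\<in>Basis. {\<omega> \<in> space M. r b \<le> \<bar>W n \<omega> \<bullet> b\<bar>})"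
      by (intro finite_measure_mono sets.finite_UN) auto
    also have "\<dots> \<le> (\<Sum>b\<in>Basis. prob {\<omega> \<in> space M. r b \<le> \<bar>W n \<omega> \<bullet> b\<bar>})"
      by (intro finite_measure_subadditive_finite) auto
    also have "\<dots> \<le> (\<Sum>b\<in>(Basis :: 'v set). e')" by (intro sum_mono r)
    also have "\<dots> = e" by (simp add: e'_def)
    finally show ?thesis .
  qed
  then show ?thesis by blast
qed

end

section \<open>Asymptotic recovery for a fixed truth\<close>

locale generalized_lasso_model =
  standard_linear_model M X \<epsilon> \<sigma> + generalized_lasso J l z
  for M :: "'w measure" and X :: "nat \<Rightarrow> 'w \<Rightarrow> 'v::euclidean_space" and \<epsilon> and \<sigma>
    and J :: "'j set" and l :: "'j \<Rightarrow> 'v" and z :: 'v +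
  fixes est :: "real \<Rightarrow> nat \<Rightarrow> 'w \<Rightarrow> 'v"
  assumes est_measurable: "\<And>lam n. lam > 0 \<Longrightarrow> random_variable borel (est lam n)"
    and est_minimal: "\<And>lam n \<omega> \<beta>. lam > 0 \<Longrightarrow> \<omega> \<in> space M \<Longrightarrow>
      1 / 2 * (\<Sum>i<n. (X i \<omega> \<bullet> z + \<epsilon> i \<omega> - X i \<omega> \<bullet> est lam n \<omega>)\<^sup>2) + sqrt (real n) * (lam * penalty (est lam n \<omega>))
      \<le> 1 / 2 * (\<Sum>i<n. (X i \<omega> \<bullet> z + \<epsilon> i \<omega> - X i \<omega> \<bullet> \<beta>)\<^sup>2) + sqrt (real n) * (lam * penalty \<beta>)"
begin

definition recovery :: "real \<Rightarrow> nat \<Rightarrow> 'w set" where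
  "recovery lam n = {\<omega> \<in> space M. same_signs (est lam n \<omega>)}"

lemma recovery_event: "lam > 0 \<Longrightarrow> recovery lam n \<in> events"
proof -
  assume "lam > 0"
  then have [measurable]: "random_variable borel (est lam n)" by (rule est_measurable)
  have "{\<omega> \<in> space M. sgn (l j \<bullet> est lam n \<omega>) = sgn (l j \<bullet> z)} \<in> events" for j by measurable
  then have "{\<omega> \<in> space M. \<forall>j\<in>J. sgn (l j \<bullet> est lam n \<omega>) = sgn (l j \<bullet> z)} \<in> events"
    using finite_rows by (intro sets.sets_Collect_finite_All) auto
  then show ?thesis by (simp add: recovery_def same_signs_def)
qed

text \<open>The penalty weight sqrt n is exactly the order of the noise term. Factoring it out
  leaves the deterministic functional with \<open>m = sqrt (real n)\<close>, whose noise and penalty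
  terms do not grow with \<open>n\<close>.\<close>

lemma objective_expand:
  assumes "n > 0"
  shows "1 / 2 * (\<Sum>i<n. (X i \<omega> \<bullet> z + \<epsilon> i \<omega> - X i \<omega> \<bullet> (z + u))\<^sup>2) + sqrt (real n) * (lam * penalty (z + u))
    = (1 / 2 * (\<Sum>i<n. (\<epsilon> i \<omega>)\<^sup>2) + sqrt (real n) * (lam * penalty z))
      + sqrt (real n) * (sqrt (real n) / 2 * gram n \<omega> u u - u \<bullet> W n \<omega> + lam * (penalty (z + u) - penalty z))"
proof -
  have s: "sqrt (real n) * sqrt (real n) = real n" by simp
  have W: "sqrt (real n) * (u \<bullet> W n \<omega>) = (\<Sum>i<n. \<epsilon> i \<omega> * (X i \<omega> \<bullet> u))"
    using assms W_inner[of n \<omega> u] by (simp add: inner_commute score_def)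
  have G: "real n * gram n \<omega> u u = (\<Sum>i<n. (X i \<omega> \<bullet> u)\<^sup>2)"
    using assms by (simp add: gram_def power2_eq_square)
  have "(\<Sum>i<n. (X i \<omega> \<bullet> z + \<epsilon> i \<omega> - X i \<omega> \<bullet> (z + u))\<^sup>2)
      = (\<Sum>i<n. (\<epsilon> i \<omega>)\<^sup>2 + (X i \<omega> \<bullet> u)\<^sup>2 - 2 * (\<epsilon> i \<omega> * (X i \<omega> \<bullet> u)))"
    by (intro sum.cong) (auto simp: inner_add_right power2_eq_square algebra_simps)
  also have "\<dots> = (\<Sum>i<n. (\<epsilon> i \<omega>)\<^sup>2) + real n * gram n \<omega> u u - 2 * (sqrt (real n) * (u \<bullet> W n \<omega>))"
    unfolding W G by (simp add: sum.distrib sum_subtractf sum_distrib_left)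
  finally have sq: "(\<Sum>i<n. (X i \<omega> \<bullet> z + \<epsilon> i \<omega> - X i \<omega> \<bullet> (z + u))\<^sup>2)
    = (\<Sum>i<n. (\<epsilon> i \<omega>)\<^sup>2) + sqrt (real n) * sqrt (real n) * gram n \<omega> u u - 2 * (sqrt (real n) * (u \<bullet> W n \<omega>))"
    unfolding s .
  show ?thesis unfolding sq by (simp add: algebra_simps del: real_sqrt_mult_self)
qed

lemma est_increment_minimal:
  assumes "lam > 0" "n > 0" "\<omega> \<in> space M"
  defines "u\<^sub>0 \<equiv> est lam n \<omega> - z"
  shows "sqrt (real n) / 2 * gram n \<omega> u\<^sub>0 u\<^sub>0 - u\<^sub>0 \<bullet> W n \<omega> + lam * (penalty (z + u\<^sub>0) - penalty z)
    \<le> sqrt (real n) / 2 * gram n \<omega> u u - u \<bullet> W n \<omega> + lam * (penalty (z + u) - penalty z)"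
proof -
  have "sqrt (real n) > 0" using assms by simp
  moreover have "est lam n \<omega> = z + u\<^sub>0" by (simp add: u\<^sub>0_def)
  ultimately show ?thesis
    using est_minimal[OF assms(1,3), of n "z + u"] by (simp only: objective_expand[OF assms(2)] add_le_cancel_left mult_le_cancel_left_pos)
qed

text \<open>\<open>Bad\<close> collects the samples with large noise or with a Gram form far from
  the identity; outside it the deterministic comparisons apply, one for each inclusion. The
  tolerance \<open>\<eta>\<close> is left free, since its three uses choose it differently.\<close>

lemma recovery_sandwich:
  assumes lam: "lam > 0" and "\<eta> > 0" "\<kappa> > 0"
  obtains Bad where "\<And>n. Bad n \<in> events"
    "\<forall>\<^sub>F n in sequentially. prob (Bad n) \<le> \<kappa> \<and> (\<forall>\<omega>\<in>space M - Bad n.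
       (\<omega> \<in> recovery lam n \<longrightarrow> (\<forall>v\<in>normal_space. W n \<omega> \<bullet> v \<le> lam * (slope \<bullet> v + kink v) + \<eta> * norm v)) \<and>
       ((\<forall>v\<in>normal_space. W n \<omega> \<bullet> v + \<eta> * norm v \<le> lam * (slope \<bullet> v + kink v)) \<longrightarrow> \<omega> \<in> recovery lam n))"
proof -
  obtain R0 where R0: "\<And>n. prob {\<omega> \<in> space M. R0 < norm (W n \<omega>)} \<le> \<kappa> / 2"
    using W_norm_tail[of "\<kappa> / 2"] \<open>\<kappa> > 0\<close> by auto
  define R where "R = max R0 0"
  define G where "G = (\<Sum>j\<in>J. norm (l j))"
  \<comment> \<open>This is the constant in \<open>minimizer_bound\<close>. Then
    \<open>\<delta>\<close> is at most 1/2 for coercivity and at most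
    \<open>\<eta> / (R' + 1)\<close>, where the \<open>+ 1\<close> yields the strict inequality
    \<open>\<delta> * R' < \<eta>\<close>.\<close>
  define R' where "R' = 4 * (R + lam * G)"
  have R': "R' \<ge> 0" using lam by (auto simp: R'_def R_def G_def intro!: add_nonneg_nonneg mult_nonneg_nonneg sum_nonneg)
  define \<delta> where "\<delta> = min (1 / 2) (\<eta> / (R' + 1))"
  have \<delta>: "\<delta> > 0" "\<delta> \<le> 1 / 2"
    using R' \<open>\<eta> > 0\<close> unfolding \<delta>_def by (simp, intro min.cobounded1)
  have \<delta>R: "\<delta> * R' < \<eta>"
  proof -
    have "\<delta> * (R' + 1) \<le> \<eta> / (R' + 1) * (R' + 1)" using R' by (intro mult_right_mono) (auto simp: \<delta>_def)
    also have "\<dots> = \<eta>" using R' by simp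
    finally show ?thesis using \<delta>(1) by (simp add: distrib_left)
  qed
  obtain r where r: "r > 0" "\<And>u j. norm u < r \<Longrightarrow> j \<in> J - ties \<Longrightarrow> \<bar>l j \<bullet> u\<bar> < \<bar>l j \<bullet> z\<bar>"
    using signs_stable_radius by blast
  define Bad where "Bad n = {\<omega> \<in> space M. R0 < norm (W n \<omega>)} \<union> gram_far n \<delta>" for n
  have Bad: "Bad n \<in> events" for n unfolding Bad_def by measurable
  have "filterlim (\<lambda>n. r * sqrt (real n)) at_top sequentially"
    by (intro filterlim_tendsto_pos_mult_at_top[OF tendsto_const r(1)]
        filterlim_compose[OF sqrt_at_top filterlim_real_sequentially])
  then have large: "\<forall>\<^sub>F n in sequentially. R' < r * sqrt (real n)"
    by (simp add: filterlim_at_top_dense)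
  have far: "\<forall>\<^sub>F n in sequentially. prob (gram_far n \<delta>) < \<kappa> / 2"
    using gram_far_tendsto[OF \<delta>(1)] \<open>\<kappa> > 0\<close> by (intro order_tendstoD) auto
  have "\<forall>\<^sub>F n in sequentially. prob (Bad n) \<le> \<kappa> \<and> (\<forall>\<omega>\<in>space M - Bad n.
       (\<omega> \<in> recovery lam n \<longrightarrow> (\<forall>v\<in>normal_space. W n \<omega> \<bullet> v \<le> lam * (slope \<bullet> v + kink v) + \<eta> * norm v)) \<and>
       ((\<forall>v\<in>normal_space. W n \<omega> \<bullet> v + \<eta> * norm v \<le> lam * (slope \<bullet> v + kink v)) \<longrightarrow> \<omega> \<in> recovery lam n))"
    using large far eventually_gt_at_top[of 0]
  proof eventually_elim
    case (elim n)
    have "prob (Bad n) \<le> prob {\<omega> \<in> space M. R0 < norm (W n \<omega>)} + prob (gram_far n \<delta>)"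
      unfolding Bad_def by (intro measure_Un_le) auto
    then have "prob (Bad n) \<le> \<kappa>" using R0[of n] elim(2) by linarith
    moreover have "(\<omega> \<in> recovery lam n \<longrightarrow> (\<forall>v\<in>normal_space. W n \<omega> \<bullet> v \<le> lam * (slope \<bullet> v + kink v) + \<eta> * norm v)) \<and>
       ((\<forall>v\<in>normal_space. W n \<omega> \<bullet> v + \<eta> * norm v \<le> lam * (slope \<bullet> v + kink v)) \<longrightarrow> \<omega> \<in> recovery lam n)"
      if \<omega>: "\<omega> \<in> space M - Bad n" for \<omega>
    proof -
      define u\<^sub>0 where "u\<^sub>0 = est lam n \<omega> - z"
      have \<omega>M: "\<omega> \<in> space M" using \<omega> by blast
      have near: "\<And>u v. \<bar>gram n \<omega> u v - u \<bullet> v\<bar> \<le> \<delta> * norm u * norm v"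
        using \<omega> by (intro gram_near) (auto simp: Bad_def)
      have m: "0 < sqrt (real n)" using elim by simp
      have WR: "norm (W n \<omega>) \<le> R" using \<omega> by (auto simp: Bad_def R_def)
      have large': "4 * (R + lam * (\<Sum>j\<in>J. norm (l j))) < r * sqrt (real n)"
        using elim(1) by (simp add: R'_def G_def)
      note core = bilinear_gram gram_sym near \<delta>(2) m lam WR r(2) large'
        est_increment_minimal[OF lam elim(3) \<omega>M, folded u\<^sub>0_def]
      have rec: "\<omega> \<in> recovery lam n \<longleftrightarrow> u\<^sub>0 \<in> tie_space"
      proof -
        have "\<omega> \<in> recovery lam n \<longleftrightarrow> same_signs (z + u\<^sub>0)" using \<omega>M by (simp add: recovery_def u\<^sub>0_def)
        also have "\<dots> \<longleftrightarrow> u\<^sub>0 \<in> tie_space" by (rule minimizer_same_signs_iff[OF core])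
        finally show ?thesis .
      qed
      show ?thesis
      proof (intro conjI impI ballI)
        fix v assume "\<omega> \<in> recovery lam n" and v: "v \<in> normal_space"
        then have "W n \<omega> \<bullet> v \<le> lam * (slope \<bullet> v + kink v) + \<delta> * R' * norm v"
          unfolding R'_def G_def using rec by (intro minimizer_dominated[OF core]) auto
        also have "\<delta> * R' * norm v \<le> \<eta> * norm v" using \<delta>R by (intro mult_right_mono) auto
        finally show "W n \<omega> \<bullet> v \<le> lam * (slope \<bullet> v + kink v) + \<eta> * norm v" by simp
      next
        assume dom: "\<forall>v\<in>normal_space. W n \<omega> \<bullet> v + \<eta> * norm v \<le> lam * (slope \<bullet> v + kink v)"
        have "u\<^sub>0 \<in> tie_space"
          by (rule minimizer_tie_space[OF core, of \<eta>]) (use dom \<delta>R in \<open>auto simp: R'_def G_def\<close>)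
        then show "\<omega> \<in> recovery lam n" using rec by blast
      qed
    qed
    ultimately show ?case by blast
  qed
  then show thesis using that Bad by blast
qed

text \<open>The test set handles only linear functionals, so the norm is linearised at the given
  \<open>v\<close>: tilting \<open>w\<close> by \<eta> times the unit vector of \<open>v\<close>
  gives exactly \<open>\<eta> * norm v\<close> at \<open>v\<close> and, by Cauchy-Schwarz, at most
  \<open>\<eta> * norm e\<close> at each test direction.\<close>

lemma strict_domination_test:
  assumes E: "\<And>x v. (\<And>e. e \<in> E \<Longrightarrow> x \<bullet> e \<le> kink e) \<Longrightarrow> v \<in> normal_space \<Longrightarrow> x \<bullet> v \<le> kink v"
    and lam: "lam > 0" and "\<eta> \<ge> 0" and v: "v \<in> normal_space"
    and w: "\<And>e. e \<in> E \<Longrightarrow> w \<bullet> e + \<eta> * norm e \<le> lam * (slope \<bullet> e + kink e)"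
  shows "w \<bullet> v + \<eta> * norm v \<le> lam * (slope \<bullet> v + kink v)"
proof -
  define x where "x = (1 / lam) *\<^sub>R (w + (\<eta> / norm v) *\<^sub>R v) - slope"
  have x: "lam * (x \<bullet> y) = w \<bullet> y + \<eta> / norm v * (v \<bullet> y) - lam * (slope \<bullet> y)" for y
    using lam by (simp add: x_def inner_diff_left inner_add_left algebra_simps)
  have "x \<bullet> e \<le> kink e" if "e \<in> E" for e
  proof -
    have "\<eta> / norm v * (v \<bullet> e) \<le> \<eta> / norm v * (norm v * norm e)"
      using \<open>\<eta> \<ge> 0\<close> by (intro mult_left_mono norm_cauchy_schwarz) auto
    also have "\<dots> \<le> \<eta> * norm e" using \<open>\<eta> \<ge> 0\<close> by (cases "v = 0") auto
    finally have "lam * (x \<bullet> e) \<le> lam * kink e" using x[of e] w[OF that] by (simp add: distrib_left)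
    then show ?thesis using lam by simp
  qed
  then have "x \<bullet> v \<le> kink v" using v by (rule E)
  then have "lam * (x \<bullet> v) \<le> lam * kink v" using lam by simp
  moreover have "\<eta> / norm v * (v \<bullet> v) = \<eta> * norm v"
    by (cases "v = 0") (auto simp: dot_square_norm power2_eq_square)
  ultimately show ?thesis using x[of v] by (simp add: distrib_left)
qed

text \<open>Outside \<open>Bad\<close> and the layers \<open>L\<close>, each test direction is
  clearly below or clearly above its threshold, so recovery is decided and its indicator agrees with
  a product of continuous ramps. The expectations of these products converge.\<close>

theorem recovery_convergent:
  assumes lam: "lam > 0"
  shows "convergent (\<lambda>n. prob (recovery lam n))"
proof (rule convergent_if_approximable)
  fix e :: real assume "e > 0"
  obtain E where E: "finite E" "E \<subseteq> normal_space - {0}"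
    "\<And>x v. (\<And>e. e \<in> E \<Longrightarrow> x \<bullet> e \<le> kink e) \<Longrightarrow> v \<in> normal_space \<Longrightarrow> x \<bullet> v \<le> kink v"
    by (rule kink_finite_test) blast
  define c where "c d = lam * (slope \<bullet> d + kink d)" for d
  \<comment> \<open>One share of \<open>e\<close> for \<open>Bad\<close> and one for the layer of
    each direction.\<close>
  define \<kappa> where "\<kappa> = e / (real (card E) + 1)"
  have \<kappa>: "\<kappa> > 0" using \<open>e > 0\<close> by (simp add: \<kappa>_def)
  have "\<forall>d\<in>E. \<exists>\<eta>. 0 < \<eta> \<and>
      (\<forall>\<^sub>F n in sequentially. prob {\<omega> \<in> space M. \<bar>W n \<omega> \<bullet> d - c d\<bar> \<le> \<eta> * norm d} \<le> \<kappa>)"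
  proof
    fix d assume "d \<in> E"
    then have "d \<noteq> 0" using E(2) by blast
    from W_layer[OF this \<kappa>, of "c d"] show "\<exists>\<eta>. 0 < \<eta> \<and>
      (\<forall>\<^sub>F n in sequentially. prob {\<omega> \<in> space M. \<bar>W n \<omega> \<bullet> d - c d\<bar> \<le> \<eta> * norm d} \<le> \<kappa>)" .
  qed
  from bchoice[OF this] obtain h where "\<forall>d\<in>E. 0 < h d \<and>
      (\<forall>\<^sub>F n in sequentially. prob {\<omega> \<in> space M. \<bar>W n \<omega> \<bullet> d - c d\<bar> \<le> h d * norm d} \<le> \<kappa>)" ..
  then have h: "\<And>d. d \<in> E \<Longrightarrow> h d > 0"
    "\<And>d. d \<in> E \<Longrightarrow> \<forall>\<^sub>F n in sequentially. prob {\<omega> \<in> space M. \<bar>W n \<omega> \<bullet> d - c d\<bar> \<le> h d * norm d} \<le> \<kappa>"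
    by (simp_all only: Ball_def)
  define \<eta> where "\<eta> = Min (insert 1 (h ` E))"
  have \<eta>: "\<eta> > 0" using E(1) h(1) by (simp add: \<eta>_def)
  have \<eta>_le: "\<eta> \<le> h d" if "d \<in> E" for d using that E(1) by (simp add: \<eta>_def)
  define L where "L d n = {\<omega> \<in> space M. \<bar>W n \<omega> \<bullet> d - c d\<bar> \<le> \<eta> * norm d}" for d n
  have L_event [measurable]: "L d n \<in> events" for d n unfolding L_def by measurable
  have L: "\<forall>\<^sub>F n in sequentially. prob (L d n) \<le> \<kappa>" if "d \<in> E" for d
    using h(2)[OF that]
  proof eventually_elim
    case (elim n)
    have "prob (L d n) \<le> prob {\<omega> \<in> space M. \<bar>W n \<omega> \<bullet> d - c d\<bar> \<le> h d * norm d}"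
    proof (rule finite_measure_mono)
      have "\<eta> * norm d \<le> h d * norm d" using \<eta>_le[OF that] by (rule mult_right_mono) simp
      then show "L d n \<subseteq> {\<omega> \<in> space M. \<bar>W n \<omega> \<bullet> d - c d\<bar> \<le> h d * norm d}"
        unfolding L_def by (auto elim: order_trans)
    qed measurable
    then show ?case using elim by linarith
  qed
  obtain Bad where Bad: "\<And>n. Bad n \<in> events"
    "\<forall>\<^sub>F n in sequentially. prob (Bad n) \<le> \<kappa> \<and> (\<forall>\<omega>\<in>space M - Bad n.
       (\<omega> \<in> recovery lam n \<longrightarrow> (\<forall>v\<in>normal_space. W n \<omega> \<bullet> v \<le> lam * (slope \<bullet> v + kink v) + \<eta> * norm v)) \<and>
       ((\<forall>v\<in>normal_space. W n \<omega> \<bullet> v + \<eta> * norm v \<le> lam * (slope \<bullet> v + kink v)) \<longrightarrow> \<omega> \<in> recovery lam n))"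
    using recovery_sandwich[OF lam \<eta> \<kappa>] by blast
  note [measurable] = Bad(1) recovery_event[OF lam]
  \<comment> \<open>A ramp falling from 1 to 0 across the layer of half-width
    \<open>\<eta> * norm d\<close> around \<open>c d\<close>.\<close>
  define \<psi> where "\<psi> d y = max 0 (min 1 ((c d + \<eta> * norm d - y) / (2 * (\<eta> * norm d))))" for d y
  have cont: "continuous_on UNIV (\<psi> d)" for d
    unfolding \<psi>_def divide_inverse by (intro continuous_intros)
  have bound: "0 \<le> \<psi> d y" "\<psi> d y \<le> 1" for d y by (auto simp: \<psi>_def)
  have [measurable]: "\<psi> d \<in> borel_measurable borel" for d
    by (rule borel_measurable_continuous_onI[OF cont])
  have \<psi>_ends: "d \<in> E \<Longrightarrow> y < c d - \<eta> * norm d \<Longrightarrow> \<psi> d y = 1"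
    "d \<in> E \<Longrightarrow> y > c d + \<eta> * norm d \<Longrightarrow> \<psi> d y = 0" for d y
  proof -
    assume "d \<in> E"
    then have "norm d > 0" using E(2) by auto
    then have pos: "\<eta> * norm d > 0" using \<eta> by (rule mult_pos_pos[rotated])
    show "y < c d - \<eta> * norm d \<Longrightarrow> \<psi> d y = 1"
      using pos by (simp add: \<psi>_def min_absorb1 le_divide_eq)
    show "y > c d + \<eta> * norm d \<Longrightarrow> \<psi> d y = 0"
      using pos by (simp add: \<psi>_def max_absorb1 min.coboundedI2 divide_le_0_iff)
  qed
  define b where "b n = expectation (\<lambda>\<omega>. \<Prod>d\<in>E. \<psi> d (W n \<omega> \<bullet> d))" for n
  have "trig_convergent W (\<lambda>_ _. 1)"
    unfolding trig_convergent_def using W_cos_convergent by simp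
  then have "trig_convergent W (\<lambda>n \<omega>. \<Prod>d\<in>E. \<psi> d (W n \<omega> \<bullet> d))"
  proof (rule trig_convergent_prod[OF W_measurable E(1) _ cont bound])
    show "\<exists>R>0. \<forall>\<^sub>F n in sequentially. prob {\<omega> \<in> space M. R \<le> \<bar>W n \<omega> \<bullet> d\<bar>} \<le> e" if pos: "e > 0" for d e
    proof -
      obtain R where "R > 0" "\<And>n. prob {\<omega> \<in> space M. R \<le> \<bar>W n \<omega> \<bullet> d\<bar>} \<le> e"
        using W_tight[OF pos, of d] by blast
      then show ?thesis by (intro exI[of _ R] conjI always_eventually allI)
    qed
  qed
  then have "convergent (\<lambda>n. expectation (\<lambda>\<omega>. (\<Prod>d\<in>E. \<psi> d (W n \<omega> \<bullet> d)) * cos (W n \<omega> \<bullet> 0 + 0)))"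
    unfolding trig_convergent_def by blast
  then have "convergent b" unfolding b_def by simp
  moreover have "\<forall>\<^sub>F n in sequentially. \<forall>d\<in>E. prob (L d n) \<le> \<kappa>"
    using E(1) L by (simp add: eventually_ball_finite)
  then have "\<forall>\<^sub>F n in sequentially. \<bar>prob (recovery lam n) - b n\<bar> \<le> e"
    using Bad(2)
  proof eventually_elim
    case (elim n)
    let ?P = "\<lambda>\<omega>. \<Prod>d\<in>E. \<psi> d (W n \<omega> \<bullet> d)"
    have P01: "0 \<le> ?P \<omega>" "?P \<omega> \<le> 1" for \<omega> using bound by (auto intro!: prod_nonneg prod_le_1)
    have intP: "integrable M ?P"
    proof (rule integrable_const_bound[where B=1])
      show "random_variable borel ?P" by (intro borel_measurable_prod) measurable
    qed (use P01 in auto)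
    have int_ind: "integrable M (indicator A :: 'w \<Rightarrow> real)" if "A \<in> events" for A
      using that by (intro integrable_real_indicator) (auto simp: less_top[symmetric])
    note ints = int_ind[OF Bad(1)[of n]] int_ind[OF L_event[of _ n]] int_ind[OF recovery_event[OF lam, of n]]
    have pt: "\<bar>indicator (recovery lam n) \<omega> - ?P \<omega>\<bar> \<le> indicator (Bad n) \<omega> + (\<Sum>d\<in>E. indicator (L d n) \<omega>)"
      if \<omega>: "\<omega> \<in> space M" for \<omega>
    proof (cases "\<omega> \<in> Bad n \<or> (\<exists>d\<in>E. \<omega> \<in> L d n)")
      case True
      have "\<bar>indicator (recovery lam n) \<omega> - ?P \<omega>\<bar> \<le> 1"
        using P01[of \<omega>] by (cases "\<omega> \<in> recovery lam n") auto
      also have "1 \<le> indicator (Bad n) \<omega> + (\<Sum>d\<in>E. indicator (L d n) \<omega> :: real)"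
        using True
      proof
        assume "\<omega> \<in> Bad n"
        then show ?thesis by (simp add: sum_nonneg)
      next
        assume "\<exists>d\<in>E. \<omega> \<in> L d n"
        then obtain d where d: "d \<in> E" "\<omega> \<in> L d n" by blast
        have "(indicator (L d n) \<omega> :: real) \<le> (\<Sum>d\<in>E. indicator (L d n) \<omega>)"
          using d(1) E(1) by (intro member_le_sum) auto
        then show ?thesis using d(2) by (simp add: add_increasing)
      qed
      finally show ?thesis .
    next
      case False
      then have good: "\<omega> \<in> space M - Bad n" using \<omega> by blast
      have away: "W n \<omega> \<bullet> d < c d - \<eta> * norm d \<or> W n \<omega> \<bullet> d > c d + \<eta> * norm d" if "d \<in> E" for d
      proof -
        have "\<omega> \<notin> L d n" using False that by blast
        then have "\<not> \<bar>W n \<omega> \<bullet> d - c d\<bar> \<le> \<eta> * norm d" using \<omega> unfolding L_def by blast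
        then show ?thesis by linarith
      qed
      have "indicator (recovery lam n) \<omega> = ?P \<omega>"
      proof (cases "\<forall>d\<in>E. W n \<omega> \<bullet> d < c d - \<eta> * norm d")
        case True
        have "W n \<omega> \<bullet> v + \<eta> * norm v \<le> lam * (slope \<bullet> v + kink v)" if "v \<in> normal_space" for v
        proof (rule strict_domination_test[OF E(3) lam _ that])
          show "W n \<omega> \<bullet> d + \<eta> * norm d \<le> lam * (slope \<bullet> d + kink d)" if "d \<in> E" for d
            using bspec[OF True that] unfolding c_def by linarith
        qed (use \<eta> in auto)
        then have "\<omega> \<in> recovery lam n" using elim(2) good by blast
        moreover have "?P \<omega> = 1" using True \<psi>_ends(1) by (intro prod.neutral) blast
        ultimately show ?thesis by simp
      next
        case False
        then obtain d where d: "d \<in> E" "W n \<omega> \<bullet> d > c d + \<eta> * norm d" using away by blast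
        have "\<omega> \<notin> recovery lam n"
        proof
          assume "\<omega> \<in> recovery lam n"
          moreover have "d \<in> normal_space" using d(1) E(2) by blast
          ultimately have "W n \<omega> \<bullet> d \<le> lam * (slope \<bullet> d + kink d) + \<eta> * norm d"
            using elim(2) good by blast
          then show False using d(2) unfolding c_def by linarith
        qed
        moreover have "?P \<omega> = 0" using d \<psi>_ends(2)[OF d] E(1) by (intro prod_zero) auto
        ultimately show ?thesis by simp
      qed
      then show ?thesis by (simp add: sum_nonneg)
    qed
    have "prob (recovery lam n) - b n = expectation (\<lambda>\<omega>. indicator (recovery lam n) \<omega> - ?P \<omega>)"
      unfolding b_def using ints(3) intP recovery_event[OF lam, of n] by simp
    also have "\<bar>\<dots>\<bar> \<le> expectation (\<lambda>\<omega>. \<bar>indicator (recovery lam n) \<omega> - ?P \<omega>\<bar>)"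
      by (rule integral_abs_bound)
    also have "\<dots> \<le> expectation (\<lambda>\<omega>. indicator (Bad n) \<omega> + (\<Sum>d\<in>E. indicator (L d n) \<omega>))"
    proof (rule integral_mono)
      show "integrable M (\<lambda>\<omega>. \<bar>indicator (recovery lam n) \<omega> - ?P \<omega>\<bar>)"
        by (intro integrable_abs Bochner_Integration.integrable_diff ints intP)
      show "integrable M (\<lambda>\<omega>. indicator (Bad n) \<omega> + (\<Sum>d\<in>E. indicator (L d n) \<omega> :: real))"
        by (intro Bochner_Integration.integrable_add Bochner_Integration.integrable_sum ints)
    qed (rule pt)
    also have "\<dots> = prob (Bad n) + (\<Sum>d\<in>E. prob (L d n))"
    proof -
      have "expectation (\<lambda>\<omega>. indicat_real (Bad n) \<omega> + (\<Sum>d\<in>E. indicat_real (L d n) \<omega>))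
          = expectation (indicat_real (Bad n)) + expectation (\<lambda>\<omega>. \<Sum>d\<in>E. indicat_real (L d n) \<omega>)"
        by (rule Bochner_Integration.integral_add[OF ints(1) Bochner_Integration.integrable_sum[OF ints(2)]])
      also have "expectation (\<lambda>\<omega>. \<Sum>d\<in>E. indicat_real (L d n) \<omega>) = (\<Sum>d\<in>E. expectation (indicat_real (L d n)))"
        by (rule Bochner_Integration.integral_sum[OF ints(2)])
      finally show ?thesis using Bad(1) L_event by simp
    qed
    also have "\<dots> \<le> \<kappa> + (\<Sum>d\<in>E. \<kappa>)"
      using conjunct1[OF elim(2)] bspec[OF elim(1)] by (intro add_mono sum_mono)
    also have "\<dots> = e"
    proof -
      have "real (card E) + 1 \<noteq> 0" by (metis of_nat_Suc of_nat_neq_0 Suc_eq_plus1 add.commute of_nat_1 of_nat_add)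
      then have "\<kappa> * (real (card E) + 1) = e" by (simp add: \<kappa>_def)
      then show ?thesis by (simp add: distrib_left mult.commute)
    qed
    finally show ?case .
  qed
  ultimately show "\<exists>b. convergent b \<and> (\<forall>\<^sub>F n in sequentially. \<bar>prob (recovery lam n) - b n\<bar> \<le> e)" by blast
qed

text \<open>The margins scale with \<open>lam\<close>, so the tolerance may too. At most half of
  each margin pays for the tolerance and the other half is the Chebyshev threshold
  \<open>lam * (\<gamma> d / 2)\<close>, which produces the inverse square of \<open>lam\<close>;
  \<open>\<kappa>\<close> pays for \<open>Bad\<close>.\<close>

lemma recovery_lower_bound:
  assumes pos: "\<And>v. v \<in> normal_space \<Longrightarrow> v \<noteq> 0 \<Longrightarrow> 0 < slope \<bullet> v + kink v"
  obtains K where "\<And>lam \<kappa>. lam > 0 \<Longrightarrow> \<kappa> > 0 \<Longrightarrow>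
    \<forall>\<^sub>F n in sequentially. 1 - K / lam\<^sup>2 - \<kappa> \<le> prob (recovery lam n)"
proof -
  obtain E where E: "finite E" "E \<subseteq> normal_space - {0}"
    "\<And>x v. (\<And>e. e \<in> E \<Longrightarrow> x \<bullet> e \<le> kink e) \<Longrightarrow> v \<in> normal_space \<Longrightarrow> x \<bullet> v \<le> kink v"
    by (rule kink_finite_test) blast
  define \<gamma> where "\<gamma> d = slope \<bullet> d + kink d" for d
  have \<gamma>: "\<gamma> d > 0" if "d \<in> E" for d using pos that E(2) by (auto simp: \<gamma>_def)
  define \<mu> where "\<mu> = Min (insert 1 ((\<lambda>d. \<gamma> d / (2 * norm d)) ` E))"
  have "0 < \<gamma> d / (2 * norm d)" if "d \<in> E" for d
    using \<gamma>[OF that] that E(2) by (intro divide_pos_pos) auto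
  then have \<mu>: "\<mu> > 0" using E(1) by (simp add: \<mu>_def)
  have \<mu>_le: "\<mu> * norm d \<le> \<gamma> d / 2" if "d \<in> E" for d
  proof -
    have "\<mu> \<le> \<gamma> d / (2 * norm d)" using that E(1) by (simp add: \<mu>_def)
    moreover have "norm d > 0" using that E(2) by auto
    ultimately show ?thesis by (simp add: pos_le_divide_eq)
  qed
  define K where "K = (\<Sum>d\<in>E. \<sigma>\<^sup>2 * (norm d)\<^sup>2 / (\<gamma> d / 2)\<^sup>2)"
  have "\<forall>\<^sub>F n in sequentially. 1 - K / lam\<^sup>2 - \<kappa> \<le> prob (recovery lam n)"
    if lam: "lam > 0" and \<kappa>: "\<kappa> > 0" for lam \<kappa>
  proof -
    have \<eta>: "lam * \<mu> > 0" using lam \<mu> by simp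
    obtain Bad where Bad: "\<And>n. Bad n \<in> events"
      "\<forall>\<^sub>F n in sequentially. prob (Bad n) \<le> \<kappa> \<and> (\<forall>\<omega>\<in>space M - Bad n.
         (\<omega> \<in> recovery lam n \<longrightarrow> (\<forall>v\<in>normal_space. W n \<omega> \<bullet> v \<le> lam * (slope \<bullet> v + kink v) + lam * \<mu> * norm v)) \<and>
         ((\<forall>v\<in>normal_space. W n \<omega> \<bullet> v + lam * \<mu> * norm v \<le> lam * (slope \<bullet> v + kink v)) \<longrightarrow> \<omega> \<in> recovery lam n))"
      using recovery_sandwich[OF lam \<eta> \<kappa>] by blast
    from Bad(2) show ?thesis
    proof eventually_elim
      case (elim n)
      let ?T = "\<lambda>d. {\<omega> \<in> space M. lam * (\<gamma> d / 2) \<le> \<bar>W n \<omega> \<bullet> d\<bar>}"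
      have T: "(\<Union>d\<in>E. ?T d) \<in> events" using E(1) by (intro sets.finite_UN) auto
      have "space M - recovery lam n \<subseteq> Bad n \<union> (\<Union>d\<in>E. ?T d)"
      proof
        fix \<omega> assume \<omega>: "\<omega> \<in> space M - recovery lam n"
        show "\<omega> \<in> Bad n \<union> (\<Union>d\<in>E. ?T d)"
        proof (rule ccontr)
          assume out: "\<omega> \<notin> Bad n \<union> (\<Union>d\<in>E. ?T d)"
          have "W n \<omega> \<bullet> v + lam * \<mu> * norm v \<le> lam * (slope \<bullet> v + kink v)" if "v \<in> normal_space" for v
          proof (rule strict_domination_test[OF E(3) lam _ that])
            fix d assume d: "d \<in> E"
            then have "\<bar>W n \<omega> \<bullet> d\<bar> < lam * (\<gamma> d / 2)" using out \<omega> by force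
            moreover have "lam * (\<mu> * norm d) \<le> lam * (\<gamma> d / 2)" using \<mu>_le[OF d] lam by (intro mult_left_mono) auto
            ultimately have "W n \<omega> \<bullet> d + lam * \<mu> * norm d \<le> lam * \<gamma> d" by (simp add: mult.assoc)
            then show "W n \<omega> \<bullet> d + lam * \<mu> * norm d \<le> lam * (slope \<bullet> d + kink d)" by (simp add: \<gamma>_def)
          qed (use \<eta> in auto)
          then show False using elim \<omega> out by blast
        qed
      qed
      then have "prob (space M - recovery lam n) \<le> prob (Bad n \<union> (\<Union>d\<in>E. ?T d))"
        using Bad(1) T by (intro finite_measure_mono) auto
      also have "\<dots> \<le> prob (Bad n) + prob (\<Union>d\<in>E. ?T d)"
        using Bad(1) T by (intro measure_Un_le)
      also have "prob (\<Union>d\<in>E. ?T d) \<le> (\<Sum>d\<in>E. prob (?T d))"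
        using E(1) by (intro finite_measure_subadditive_finite) auto
      also have "\<dots> \<le> (\<Sum>d\<in>E. \<sigma>\<^sup>2 * (norm d)\<^sup>2 / (lam * (\<gamma> d / 2))\<^sup>2)"
        using \<gamma> lam by (intro sum_mono W_tail) auto
      also have "\<dots> = K / lam\<^sup>2"
        unfolding K_def sum_divide_distrib
        by (intro sum.cong refl) (simp only: power_mult_distrib divide_divide_eq_left mult.commute)
      finally show ?case
        using elim prob_compl[OF recovery_event[OF lam, of n]] by simp
    qed
  qed
  then show thesis using that by blast
qed

text \<open>Multiplying a nonpositive threshold by \<open>lam\<close> never relaxes it beyond 0, so
  for every \<open>lam\<close> recovery outside \<open>Bad\<close> confines \<open>W n\<close> to
  the same half-space.\<close>

lemma recovery_upper_bound:
  assumes v: "v \<in> normal_space" "v \<noteq> 0" and nonpos: "slope \<bullet> v + kink v \<le> 0"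
  obtains q where "q < 1" "\<And>lam. lam > 0 \<Longrightarrow> \<forall>\<^sub>F n in sequentially. prob (recovery lam n) \<le> q"
proof -
  obtain q where q: "q < 1" "\<forall>\<^sub>F n in sequentially. prob {\<omega> \<in> space M. W n \<omega> \<bullet> v \<le> norm v} \<le> q"
    using W_halfspace_bound[OF v(2)] by blast
  \<comment> \<open>Half of the gap \<open>1 - q\<close> is spent on \<open>Bad\<close>; the
    resulting bound is below 1 and free of \<open>lam\<close>.\<close>
  have "\<forall>\<^sub>F n in sequentially. prob (recovery lam n) \<le> q + (1 - q) / 2" if lam: "lam > 0" for lam
  proof -
    obtain Bad where Bad: "\<And>n. Bad n \<in> events"
      "\<forall>\<^sub>F n in sequentially. prob (Bad n) \<le> (1 - q) / 2 \<and> (\<forall>\<omega>\<in>space M - Bad n.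
         (\<omega> \<in> recovery lam n \<longrightarrow> (\<forall>v\<in>normal_space. W n \<omega> \<bullet> v \<le> lam * (slope \<bullet> v + kink v) + 1 * norm v)) \<and>
         ((\<forall>v\<in>normal_space. W n \<omega> \<bullet> v + 1 * norm v \<le> lam * (slope \<bullet> v + kink v)) \<longrightarrow> \<omega> \<in> recovery lam n))"
      using recovery_sandwich[OF lam, of 1 "(1 - q) / 2"] q(1) by auto
    from Bad(2) q(2) show ?thesis
    proof eventually_elim
      case (elim n)
      let ?H = "{\<omega> \<in> space M. W n \<omega> \<bullet> v \<le> norm v}"
      have "recovery lam n \<subseteq> Bad n \<union> ?H"
      proof
        fix \<omega> assume \<omega>: "\<omega> \<in> recovery lam n"
        then have "\<omega> \<in> space M" by (simp add: recovery_def)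
        moreover have "W n \<omega> \<bullet> v \<le> norm v" if "\<omega> \<notin> Bad n"
        proof -
          have "W n \<omega> \<bullet> v \<le> lam * (slope \<bullet> v + kink v) + 1 * norm v"
            using elim(1) \<omega> \<open>\<omega> \<in> space M\<close> that v(1) by blast
          moreover have "lam * (slope \<bullet> v + kink v) \<le> 0" using lam nonpos by (simp add: mult_le_0_iff)
          ultimately show ?thesis by linarith
        qed
        ultimately show "\<omega> \<in> Bad n \<union> ?H" by blast
      qed
      then have "prob (recovery lam n) \<le> prob (Bad n \<union> ?H)"
        using Bad(1) by (intro finite_measure_mono) auto
      also have "\<dots> \<le> prob (Bad n) + prob ?H"
        using Bad(1) by (intro measure_Un_le) auto
      finally show ?case using elim by linarith
    qed
  qed
  moreover have "q + (1 - q) / 2 < 1" using q(1) by (simp add: field_simps)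
  ultimately show thesis using that by blast
qed

theorem asymptotic_recovery_iff:
  "(\<exists>L. (\<forall>lam>0. (\<lambda>n. prob (recovery lam n)) \<longlonglongrightarrow> L lam) \<and> (L \<longlongrightarrow> 1) at_top)
    \<longleftrightarrow> (\<forall>v\<in>normal_space - {0}. 0 < slope \<bullet> v + kink v)" (is "?lhs \<longleftrightarrow> ?rhs")
proof
  assume ?lhs
  then obtain L where L: "\<And>lam. lam > 0 \<Longrightarrow> (\<lambda>n. prob (recovery lam n)) \<longlonglongrightarrow> L lam" "(L \<longlongrightarrow> 1) at_top"
    by blast
  show ?rhs
  proof (rule ccontr)
    assume "\<not> ?rhs"
    then obtain v where v: "v \<in> normal_space" "v \<noteq> 0" "slope \<bullet> v + kink v \<le> 0" by (auto simp: not_less)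
    then obtain q where q: "q < 1" "\<And>lam. lam > 0 \<Longrightarrow> \<forall>\<^sub>F n in sequentially. prob (recovery lam n) \<le> q"
      using recovery_upper_bound by blast
    have le: "L lam \<le> q" if "lam > 0" for lam
      using tendsto_upperbound[OF L(1)[OF that] q(2)[OF that]] by simp
    have "\<forall>\<^sub>F lam in at_top. L lam \<le> q"
      by (rule eventually_mono[OF eventually_gt_at_top[of 0]]) (rule le)
    from tendsto_upperbound[OF L(2) this] show False using q(1) by simp
  qed
next
  assume ?rhs
  then obtain K where K: "\<And>lam \<kappa>. lam > 0 \<Longrightarrow> \<kappa> > 0 \<Longrightarrow>
      \<forall>\<^sub>F n in sequentially. 1 - K / lam\<^sup>2 - \<kappa> \<le> prob (recovery lam n)"
    using recovery_lower_bound by blast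
  define L where "L lam = lim (\<lambda>n. prob (recovery lam n))" for lam
  have L: "(\<lambda>n. prob (recovery lam n)) \<longlonglongrightarrow> L lam" if "lam > 0" for lam
    unfolding L_def using recovery_convergent[OF that] by (simp add: convergent_LIMSEQ_iff)
  have upper: "L lam \<le> 1" if "lam > 0" for lam
    using tendsto_upperbound[OF L[OF that], of 1] by simp
  have lower: "1 - K / lam\<^sup>2 \<le> L lam" if "lam > 0" for lam
  proof (rule field_le_epsilon)
    fix \<kappa> :: real assume "\<kappa> > 0"
    then have "1 - K / lam\<^sup>2 - \<kappa> \<le> L lam"
      using tendsto_lowerbound[OF L[OF that] K[OF that]] by simp
    then show "1 - K / lam\<^sup>2 \<le> L lam + \<kappa>" by simp
  qed
  have "((\<lambda>lam. K / lam\<^sup>2) \<longlongrightarrow> 0) at_top"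
    by (intro tendsto_divide_0[OF tendsto_const] filterlim_at_top_imp_at_infinity
        filterlim_pow_at_top filterlim_ident) auto
  then have "((\<lambda>lam. 1 - K / lam\<^sup>2) \<longlongrightarrow> 1 - 0) at_top" by (intro tendsto_intros)
  then have lim: "((\<lambda>lam. 1 - K / lam\<^sup>2) \<longlongrightarrow> 1) at_top" by simp
  have "(L \<longlongrightarrow> 1) at_top"
  proof (rule tendsto_sandwich[OF _ _ lim tendsto_const])
    show "\<forall>\<^sub>F lam in at_top. 1 - K / lam\<^sup>2 \<le> L lam"
      by (rule eventually_mono[OF eventually_gt_at_top[of 0]]) (rule lower)
    show "\<forall>\<^sub>F lam in at_top. L lam \<le> 1"
      by (rule eventually_mono[OF eventually_gt_at_top[of 0]]) (rule upper)
  qed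
  then show ?lhs using L by blast
qed

end

section \<open>The Fused Lasso penalty\<close>

lemma strictly_concave_seq_interpolation:
  assumes "strictly_concave_seq p a" "l < i" "i < r" "r \<le> p"
  defines "t \<equiv> (real i - real l) / (real r - real l)"
  shows "(1 - t) * a l + t * a r < a i"
proof -
  obtain F where F: "strictly_concave F" "\<And>i. i \<in> {0..p} \<Longrightarrow> a i = F (real i)"
    using assms(1) unfolding strictly_concave_seq_def by blast
  have t: "0 < t" "t < 1" using assms(2,3) by (auto simp: t_def)
  have "t * (real r - real l) = real i - real l" using assms(2,3) by (simp add: t_def)
  then have "(1 - t) * real l + t * real r = real i" by (simp add: algebra_simps)
  moreover have "(1 - t) * F (real l) + t * F (real r) < F ((1 - t) * real l + t * real r)"
    using F(1) assms(2,3) t unfolding strictly_concave_def by auto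
  ultimately show ?thesis using F(2) assms(2-4) by auto
qed

text \<open>Nonincreasing increments keep the sequence below the line through two neighbouring
  points; the induction moves away from \<open>k\<close>, upwards and downwards.\<close>

lemma concave_increments_supporting_line:
  fixes c :: "nat \<Rightarrow> real"
  assumes e: "\<And>k. 1 \<le> k \<Longrightarrow> k < p \<Longrightarrow> c (k + 1) - c k \<le> c k - c (k - 1)"
    and "k < p" "i \<le> p"
  shows "c i \<le> c k + (c (k + 1) - c k) * (real i - real k)"
proof -
  define d where "d m = c (m + 1) - c m" for m
  have d_Suc: "d (Suc m) \<le> d m" if "Suc m < p" for m using e[of "Suc m"] that by (simp add: d_def)
  have d_le: "d n \<le> d m" if "m \<le> n" "n < p" for m n
    using that
  proof (induction n rule: dec_induct)
    case (step n)
    then show ?case using d_Suc[of n] by simp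
  qed simp
  show ?thesis
  proof (cases "k \<le> i")
    case True
    then have "i \<le> p \<longrightarrow> c i \<le> c k + d k * (real i - real k)"
    proof (induction i rule: dec_induct)
      case (step n)
      then show ?case using d_le[of k n] by (auto simp: d_def algebra_simps)
    qed simp
    then show ?thesis using \<open>i \<le> p\<close> by (simp add: d_def)
  next
    case False
    then have "i \<le> k" by simp
    then have "c i \<le> c k + d k * (real i - real k)"
    proof (induction i rule: inc_induct)
      case (step n)
      then show ?case using d_le[of n k] \<open>k < p\<close> by (auto simp: d_def algebra_simps)
    qed simp
    then show ?thesis by (simp add: d_def)
  qed
qed

text \<open>The extension is a minimum of finitely many affine functions minus a small multiple of
  \<open>x\<^sup>2\<close>; the affine functions interpolate the sequence with that multiple of \<open>i\<^sup>2\<close> added back.\<close>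

lemma strictly_concave_seqI:
  assumes "p \<ge> 1" and "\<And>i. 1 \<le> i \<Longrightarrow> i < p \<Longrightarrow> a (i - 1) + a (i + 1) < 2 * a i"
  shows "strictly_concave_seq p a"
proof -
  \<comment> \<open>The squares of the integers have second difference 2, so adding
    \<open>\<delta>\<close> times them keeps the increments nonincreasing when
    \<open>\<delta>\<close> is at most every \<open>s i\<close>. The \<open>insert 1\<close> below
    covers \<open>p = 1\<close>.\<close>
  define s where "s i = (2 * a i - a (i - 1) - a (i + 1)) / 2" for i
  define \<delta> where "\<delta> = Min (insert 1 (s ` {1..<p}))"
  have s: "s i > 0" if "i \<in> {1..<p}" for i using assms(2)[of i] that by (simp add: s_def)
  have \<delta>: "\<delta> > 0" using s by (simp add: \<delta>_def)
  have \<delta>_le: "\<delta> \<le> s i" if "i \<in> {1..<p}" for i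
    unfolding \<delta>_def using that by (intro Min_le) auto
  define c where "c i = a i + \<delta> * (real i)\<^sup>2" for i
  define g where "g k x = c k + (c (k + 1) - c k) * (x - real k)" for k x
  define G where "G x = Min ((\<lambda>k. g k x) ` {..<p})" for x
  define F where "F x = G x - \<delta> * x\<^sup>2" for x
  have ne: "{..<p} \<noteq> {}" using assms(1) by (auto simp: lessThan_empty_iff)
  have G_le: "G x \<le> g k x" if "k < p" for k x unfolding G_def using that by (intro Min_le) auto
  have G_ex: "\<exists>k<p. G x = g k x" for x
  proof -
    have "G x \<in> (\<lambda>k. g k x) ` {..<p}" unfolding G_def using ne by (intro Min_in) auto
    then show ?thesis by auto
  qed
  have inc: "c (k + 1) - c k \<le> c k - c (k - 1)" if "1 \<le> k" "k < p" for k
  proof -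
    have "real (k - 1) = real k - 1" using that by (simp add: of_nat_diff)
    then have "2 * c k - c (k - 1) - c (k + 1) = 2 * s k - 2 * \<delta>"
      by (simp add: c_def s_def power2_eq_square algebra_simps)
    then show ?thesis using \<delta>_le[of k] that by simp
  qed
  have G_nat: "G (real i) = c i" if "i \<le> p" for i
  proof (rule antisym)
    obtain k where "k < p" "G (real i) = g k (real i)" using G_ex by blast
    then show "c i \<le> G (real i)"
      using concave_increments_supporting_line[OF inc, of p k i] that by (simp add: g_def)
    show "G (real i) \<le> c i"
    proof (cases "i < p")
      case True
      then show ?thesis using G_le[of i "real i"] by (simp add: g_def)
    next
      case False
      then have "i = p" using that by simp
      then show ?thesis using G_le[of "p - 1" "real i"] assms(1) by (simp add: g_def of_nat_diff)
    qed
  qed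
  have "strictly_concave F"
    unfolding strictly_concave_def
  proof (intro allI impI)
    fix x y t :: real assume xy: "x \<noteq> y" and t: "0 < t" "t < 1"
    define u where "u = (1 - t) * x + t * y"
    \<comment> \<open>A single affine piece active at \<open>u\<close> bounds \<open>G\<close> at
      both ends and equals it at \<open>u\<close>; the strictness comes from the quadratic term
      alone.\<close>
    obtain k where k: "k < p" "G u = g k u" using G_ex by blast
    have "(1 - t) * G x \<le> (1 - t) * g k x" "t * G y \<le> t * g k y"
      using G_le[OF k(1)] t by (auto intro: mult_left_mono)
    moreover have "(1 - t) * g k x + t * g k y = g k u" by (simp add: g_def u_def algebra_simps)
    moreover have "\<delta> * ((1 - t) * x\<^sup>2 + t * y\<^sup>2 - u\<^sup>2) > 0"
    proof -
      have "(1 - t) * x\<^sup>2 + t * y\<^sup>2 - u\<^sup>2 = t * (1 - t) * (x - y)\<^sup>2"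
        by (simp add: u_def power2_eq_square algebra_simps)
      then show ?thesis using \<delta> t xy by simp
    qed
    ultimately show "(1 - t) * F x + t * F y < F ((1 - t) * x + t * y)"
      unfolding u_def[symmetric] F_def using k(2) by (simp add: algebra_simps)
  qed
  moreover have "\<forall>i\<in>{0..p}. a i = F (real i)" using G_nat by (simp add: F_def c_def)
  ultimately show ?thesis unfolding strictly_concave_seq_def by blast
qed

text \<open>\<open>T\<close> is a dual certificate: it carries the forced signs off the ties, is
  strictly inside [-1, 1] on them, and its combination of rows is orthogonal to
  \<open>normal_space\<close>. So \<open>slope \<bullet> v\<close> is minus the tie part of that
  combination. This part is strictly below \<open>kink v\<close>, because some tie row does not
  annihilate \<open>v\<close>.\<close>

lemma (in generalized_lasso) dominated_by_certificate:
  assumes T: "\<And>j. j \<in> J - ties \<Longrightarrow> T j = sgn (l j \<bullet> z)" "\<And>j. j \<in> ties \<Longrightarrow> \<bar>T j\<bar> < 1"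
    and x: "x \<in> tie_space" "\<And>v. (\<Sum>j\<in>J. T j * (l j \<bullet> v)) = x \<bullet> v"
    and v: "v \<in> normal_space" "v \<noteq> 0"
  shows "0 < slope \<bullet> v + kink v"
proof -
  have "(\<Sum>j\<in>J. T j * (l j \<bullet> v)) = (\<Sum>j\<in>J - ties. T j * (l j \<bullet> v)) + (\<Sum>j\<in>ties. T j * (l j \<bullet> v))"
    by (rule sum.subset_diff[OF ties_subset finite_rows])
  moreover have "(\<Sum>j\<in>J - ties. T j * (l j \<bullet> v)) = slope \<bullet> v"
    unfolding slope_inner by (intro sum.cong refl) (simp only: T(1))
  moreover have "x \<bullet> v = 0" using normal_orthogonal[OF v(1) x(1)] by (simp add: inner_commute)
  ultimately have slope: "slope \<bullet> v = (\<Sum>j\<in>ties. - (T j * (l j \<bullet> v)))"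
    using x(2)[of v] by (simp add: sum_negf)
  have le: "T j * (l j \<bullet> v) \<le> \<bar>l j \<bullet> v\<bar>" if "j \<in> ties" for j
  proof -
    have "T j * (l j \<bullet> v) \<le> \<bar>T j\<bar> * \<bar>l j \<bullet> v\<bar>" by (metis abs_ge_self abs_mult)
    also have "\<dots> \<le> 1 * \<bar>l j \<bullet> v\<bar>" using T(2)[OF that] by (intro mult_right_mono) auto
    finally show ?thesis by simp
  qed
  obtain j where j: "j \<in> ties" "l j \<bullet> v \<noteq> 0"
  proof (rule ccontr)
    assume "\<not> thesis"
    then have "\<forall>j\<in>ties. l j \<bullet> v = 0" using that by blast
    then have "kink v = 0" unfolding kink_def by simp
    then show False using kink_pos[OF v] by simp
  qed
  have "T j * (l j \<bullet> v) < \<bar>l j \<bullet> v\<bar>"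
  proof -
    have "T j * (l j \<bullet> v) \<le> \<bar>T j\<bar> * \<bar>l j \<bullet> v\<bar>" by (metis abs_ge_self abs_mult)
    also have "\<dots> < 1 * \<bar>l j \<bullet> v\<bar>" using T(2)[OF j(1)] j(2) by (intro mult_strict_right_mono) auto
    finally show ?thesis by simp
  qed
  then have "(\<Sum>j\<in>ties. T j * (l j \<bullet> v)) < kink v"
    unfolding kink_def using le j(1) finite_ties by (intro sum_strict_mono_ex1) auto
  then show ?thesis unfolding slope by (simp add: sum_negf)
qed

definition fused_row :: "(nat \<Rightarrow> 'p::finite) \<Rightarrow> (nat \<Rightarrow> real) \<Rightarrow> real \<Rightarrow> nat \<Rightarrow> real ^ 'p" where
  "fused_row ix a b j =
     (if j < CARD('p) then a j *\<^sub>R (axis (ix j) 1 - axis (ix (j + 1)) 1)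
      else b *\<^sub>R axis (ix (j - (CARD('p) - 1))) 1)"

lemma fused_row_inner: "fused_row ix a b j \<bullet> \<beta> = fused_map ix a b \<beta> j"
  by (simp add: fused_row_def fused_map_def inner_diff_left inner_axis' algebra_simps)

section \<open>The Fused Lasso rows in coordinates\<close>

context
  fixes ix :: "nat \<Rightarrow> 'p::finite" and a :: "nat \<Rightarrow> real" and b :: real
  assumes ix: "bij_betw ix {1..CARD('p)} UNIV"
    and a_pos: "\<forall>i\<in>{1..<CARD('p)}. a i > 0" and a_0: "a 0 = 0" and a_p: "a (CARD('p)) = 0" and b_pos: "b > 0"
begin

lemma card_ge_1: "1 \<le> CARD('p)"
  using zero_less_card_finite[where 'a='p] by linarith

lemma ix_inj: "i \<in> {1..CARD('p)} \<Longrightarrow> j \<in> {1..CARD('p)} \<Longrightarrow> ix i = ix j \<longleftrightarrow> i = j"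
  using ix unfolding bij_betw_def inj_on_def by blast

lemma vec_of_coordinates:
  obtains x :: "real ^ 'p" where "\<And>i. i \<in> {1..CARD('p)} \<Longrightarrow> x $ ix i = y i"
proof
  show "(\<chi> k. y (inv_into {1..CARD('p)} ix k)) $ ix i = y i" if "i \<in> {1..CARD('p)}" for i
    using that ix by (simp add: bij_betw_inv_into_left)
qed

lemma inner_coordinates: "x \<bullet> v = (\<Sum>i = 1..CARD('p). x $ ix i * v $ ix i)" for x v :: "real ^ 'p"
  unfolding inner_vec_def using sum.reindex_bij_betw[OF ix, of "\<lambda>k. x $ k * v $ k"] by simp

lemma rows_split:
  "(\<Sum>j\<in>{1..2 * CARD('p) - 1}. f j) = (\<Sum>i = 1..<CARD('p). f i) + (\<Sum>i = 1..CARD('p). f (i + (CARD('p) - 1)))" for f :: "nat \<Rightarrow> real"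
proof -
  have "{1..2 * CARD('p) - 1} = {1..<CARD('p)} \<union> {CARD('p)..2 * CARD('p) - 1}"
    by (rule set_eqI, unfold Un_iff atLeastAtMost_iff atLeastLessThan_iff, insert card_ge_1, linarith)
  then have "(\<Sum>j\<in>{1..2 * CARD('p) - 1}. f j) = (\<Sum>i = 1..<CARD('p). f i) + (\<Sum>j = CARD('p)..2 * CARD('p) - 1. f j)"
    by (simp only:) (rule sum.union_disjoint, auto)
  moreover have "{CARD('p)..2 * CARD('p) - 1} = {1 + (CARD('p) - 1)..CARD('p) + (CARD('p) - 1)}"
    using card_ge_1 by (simp add: mult_2)
  ultimately show ?thesis by (simp only: sum.shift_bounds_cl_nat_ivl)
qed

text \<open>Summation by parts: the left-hand side is \<open>\<langle>T, A v\<rangle>\<close>.\<close>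

lemma sum_fused_map:
  assumes S: "\<And>i. i \<in> {1..<CARD('p)} \<Longrightarrow> S i = a i * T i" "S 0 = 0" "S (CARD('p)) = 0"
  shows "(\<Sum>j\<in>{1..2 * CARD('p) - 1}. T j * fused_map ix a b v j)
    = (\<Sum>i = 1..CARD('p). (S i - S (i - 1) + b * T (i + (CARD('p) - 1))) * v $ ix i)"
proof -
  have parts: "(\<Sum>i = 1..<Suc m. S i * (f i - f (Suc i))) = (\<Sum>i = 1..m. (S i - S (i - 1)) * f i) - S m * f (Suc m)"
    for m and f :: "nat \<Rightarrow> real"
    by (induction m) (auto simp: S(2) algebra_simps)
  obtain q where q: "CARD('p) = Suc q" using card_ge_1 by (cases "CARD('p)") auto
  have "(\<Sum>i = 1..<CARD('p). T i * fused_map ix a b v i) = (\<Sum>i = 1..<CARD('p). S i * (v $ ix i - v $ ix (Suc i)))"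
    by (intro sum.cong) (auto simp: fused_map_def S(1))
  also have "\<dots> = (\<Sum>i = 1..q. (S i - S (i - 1)) * v $ ix i) - S q * v $ ix (Suc q)"
    unfolding q by (rule parts)
  also have "\<dots> = (\<Sum>i = 1..CARD('p). (S i - S (i - 1)) * v $ ix i)"
    using S(3) unfolding q by simp
  finally have "(\<Sum>i = 1..<CARD('p). T i * fused_map ix a b v i) = (\<Sum>i = 1..CARD('p). (S i - S (i - 1)) * v $ ix i)" .
  moreover have "(\<Sum>i = 1..CARD('p). T (i + (CARD('p) - 1)) * fused_map ix a b v (i + (CARD('p) - 1)))
      = (\<Sum>i = 1..CARD('p). b * T (i + (CARD('p) - 1)) * v $ ix i)"
    by (intro sum.cong) (auto simp: fused_map_def)
  ultimately show ?thesis
    unfolding rows_split by (simp add: sum.distrib[symmetric] distrib_right)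
qed

lemma generalized_lasso_fused: "generalized_lasso {1..2 * CARD('p) - 1}"
  by unfold_locales simp

abbreviation "f_normal_space z \<equiv> generalized_lasso.normal_space {1..2 * CARD('p) - 1} (fused_row ix a b) z"
abbreviation "f_slope z \<equiv> generalized_lasso.slope {1..2 * CARD('p) - 1} (fused_row ix a b) z"
abbreviation "f_kink z \<equiv> generalized_lasso.kink {1..2 * CARD('p) - 1} (fused_row ix a b) z"

text \<open>Tie rows have sign 0, so the sum extends to all rows before summing by parts. At 0 and
  at \<open>CARD('p)\<close>, \<open>S\<close> reads a coordinate outside the numbering, but with
  the factor \<open>a 0 = 0\<close> or \<open>a (CARD('p)) = 0\<close>.\<close>

lemma slope_fused:
  assumes "S = (\<lambda>i. a i * sgn (z $ ix i - z $ ix (i + 1)))"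
  shows "f_slope z \<bullet> v = (\<Sum>i = 1..CARD('p). (S i - S (i - 1) + b * sgn (z $ ix i)) * v $ ix i)"
proof -
  interpret generalized_lasso "{1..2 * CARD('p) - 1}" "fused_row ix a b" z by (rule generalized_lasso_fused)
  define T where "T j = sgn (fused_map ix a b z j)" for j
  have "slope \<bullet> v = (\<Sum>j\<in>{1..2 * CARD('p) - 1} - ties. T j * fused_map ix a b v j)"
    unfolding slope_inner T_def fused_row_inner ..
  also have "\<dots> = (\<Sum>j\<in>{1..2 * CARD('p) - 1}. T j * fused_map ix a b v j)"
  proof (rule sum.mono_neutral_left)
    show "\<forall>j\<in>{1..2 * CARD('p) - 1} - ({1..2 * CARD('p) - 1} - ties). T j * fused_map ix a b v j = 0"
    proof
      fix j assume "j \<in> {1..2 * CARD('p) - 1} - ({1..2 * CARD('p) - 1} - ties)"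
      then have "fused_map ix a b z j = 0" unfolding ties_def fused_row_inner by blast
      then show "T j * fused_map ix a b v j = 0" by (simp add: T_def)
    qed
  qed auto
  also have "\<dots> = (\<Sum>i = 1..CARD('p). (S i - S (i - 1) + b * T (i + (CARD('p) - 1))) * v $ ix i)"
  proof (rule sum_fused_map)
    show "S i = a i * T i" if "i \<in> {1..<CARD('p)}" for i
      using a_pos that by (auto simp: assms T_def fused_map_def sgn_mult)
  qed (simp_all add: assms a_0 a_p)
  also have "\<dots> = (\<Sum>i = 1..CARD('p). (S i - S (i - 1) + b * sgn (z $ ix i)) * v $ ix i)"
    using b_pos by (intro sum.cong) (auto simp: T_def fused_map_def sgn_mult)
  finally show ?thesis .
qed

text \<open>At a \<open>z\<close> whose only tie joins coordinates \<open>i\<close> and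
  \<open>i + 1\<close>, the direction \<open>v\<close> that separates them has
  \<open>kink v = 2 * a i\<close>. The two neighbouring jumps point the same way and give the slope
  \<open>- (a (i - 1) + a (i + 1))\<close>; the coordinate rows cancel.\<close>

lemma fused_necessary_concave:
  assumes cond: "\<And>z v. v \<in> f_normal_space z \<Longrightarrow> v \<noteq> 0 \<Longrightarrow> 0 < f_slope z \<bullet> v + f_kink z v"
    and i: "1 \<le> i" "i < CARD('p)"
  shows "a (i - 1) + a (i + 1) < 2 * a i"
proof -
  \<comment> \<open>Positive coordinates that decrease by 1 at each step, except for equality at
    \<open>i\<close> and \<open>i + 1\<close>.\<close>
  obtain z :: "real ^ 'p" where z: "\<And>k. k \<in> {1..CARD('p)} \<Longrightarrow>
      z $ ix k = real (CARD('p) + 1) - (if k \<le> i then real k else real k - 1)"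
    by (rule vec_of_coordinates[of "\<lambda>k. real (CARD('p) + 1) - (if k \<le> i then real k else real k - 1)"]) blast
  interpret generalized_lasso "{1..2 * CARD('p) - 1}" "fused_row ix a b" z by (rule generalized_lasso_fused)
  define v :: "real ^ 'p" where "v = axis (ix i) 1 - axis (ix (i + 1)) 1"
  have v: "v $ ix k = (if k = i then 1 else if k = i + 1 then -1 else 0)" if "k \<in> {1..CARD('p)}" for k
    using that i ix_inj[of k i] ix_inj[of k "i + 1"] ix_inj[of i "i + 1"] by (auto simp: v_def axis_def)
  have ties: "ties = {i}"
  proof -
    have pos: "z $ ix k > 0" if "k \<in> {1..CARD('p)}" for k using z[OF that] that by auto
    have "fused_map ix a b z j = 0 \<longleftrightarrow> j = i" if j: "j \<in> {1..2 * CARD('p) - 1}" for j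
    proof (cases "j < CARD('p)")
      case True
      then have "a j \<noteq> 0" using a_pos j by force
      then show ?thesis using True j z[of j] z[of "j + 1"] by (auto simp: fused_map_def)
    next
      case False
      then have "j - (CARD('p) - 1) \<in> {1..CARD('p)}" using j by auto
      then show ?thesis using False pos[of "j - (CARD('p) - 1)"] b_pos i by (auto simp: fused_map_def)
    qed
    moreover have "i \<in> {1..2 * CARD('p) - 1}" using i by auto
    ultimately show ?thesis unfolding ties_def fused_row_inner by blast
  qed
  have ai: "a i > 0" using a_pos i by auto
  have inner_v: "fused_map ix a b u i = a i * (v \<bullet> u)" for u
    using i by (simp add: fused_map_def v_def inner_diff_left inner_axis')
  have "v \<in> normal_space"
    unfolding normal_space_def tie_space_def ties fused_row_inner using inner_v ai by auto
  moreover have "v \<noteq> 0" using v[of i] i by auto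
  ultimately have "0 < slope \<bullet> v + kink v" by (rule cond)
  moreover have "kink v = 2 * a i"
  proof -
    have "fused_map ix a b v i = 2 * a i" using i v[of i] v[of "i + 1"] by (simp add: fused_map_def)
    then show ?thesis unfolding kink_def ties fused_row_inner using ai by simp
  qed
  moreover have "slope \<bullet> v = - (a (i - 1) + a (i + 1))"
  proof -
    define S where "S = (\<lambda>i. a i * sgn (z $ ix i - z $ ix (i + 1)))"
    define y where "y k = S k - S (k - 1) + b * sgn (z $ ix k)" for k
    have pos: "sgn (z $ ix k) = 1" if "k \<in> {1..CARD('p)}" for k using z[OF that] that by auto
    have S: "S k = (if k = i then 0 else a k)" if "k \<le> CARD('p)" for k
    proof (cases "k = 0 \<or> k = CARD('p)")
      case True
      then show ?thesis using a_0 a_p i by (auto simp: S_def)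
    next
      case False
      then show ?thesis using that z[of k] z[of "k + 1"] by (auto simp: S_def)
    qed
    have "slope \<bullet> v = (\<Sum>k = 1..CARD('p). y k * v $ ix k)"
      unfolding y_def by (rule slope_fused[OF S_def])
    also have "\<dots> = (\<Sum>k\<in>{i, i + 1}. y k * v $ ix k)"
      using i v by (intro sum.mono_neutral_right) auto
    also have "\<dots> = y i - y (i + 1)" using i v[of i] v[of "i + 1"] by simp
    also have "\<dots> = - (a (i - 1) + a (i + 1))"
      using i S[of i] S[of "i - 1"] S[of "i + 1"] pos[of i] pos[of "i + 1"] by (simp add: y_def)
    finally show ?thesis .
  qed
  ultimately show ?thesis by simp
qed

text \<open>A single zero coordinate among positive distinct ones is the only tie. Both neighbours
  are larger, so both jumps favour raising coordinate \<open>i\<close>, with total strength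
  \<open>a (i - 1) + a i\<close> against the kink \<open>b\<close>; at the ends a missing neighbour
  counts as 0.\<close>

lemma fused_necessary_bound:
  assumes cond: "\<And>z v. v \<in> f_normal_space z \<Longrightarrow> v \<noteq> 0 \<Longrightarrow> 0 < f_slope z \<bullet> v + f_kink z v"
    and i: "1 \<le> i" "i \<le> CARD('p)"
  shows "a (i - 1) + a i < b"
proof -
  obtain z :: "real ^ 'p" where z: "\<And>k. k \<in> {1..CARD('p)} \<Longrightarrow> z $ ix k = (if k = i then 0 else real k)"
    by (rule vec_of_coordinates[of "\<lambda>k. if k = i then 0 else real k"]) blast
  interpret generalized_lasso "{1..2 * CARD('p) - 1}" "fused_row ix a b" z by (rule generalized_lasso_fused)
  define v :: "real ^ 'p" where "v = axis (ix i) 1"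
  have v: "v $ ix k = (if k = i then 1 else 0)" if "k \<in> {1..CARD('p)}" for k
    using that i ix_inj[of k i] by (auto simp: v_def axis_def)
  let ?j = "i + (CARD('p) - 1)"
  have ties: "ties = {?j}"
  proof -
    have "fused_map ix a b z j = 0 \<longleftrightarrow> j = ?j" if j: "j \<in> {1..2 * CARD('p) - 1}" for j
    proof (cases "j < CARD('p)")
      case True
      then have "a j \<noteq> 0" using a_pos j by force
      then show ?thesis using True j z[of j] z[of "j + 1"] i by (auto simp: fused_map_def)
    next
      case False
      then have "j - (CARD('p) - 1) \<in> {1..CARD('p)}" using j by auto
      then show ?thesis using False z[of "j - (CARD('p) - 1)"] b_pos i j by (auto simp: fused_map_def)
    qed
    moreover have "?j \<in> {1..2 * CARD('p) - 1}" using i by auto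
    ultimately show ?thesis unfolding ties_def fused_row_inner by blast
  qed
  have inner_v: "fused_map ix a b u ?j = b * (v \<bullet> u)" for u
    using i by (auto simp: fused_map_def v_def inner_axis')
  have "v \<in> normal_space"
    unfolding normal_space_def tie_space_def ties fused_row_inner using inner_v b_pos by auto
  moreover have "v \<noteq> 0" using v[of i] i by auto
  ultimately have "0 < slope \<bullet> v + kink v" by (rule cond)
  moreover have "kink v = b"
  proof -
    have "v \<bullet> v = 1" by (simp add: v_def inner_axis')
    then have "fused_map ix a b v ?j = b" using inner_v[of v] by simp
    then show ?thesis unfolding kink_def ties fused_row_inner using b_pos by simp
  qed
  moreover have "slope \<bullet> v = - (a (i - 1) + a i)"
  proof -
    define S where "S = (\<lambda>i. a i * sgn (z $ ix i - z $ ix (i + 1)))"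
    define y where "y k = S k - S (k - 1) + b * sgn (z $ ix k)" for k
    have "S i = - a i"
      using i a_p z[of i] z[of "i + 1"] by (cases "i = CARD('p)") (auto simp: S_def)
    moreover have "S (i - 1) = a (i - 1)"
    proof (cases "i = 1")
      case True
      then show ?thesis by (simp add: S_def a_0)
    next
      case False
      then have "i - 1 \<in> {1..CARD('p)}" "i - 1 + 1 = i" "i - 1 \<noteq> i" using i by auto
      moreover from this have "z $ ix (i - 1) = real (i - 1)" "z $ ix i = 0" using z[of "i - 1"] z[of i] i by auto
      moreover have "0 < real (i - 1)" using i False by simp
      ultimately show ?thesis by (simp only: S_def diff_0_right sgn_pos mult_1_right)
    qed
    ultimately have "y i = - (a (i - 1) + a i)" using z[of i] i by (simp add: y_def)
    moreover have "slope \<bullet> v = (\<Sum>k = 1..CARD('p). y k * v $ ix k)"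
      unfolding y_def by (rule slope_fused[OF S_def])
    moreover have "\<dots> = (\<Sum>k\<in>{i}. y k * v $ ix k)"
      using i v by (intro sum.mono_neutral_right) auto
    ultimately show ?thesis using v[of i] i by simp
  qed
  ultimately show ?thesis by simp
qed

text \<open>The certificate interpolates linearly between the ends of each block of equal coordinates of
  \<open>z\<close>; strict concavity keeps the interpolated values below \<open>a\<close> in absolute value.\<close>

lemma fused_sufficient:
  assumes concave: "strictly_concave_seq (CARD('p)) a"
    and bound: "\<And>i. 1 \<le> i \<Longrightarrow> i \<le> CARD('p) \<Longrightarrow> a (i - 1) + a i < b"
    and v: "v \<in> f_normal_space z" "v \<noteq> 0"
  shows "0 < f_slope z \<bullet> v + f_kink z v"
proof -
  interpret generalized_lasso "{1..2 * CARD('p) - 1}" "fused_row ix a b" z by (rule generalized_lasso_fused)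
  \<comment> \<open>\<open>bd i\<close> marks a cut between coordinates \<open>i\<close> and
    \<open>i + 1\<close>. The outer ends count as cuts, with \<open>B\<close> vanishing at 0 and
    \<open>CARD('p)\<close>; at inner cuts \<open>B\<close> is the value forced by the sign of the
    jump.\<close>
  define bd where "bd i \<longleftrightarrow> i = 0 \<or> i \<ge> CARD('p) \<or> z $ ix i \<noteq> z $ ix (i + 1)" for i
  define B where "B i = a i * sgn (z $ ix i - z $ ix (i + 1))" for i
  define lo where "lo i = (GREATEST k. k \<le> i \<and> bd k)" for i
  define hi where "hi i = (LEAST k. i \<le> k \<and> bd k)" for i
  define S where "S i = (if bd i then B i
    else B (lo i) + (real i - real (lo i)) / (real (hi i) - real (lo i)) * (B (hi i) - B (lo i)))" for i
  have a_nonneg: "0 \<le> a i" if "i \<le> CARD('p)" for i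
    using that a_pos a_0 a_p by (cases "i = 0 \<or> i = CARD('p)") (auto simp: less_imp_le)
  have B_le: "\<bar>B i\<bar> \<le> a i" if "i \<le> CARD('p)" for i
    using a_nonneg[OF that] by (auto simp: B_def abs_mult sgn_if)
  have block: "\<exists>l r. l < i \<and> i < r \<and> r \<le> CARD('p) \<and> bd l \<and> bd r \<and> (\<forall>k. l < k \<and> k < r \<longrightarrow> \<not> bd k)
      \<and> lo i = l \<and> hi i = r" if nb: "\<not> bd i" for i
  proof -
    have ip: "i < CARD('p)" "0 < i" using nb by (auto simp: bd_def)
    have "bd (lo i) \<and> lo i \<le> i"
      unfolding lo_def using GreatestI_nat[of "\<lambda>k. k \<le> i \<and> bd k" 0 i] by (auto simp: bd_def)
    moreover have "k \<le> lo i" if "k \<le> i" "bd k" for k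
      unfolding lo_def using Greatest_le_nat[of "\<lambda>k. k \<le> i \<and> bd k" k i] that by auto
    moreover have hi: "i \<le> hi i \<and> bd (hi i)"
      unfolding hi_def using LeastI[of "\<lambda>k. i \<le> k \<and> bd k" "CARD('p)"] ip by (auto simp: bd_def)
    moreover have "hi i \<le> k" if "i \<le> k" "bd k" for k
      unfolding hi_def using Least_le[of "\<lambda>k. i \<le> k \<and> bd k" k] that by auto
    moreover have "lo i \<noteq> i" "hi i \<noteq> i" using calculation nb by metis+
    moreover have "hi i \<le> CARD('p)" using calculation(4)[of "CARD('p)"] ip by (auto simp: bd_def)
    ultimately show ?thesis
      by (intro exI[of _ "lo i"] exI[of _ "hi i"]) (auto, metis nat_le_linear not_less order.strict_iff_order)
  qed
  \<comment> \<open>The formula also gives \<open>B\<close> at the two cuts, so one affine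
    expression covers the closed block. \<open>S_step\<close> relies on this, since the neighbours
    of \<open>i\<close> may be cuts.\<close>
  have lin: "S k = B l + (real k - real l) / (real r - real l) * (B r - B l)"
    if "bd l" "bd r" "l < r" "\<And>k. l < k \<Longrightarrow> k < r \<Longrightarrow> \<not> bd k" "l \<le> k" "k \<le> r" for l r k
  proof (cases "bd k")
    case True
    then have "k = l \<or> k = r" using that(4-6) by (metis le_neq_implies_less)
    then show ?thesis using True that(3) by (auto simp: S_def)
  next
    case False
    obtain l' r' where lr: "l' < k" "k < r'" "bd l'" "bd r'" "\<forall>m. l' < m \<and> m < r' \<longrightarrow> \<not> bd m" "lo k = l'" "hi k = r'"
      using block[OF False] by blast
    have "l < k" "k < r" using False that by (auto simp: order.order_iff_strict)
    have "l' = l"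
      using lr that \<open>l < k\<close> \<open>k < r\<close> by (metis linorder_neqE_nat order.strict_trans)
    moreover have "r' = r"
      using lr that \<open>l < k\<close> \<open>k < r\<close> by (metis linorder_neqE_nat order.strict_trans)
    ultimately show ?thesis using False lr by (simp add: S_def)
  qed
  have S_bound: "\<bar>S i\<bar> < a i" and S_step: "S (i + 1) - S i = S i - S (i - 1)" if nb: "\<not> bd i" for i
  proof -
    obtain l r where lr: "l < i" "i < r" "r \<le> CARD('p)" "bd l" "bd r" "\<forall>k. l < k \<and> k < r \<longrightarrow> \<not> bd k"
      using block[OF nb] by blast
    define t where "t = (real i - real l) / (real r - real l)"
    have t: "0 < t" "t < 1" using lr by (auto simp: t_def)
    have Sk: "S k = B l + (real k - real l) / (real r - real l) * (B r - B l)" if "l \<le> k" "k \<le> r" for k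
      using lr that by (intro lin) auto
    have "S i = (1 - t) * B l + t * B r"
      using Sk[of i] lr by (simp add: t_def[symmetric] algebra_simps)
    also have "\<bar>\<dots>\<bar> \<le> (1 - t) * \<bar>B l\<bar> + t * \<bar>B r\<bar>"
      using t abs_triangle_ineq[of "(1 - t) * B l" "t * B r"] by (simp add: abs_mult)
    also have "\<dots> \<le> (1 - t) * a l + t * a r"
      using t B_le[of l] B_le[of r] lr by (intro add_mono mult_left_mono) auto
    also have "\<dots> < a i"
      unfolding t_def using concave lr(1-3) by (rule strictly_concave_seq_interpolation)
    finally show "\<bar>S i\<bar> < a i" .
    have below: "l \<le> i - 1" "i - 1 \<le> r" using lr by auto
    have "real (i - 1) = real i - 1" using lr by (simp add: of_nat_diff)
    then show "S (i + 1) - S i = S i - S (i - 1)"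
      using Sk[of i] Sk[of "i + 1"] Sk[OF below] lr by (simp add: add_divide_distrib diff_divide_distrib algebra_simps)
  qed
  have S_le: "\<bar>S i\<bar> \<le> a i" if "i \<le> CARD('p)" for i
    using S_bound[of i] B_le[OF that] by (cases "bd i") (auto simp: S_def)
  have S0: "S 0 = 0" and Sp: "S (CARD('p)) = 0" by (auto simp: S_def bd_def B_def a_0 a_p)
  \<comment> \<open>On zero coordinates the value is chosen to make \<open>y\<close> vanish, and
    \<open>bound\<close> makes it smaller than 1 in absolute value; on nonzero coordinates it is the
    forced sign.\<close>
  define r where "r i = (if z $ ix i = 0 then - (S i - S (i - 1)) / b else sgn (z $ ix i))" for i
  define T where "T j = (if j < CARD('p) then S j / a j else r (j - (CARD('p) - 1)))" for j
  define y where "y i = S i - S (i - 1) + b * r i" for i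
  obtain x :: "real ^ 'p" where x: "\<And>i. i \<in> {1..CARD('p)} \<Longrightarrow> x $ ix i = y i"
    by (rule vec_of_coordinates[of y]) blast
  have y0: "y i = 0" if "z $ ix i = 0" for i using that b_pos by (simp add: y_def r_def)
  \<comment> \<open>Inside a block of nonzero coordinates the sign term is constant and the affine
    \<open>S\<close> has equal increments, so \<open>y\<close> respects the tie.\<close>
  have y_eq: "y i = y (i + 1)" if "\<not> bd i" for i
  proof (cases "z $ ix i = 0")
    case True
    then have "z $ ix (i + 1) = 0" using that by (auto simp: bd_def)
    then show ?thesis using y0 True by metis
  next
    case False
    then show ?thesis using S_step[OF that] that by (auto simp: y_def r_def bd_def)
  qed
  show ?thesis
  proof (rule dominated_by_certificate[OF _ _ _ _ v])
    show "T j = sgn (fused_row ix a b j \<bullet> z)" if j: "j \<in> {1..2 * CARD('p) - 1} - ties" for j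
    proof -
      have nz: "fused_map ix a b z j \<noteq> 0" using j unfolding ties_def fused_row_inner by blast
      show ?thesis
      proof (cases "j < CARD('p)")
        case True
        then have "a j > 0" using a_pos j by auto
        moreover have "bd j" using nz True by (auto simp: fused_map_def bd_def)
        ultimately show ?thesis using True by (simp add: T_def S_def B_def fused_row_inner fused_map_def sgn_mult)
      next
        case False
        then show ?thesis using nz b_pos by (auto simp: T_def r_def fused_row_inner fused_map_def sgn_mult)
      qed
    qed
    have tieD: "j \<in> {1..2 * CARD('p) - 1}" "fused_map ix a b z j = 0" if "j \<in> ties" for j
      using that unfolding ties_def fused_row_inner by blast+
    have tie_difference: "a j > 0" "\<not> bd j" "1 \<le> j" if j: "j \<in> ties" "j < CARD('p)" for j
    proof -
      show "1 \<le> j" using tieD(1)[OF j(1)] by simp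
      then show "a j > 0" using a_pos j(2) by simp
      then show "\<not> bd j" using tieD(2)[OF j(1)] j(2) \<open>1 \<le> j\<close> by (simp add: fused_map_def bd_def)
    qed
    have tie_zero: "z $ ix (j - (CARD('p) - 1)) = 0" "j - (CARD('p) - 1) \<in> {1..CARD('p)}"
      if j: "j \<in> ties" "\<not> j < CARD('p)" for j
      using tieD[OF j(1)] j(2) b_pos by (auto simp: fused_map_def)
    show "\<bar>T j\<bar> < 1" if j: "j \<in> ties" for j
    proof (cases "j < CARD('p)")
      case True
      then show ?thesis using tie_difference(1,2)[OF j True] S_bound[of j] by (simp add: T_def)
    next
      case False
      define i where "i = j - (CARD('p) - 1)"
      have i: "1 \<le> i" "i \<le> CARD('p)" and "z $ ix i = 0" using tie_zero[OF j False] by (auto simp: i_def)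
      then have "T j = - (S i - S (i - 1)) / b" using False by (simp add: T_def r_def i_def)
      moreover have "\<bar>S i - S (i - 1)\<bar> < b" using S_le[of i] S_le[of "i - 1"] bound[OF i] i by linarith
      ultimately show ?thesis using b_pos by (simp add: abs_divide)
    qed
    show "x \<in> tie_space"
      unfolding tie_space_def fused_row_inner
    proof (intro CollectI ballI)
      fix j assume j: "j \<in> ties"
      show "fused_map ix a b x j = 0"
      proof (cases "j < CARD('p)")
        case True
        then show ?thesis using tie_difference(2,3)[OF j True] y_eq[of j] x[of j] x[of "j + 1"]
          by (simp add: fused_map_def)
      next
        case False
        then show ?thesis using y0[OF tie_zero(1)[OF j False]] x[OF tie_zero(2)[OF j False]]
          by (simp add: fused_map_def)
      qed
    qed
    show "(\<Sum>j\<in>{1..2 * CARD('p) - 1}. T j * (fused_row ix a b j \<bullet> v)) = x \<bullet> v" for v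
    proof -
      have "(\<Sum>j\<in>{1..2 * CARD('p) - 1}. T j * fused_map ix a b v j)
          = (\<Sum>i = 1..CARD('p). (S i - S (i - 1) + b * T (i + (CARD('p) - 1))) * v $ ix i)"
      proof (rule sum_fused_map[OF _ S0 Sp])
        show "S i = a i * T i" if "i \<in> {1..<CARD('p)}" for i
        proof -
          have "a i > 0" using a_pos that by blast
          then show ?thesis using that by (simp add: T_def)
        qed
      qed
      also have "\<dots> = (\<Sum>i = 1..CARD('p). x $ ix i * v $ ix i)"
        by (intro sum.cong) (auto simp: x y_def T_def)
      finally show ?thesis unfolding fused_row_inner inner_coordinates[of x v] .
    qed
  qed
qed

theorem fused_dominated_iff:
  "(\<forall>z. \<forall>v\<in>f_normal_space z - {0}. 0 < f_slope z \<bullet> v + f_kink z v) \<longleftrightarrow>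
    strictly_concave_seq (CARD('p)) a \<and> b > Max ((\<lambda>i. a i + a (i + 1)) ` {0..CARD('p) - 1})"
    (is "?lhs \<longleftrightarrow> ?concave \<and> ?bound")
proof -
  have bound: "?bound \<longleftrightarrow> (\<forall>i. 1 \<le> i \<and> i \<le> CARD('p) \<longrightarrow> a (i - 1) + a i < b)"
  proof -
    have "?bound \<longleftrightarrow> (\<forall>i\<in>{0..CARD('p) - 1}. a i + a (i + 1) < b)"
      by (subst Max_less_iff) auto
    also have "\<dots> \<longleftrightarrow> (\<forall>i. 1 \<le> i \<and> i \<le> CARD('p) \<longrightarrow> a (i - 1) + a i < b)"
    proof (intro iffI allI impI ballI)
      fix i assume "\<forall>i\<in>{0..CARD('p) - 1}. a i + a (i + 1) < b" "1 \<le> i \<and> i \<le> CARD('p)"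
      moreover from this(2) have "i - 1 \<in> {0..CARD('p) - 1}" "i - 1 + 1 = i" by auto
      ultimately show "a (i - 1) + a i < b" by metis
    next
      fix i assume *: "\<forall>i. 1 \<le> i \<and> i \<le> CARD('p) \<longrightarrow> a (i - 1) + a i < b" and "i \<in> {0..CARD('p) - 1}"
      then have "i \<le> CARD('p) - 1" by simp
      with card_ge_1 have "i + 1 \<le> CARD('p)" by linarith
      then show "a i + a (i + 1) < b" using *[rule_format, of "i + 1"] by simp
    qed
    finally show ?thesis .
  qed
  show ?thesis
  proof
    assume ?lhs
    then have cond: "0 < f_slope z \<bullet> v + f_kink z v" if "v \<in> f_normal_space z" "v \<noteq> 0" for z v
      using that by blast
    show "?concave \<and> ?bound"
      unfolding bound
      using strictly_concave_seqI[OF card_ge_1 fused_necessary_concave[OF cond]] fused_necessary_bound[OF cond]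
      by blast
  next
    assume "?concave \<and> ?bound"
    then show ?lhs unfolding bound using fused_sufficient by blast
  qed
qed

end

section \<open>From the stated model to the abstract one\<close>

lemma (in prob_space) standardized_second_moments:
  fixes Z :: "'a \<Rightarrow> real ^ 'p::finite"
  assumes [measurable]: "random_variable borel Z"
    and sq: "integrable M (\<lambda>\<omega>. (norm (Z \<omega>))\<^sup>2)"
    and mean: "expectation Z = 0" and cov: "covariance_matrix M Z = mat 1"
  shows "expectation (\<lambda>\<omega>. (Z \<omega> \<bullet> u) * (Z \<omega> \<bullet> v)) = u \<bullet> v"
proof -
  have [measurable]: "random_variable borel (\<lambda>\<omega>. Z \<omega> $ j)" for j
    unfolding cart_eq_inner_axis by measurable
  have "integrable M (\<lambda>\<omega>. norm (Z \<omega>))"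
    using sq by (rule square_integrable_imp_integrable[rotated]) measurable
  then have "integrable M Z" by (simp add: integrable_norm_iff)
  then have mean_nth: "expectation (\<lambda>\<omega>. Z \<omega> $ j) = 0" for j
    using integral_bounded_linear[OF bounded_linear_vec_nth[of j], of M Z] mean by simp
  have cov_nth: "expectation (\<lambda>\<omega>. Z \<omega> $ j * Z \<omega> $ k) = (if j = k then 1 else 0)" for j k
  proof -
    have "covariance_matrix M Z $ j $ k = expectation (\<lambda>\<omega>. Z \<omega> $ j * Z \<omega> $ k)"
      by (simp add: covariance_matrix_def mean_nth)
    then show ?thesis unfolding cov by (simp add: mat_def)
  qed
  have int: "integrable M (\<lambda>\<omega>. Z \<omega> $ j * Z \<omega> $ k)" for j k
  proof (rule Bochner_Integration.integrable_bound[OF sq])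
    have "\<bar>x $ j * x $ k\<bar> \<le> (norm x)\<^sup>2" for x :: "real ^ 'p"
      unfolding abs_mult power2_eq_square by (intro mult_mono component_le_norm_cart) auto
    then show "AE \<omega> in M. norm (Z \<omega> $ j * Z \<omega> $ k) \<le> norm ((norm (Z \<omega>))\<^sup>2)"
      by (intro AE_I2) simp
  qed measurable
  have "(Z \<omega> \<bullet> u) * (Z \<omega> \<bullet> v) = (\<Sum>j\<in>UNIV. \<Sum>k\<in>UNIV. u $ j * v $ k * (Z \<omega> $ j * Z \<omega> $ k))" for \<omega>
    by (simp add: inner_vec_def sum_product mult_ac)
  then have "expectation (\<lambda>\<omega>. (Z \<omega> \<bullet> u) * (Z \<omega> \<bullet> v))
      = (\<Sum>j\<in>UNIV. \<Sum>k\<in>UNIV. u $ j * v $ k * expectation (\<lambda>\<omega>. Z \<omega> $ j * Z \<omega> $ k))"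
    by (simp only: Bochner_Integration.integral_sum Bochner_Integration.integrable_sum
        integrable_mult_right int integral_mult_right_zero)
  also have "\<dots> = u \<bullet> v"
    unfolding cov_nth by (simp add: inner_vec_def if_distrib cong: if_cong)
  finally show ?thesis .
qed

theorem proposition4p4:
  fixes M :: "'w measure"
    and X :: "nat \<Rightarrow> 'w \<Rightarrow> real ^ 'p::finite"
    and \<epsilon> :: "nat \<Rightarrow> 'w \<Rightarrow> real"
    and \<sigma> b :: real
    and a :: "nat \<Rightarrow> real"
    and ix :: "nat \<Rightarrow> 'p"
    and \<beta>hat :: "real ^ 'p \<Rightarrow> real \<Rightarrow> nat \<Rightarrow> 'w \<Rightarrow> real ^ 'p"
  assumes "prob_space M"
    and "bij_betw ix {1..CARD('p)} UNIV"
    \<comment> \<open>\<open>X\<close> is an i.i.d. sequence of centered random vectors with covariance matrix \<open>\<bbbI>\<close>\<close>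
    and "prob_space.indep_vars M (\<lambda>_. borel) X UNIV"
    and "\<forall>i. distr M borel (X i) = distr M borel (X 0)"
    and "\<forall>i. integrable M (\<lambda>\<omega>. (norm (X i \<omega>))\<^sup>2)"
    and "\<forall>i. prob_space.expectation M (X i) = 0"
    and "\<forall>i. covariance_matrix M (X i) = mat 1"
    \<comment> \<open>\<open>\<epsilon>\<close> is an i.i.d. sequence of centered random variables with variance \<open>\<sigma>\<^sup>2\<close>\<close>
    and "prob_space.indep_vars M (\<lambda>_. borel) \<epsilon> UNIV"
    and "\<forall>i. distr M borel (\<epsilon> i) = distr M borel (\<epsilon> 0)"
    and "\<forall>i. integrable M (\<lambda>\<omega>. (\<epsilon> i \<omega>)\<^sup>2)"
    and "\<forall>i. prob_space.expectation M (\<epsilon> i) = 0"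
    and "\<forall>i. prob_space.variance M (\<epsilon> i) = \<sigma>\<^sup>2"
    and "\<sigma>\<^sup>2 > 0"
    \<comment> \<open>the two sequences are independent: so are the sigma-algebras that they generate\<close>
    and "prob_space.indep_set M
           (sets (vimage_algebra (space M) (\<lambda>\<omega> i. X i \<omega>) (Pi\<^sub>M UNIV (\<lambda>_. borel))))
           (sets (vimage_algebra (space M) (\<lambda>\<omega> i. \<epsilon> i \<omega>) (Pi\<^sub>M UNIV (\<lambda>_. borel))))"
    and "\<forall>i\<in>{1..<CARD('p)}. a i > 0"
    and "a 0 = 0" and "a (CARD('p)) = 0"
    and "b > 0"
    \<comment> \<open>\<open>\<beta>hat \<beta>\<^sub>0 lam n\<close> is the estimator when the true parameter is \<open>\<beta>\<^sub>0\<close>\<close>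
    and "\<forall>\<beta>\<^sub>0. \<forall>lam>0. \<forall>n. \<beta>hat \<beta>\<^sub>0 lam n \<in> borel_measurable M"
    and "\<forall>\<beta>\<^sub>0. \<forall>lam>0. \<forall>n. \<forall>\<omega>\<in>space M.
           is_arg_min
             (fused_objective ix a b lam n (\<lambda>i. X i \<omega>) (\<lambda>i. response X \<epsilon> \<beta>\<^sub>0 i \<omega>))
             (\<lambda>_. True) (\<beta>hat \<beta>\<^sub>0 lam n \<omega>)"
  shows "(\<forall>\<beta>\<^sub>0. \<exists>L :: real \<Rightarrow> real.
            (\<forall>lam>0. (\<lambda>n. measure M {\<omega> \<in> space M.
                       fused_pattern ix a b lam (\<beta>hat \<beta>\<^sub>0 lam n \<omega>) = fused_pattern ix a b lam \<beta>\<^sub>0})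
                     \<longlonglongrightarrow> L lam) \<and>
            (L \<longlongrightarrow> 1) at_top)
         \<longleftrightarrow>
         strictly_concave_seq (CARD('p)) a \<and>
         b > Max ((\<lambda>i. a i + a (i + 1)) ` {0..CARD('p) - 1})"
proof -
  interpret prob_space M by fact
  let ?J = "{1..2 * CARD('p) - 1}" and ?l = "fused_row ix a b"
  have X_rv: "random_variable borel (X i)" for i
    using assms(3) by (simp add: indep_vars_def)
  \<comment> \<open>The true parameter is also the point \<open>z\<close> at which the penalty is
    expanded, so every truth gets its own instance.\<close>
  have model: "generalized_lasso_model M X \<epsilon> \<sigma> ?J ?l z (\<beta>hat z)" for z
  proof (intro generalized_lasso_model.intro generalized_lasso_model_axioms.intro
      standard_linear_model.intro standard_linear_model_axioms.intro)
    show "prob_space M" by fact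
    show "generalized_lasso ?J" by unfold_locales simp
    show "indep_vars (\<lambda>_. borel) X UNIV" by fact
    show "distr M borel (X i) = distr M borel (X 0)" for i using assms(4) by blast
    show "integrable M (\<lambda>\<omega>. (norm (X i \<omega>))\<^sup>2)" for i using assms(5) by blast
    show "expectation (\<lambda>\<omega>. (X i \<omega> \<bullet> u) * (X i \<omega> \<bullet> v)) = u \<bullet> v" for i u v
      using assms(5-7) X_rv by (intro standardized_second_moments) auto
    show "indep_vars (\<lambda>_. borel) \<epsilon> UNIV" by fact
    show "distr M borel (\<epsilon> i) = distr M borel (\<epsilon> 0)" for i using assms(9) by blast
    show "integrable M (\<lambda>\<omega>. (\<epsilon> i \<omega>)\<^sup>2)" for i using assms(10) by blast
    show "expectation (\<epsilon> i) = 0" for i using assms(11) by blast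
    show "expectation (\<lambda>\<omega>. (\<epsilon> i \<omega>)\<^sup>2) = \<sigma>\<^sup>2" for i
      using assms(11)[rule_format, of i] assms(12)[rule_format, of i] by simp
    show "\<sigma> \<noteq> 0" using assms(13) by auto
    show "indep_set (sets (vimage_algebra (space M) (\<lambda>\<omega> i. X i \<omega>) (Pi\<^sub>M UNIV (\<lambda>_. borel))))
        (sets (vimage_algebra (space M) (\<lambda>\<omega> i. \<epsilon> i \<omega>) (Pi\<^sub>M UNIV (\<lambda>_. borel))))" by fact
    show "random_variable borel (\<beta>hat z lam n)" if "lam > 0" for lam n using assms(19) that by blast
    fix lam :: real and n \<omega> \<beta> assume "lam > 0" "\<omega> \<in> space M"
    then have "fused_objective ix a b lam n (\<lambda>i. X i \<omega>) (\<lambda>i. response X \<epsilon> z i \<omega>) (\<beta>hat z lam n \<omega>)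
        \<le> fused_objective ix a b lam n (\<lambda>i. X i \<omega>) (\<lambda>i. response X \<epsilon> z i \<omega>) \<beta>"
      using assms(20) unfolding is_arg_min_def by (meson not_less)
    moreover have "fused_objective ix a b lam n (\<lambda>i. X i \<omega>) (\<lambda>i. response X \<epsilon> z i \<omega>) \<beta>
        = 1 / 2 * (\<Sum>i<n. (X i \<omega> \<bullet> z + \<epsilon> i \<omega> - X i \<omega> \<bullet> \<beta>)\<^sup>2)
          + sqrt (real n) * (lam * generalized_lasso.penalty ?J ?l \<beta>)" for \<beta>
      by (simp only: fused_objective_def response_def fused_penalty_def fused_row_inner
          generalized_lasso.penalty_def[OF \<open>generalized_lasso ?J\<close>])
    ultimately show "1 / 2 * (\<Sum>i<n. (X i \<omega> \<bullet> z + \<epsilon> i \<omega> - X i \<omega> \<bullet> \<beta>hat z lam n \<omega>)\<^sup>2)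
          + sqrt (real n) * (lam * generalized_lasso.penalty ?J ?l (\<beta>hat z lam n \<omega>))
        \<le> 1 / 2 * (\<Sum>i<n. (X i \<omega> \<bullet> z + \<epsilon> i \<omega> - X i \<omega> \<bullet> \<beta>)\<^sup>2)
          + sqrt (real n) * (lam * generalized_lasso.penalty ?J ?l \<beta>)"
      by simp
  qed
  have recovery: "(\<exists>L. (\<forall>lam>0. (\<lambda>n. measure M {\<omega> \<in> space M.
        fused_pattern ix a b lam (\<beta>hat z lam n \<omega>) = fused_pattern ix a b lam z}) \<longlonglongrightarrow> L lam)
        \<and> (L \<longlongrightarrow> 1) at_top)
    \<longleftrightarrow> (\<forall>v\<in>generalized_lasso.normal_space ?J ?l z - {0}.
          0 < generalized_lasso.slope ?J ?l z \<bullet> v + generalized_lasso.kink ?J ?l z v)" for z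
  proof -
    interpret generalized_lasso_model M X \<epsilon> \<sigma> ?J ?l z "\<beta>hat z" by (rule model)
    \<comment> \<open>For positive \<open>lam\<close>, equal patterns mean equal signs of all rows,
      so the two events coincide as sets.\<close>
    have "{\<omega> \<in> space M. fused_pattern ix a b lam (\<beta>hat z lam n \<omega>) = fused_pattern ix a b lam z}
        = recovery lam n" if "lam > 0" for lam n
      unfolding recovery_def same_signs_def fused_row_inner fused_pattern_eq_iff[OF that] ..
    then show ?thesis unfolding asymptotic_recovery_iff[symmetric] by simp
  qed
  show ?thesis
    unfolding recovery by (rule fused_dominated_iff[OF assms(2,15-18)])
qed

end
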